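(* Let $n\in\mathbb{N}_+=\{1,2,\dots\}$, let $1\le q\le\infty$, and let $f\in\mathcal{S}'(\mathbb{R}^d)$ be such that its Wigner distribution satisfies $Wf\in M^{\infty,q}(\mathbb{R}^{2d})$. Let $(z,\zeta)\in\mathbb{R}^{2d}\times\mathbb{R}^{2d}$, with $\zeta=(\zeta_1,\zeta_2)\in\mathbb{R}^d\times\mathbb{R}^d$ satisfying $\zeta_1\cdot\zeta_2\neq0$. Then $(z,\zeta)\notin WF_{\mathcal{F}L^q_{2n}}(Q^nf)$, where $Q^n f$ is the Born--Jordan distribution of order $n$ of $f$.
   Context: Write $x\omega=x\cdot\omega$ for the scalar product in $\mathbb{R}^d$. The Wigner distribution of $f$ is $Wf(x,\omega)=\int_{\mathbb{R}^d} f(x+\frac y2)\overline{f(x-\frac y2)}e^{-2\pi i y\omega}\,dy$, $(x,\omega)\in\mathbb{R}^{2d}$, extended to $f\in\mathcal{S}'(\mathbb{R}^d)$ in the usual distributional sense (a linear change of variables in $f\otimes\overline f$ followed by a partial Fourier transform), so that $Wf\in\mathcal{S}'(\mathbb{R}^{2d})$. The symplectic form is $\sigma((x,\omega),(\zeta_1,\zeta_2))=\omega\cdot\zeta_1-x\cdot\zeta_2$, and the symplectic Fourier transform on $\mathbb{R}^{2d}$ is $\mathcal{F}_\sigma F(\zeta)=\int_{\mathbb{R}^{2d}}e^{-2\pi i\sigma(\zeta,z)}F(z)\,dz$ (extended to tempered distributions); it is an involution. Let $\mathrm{sinc}(t)=\frac{\sin(\pi t)}{\pi t}$ for $t\ne0$,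 $\mathrm{sinc}(0)=1$, and $\Theta^n(x,\omega)=\mathrm{sinc}^n(x\cdot\omega)$ on $\mathbb{R}^{2d}$. The Born--Jordan distribution of order $n$ is $Q^nf=Wf*\mathcal{F}_\sigma(\Theta^n)$; equivalently, $Q^n f$ is the tempered distribution with $\mathcal{F}_\sigma(Q^nf)=\Theta^n\cdot\mathcal{F}_\sigma(Wf)$ (the product makes sense since $\Theta^n$ is smooth with all derivatives of at most polynomial growth). Modulation spaces: for a fixed $g\in\mathcal{S}(\mathbb{R}^m)\setminus\{0\}$, let $V_gF(x,\omega)=\int_{\mathbb{R}^m}F(y)\overline{g(y-x)}e^{-2\pi i y\omega}\,dy$. $M^{p,q}(\mathbb{R}^m)$ is the space of $F\in\mathcal{S}'(\mathbb{R}^m)$ with $\|F\|_{M^{p,q}}=\big(\int(\int|V_gF(x,\omega)|^p\,dx)^{q/p}d\omega\big)^{1/q}<\infty$ (usual modification if $p=\infty$ or $q=\infty$); different $g$ give equivalent norms. Fourier--Lebesgue wave-front set: let $\mathcal{F}F(\omega)=\int e^{-2\pi i x\omega}F(x)\,dx$ and $\langle\omega\rangle=(1+|\omega|^2)^{1/2}$. For $F\in\mathcal{S}'(\mathbb{R}^m)$, $s\in\mathbb{R}$, $1\le q\le\infty$, the set $WF_{\mathcal{F}L^q_s}(F)\subset\mathbb{R}^m\times(\mathbb{R}^m\setminus\{0\})$ is the set of points $(x_0,\omega_0)$, $\omega_0\ne0$, for which the following condition is NOT satisfied: there exist $\varphi\in C_c^\infty(\mathbb{R}^m)$ with $\varphi(x_0)\neq0$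 and an open conic neighbourhood $\Gamma\subset\mathbb{R}^m\setminus\{0\}$ of $\omega_0$ such that $\|\mathcal{F}[\varphi F](\omega)\langle\omega\rangle^s\|_{L^q(\Gamma)}<\infty$. *)

theory Defs
  imports "HOL-Analysis.Analysis" "HOL-Probability.Essential_Supremum"
begin

section \<open>Schwartz functions and tempered distributions\<close>

text \<open>
  Iterated partial derivative of \<open>f\<close> along the list of directions \<open>vs\<close>. With \<open>vs\<close> ranging over
  lists of basis vectors these are exactly the partial derivatives of multi-index order.
\<close>

primrec iter_deriv ::
    "'a::euclidean_space list \<Rightarrow> ('a \<Rightarrow> complex) \<Rightarrow> 'a \<Rightarrow> complex" where
  "iter_deriv [] f = f"
| "iter_deriv (v # vs) f = (\<lambda>x. frechet_derivative (iter_deriv vs f) (at x) v)"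

text \<open>
  Every iterated partial derivative is differentiable at every point, hence also continuous.
\<close>

definition smooth :: "('a::euclidean_space \<Rightarrow> complex) \<Rightarrow> bool" where
  "smooth f \<longleftrightarrow> (\<forall>vs\<in>lists Basis. \<forall>x. iter_deriv vs f differentiable (at x))"

definition test_fun :: "('a::euclidean_space \<Rightarrow> complex) \<Rightarrow> bool" where
  "test_fun \<phi> \<longleftrightarrow> smooth \<phi> \<and> compact (closure {x. \<phi> x \<noteq> 0})"

definition schwartz :: "('a::euclidean_space \<Rightarrow> complex) \<Rightarrow> bool" where
  "schwartz \<phi> \<longleftrightarrow> smooth \<phi> \<and>
     (\<forall>k::nat. \<forall>vs\<in>lists Basis.
        bdd_above (range (\<lambda>x. (1 + norm x) ^ k * norm (iter_deriv vs \<phi> x))))"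

definition schwartz_seminorm ::
    "nat \<Rightarrow> 'a::euclidean_space list \<Rightarrow> ('a \<Rightarrow> complex) \<Rightarrow> real" where
  "schwartz_seminorm k vs \<phi> = (SUP x. (1 + norm x) ^ k * norm (iter_deriv vs \<phi> x))"

text \<open>
  Distributions are functionals for the bilinear (not sesquilinear) pairing. They are total
  HOL functions, but only their values on Schwartz functions are meaningful.
\<close>

type_synonym 'a distr = "('a \<Rightarrow> complex) \<Rightarrow> complex"

text \<open>
  Linear functionals on the Schwartz space that are continuous for the topology generated by
  the seminorms.
\<close>

definition tempered :: "'a::euclidean_space distr \<Rightarrow> bool" where
  "tempered T \<longleftrightarrow>
     (\<forall>\<phi> \<psi>. schwartz \<phi> \<longrightarrow> schwartz \<psi> \<longrightarrow> T (\<lambda>x. \<phi> x + \<psi> x) = T \<phi> + T \<psi>) \<and>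
     (\<forall>c \<phi>. schwartz \<phi> \<longrightarrow> T (\<lambda>x. c * \<phi> x) = c * T \<phi>) \<and>
     (\<exists>C N. \<forall>\<phi>. schwartz \<phi> \<longrightarrow>
        norm (T \<phi>) \<le> C * (\<Sum>vs | vs \<in> lists Basis \<and> length vs \<le> N. schwartz_seminorm N vs \<phi>))"

definition distr_of_fun :: "('a::euclidean_space \<Rightarrow> complex) \<Rightarrow> 'a distr" where
  "distr_of_fun h = (\<lambda>\<phi>. \<integral>x. h x * \<phi> x \<partial>lborel)"

definition distr_cnj :: "'a::euclidean_space distr \<Rightarrow> 'a distr" where
  "distr_cnj T = (\<lambda>\<phi>. cnj (T (\<lambda>x. cnj (\<phi> x))))"

definition distr_tensor ::
    "'a::euclidean_space distr \<Rightarrow> 'b::euclidean_space distr \<Rightarrow> ('a \<times> 'b) distr" where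
  "distr_tensor S T = (\<lambda>\<Phi>. S (\<lambda>u. T (\<lambda>v. \<Phi> (u, v))))"

text \<open>
  Convolution of a tempered distribution \<open>T\<close> with a rapidly decreasing distribution \<open>S\<close>
  (for such \<open>S\<close> the function of \<open>x\<close> below is again Schwartz when \<open>\<phi>\<close> is).
\<close>

definition distr_conv :: "'a::euclidean_space distr \<Rightarrow> 'a distr \<Rightarrow> 'a distr" where
  "distr_conv T S = (\<lambda>\<phi>. T (\<lambda>x. S (\<lambda>y. \<phi> (x + y))))"


section \<open>Wigner and Born--Jordan distributions\<close>

definition partial_fourier ::
    "('a::euclidean_space \<times> 'a \<Rightarrow> complex) \<Rightarrow> 'a \<times> 'a \<Rightarrow> complex" where
  "partial_fourier \<Phi> = (\<lambda>(x, y). \<integral>\<omega>. cis (- 2 * pi * (y \<bullet> \<omega>)) * \<Phi> (x, \<omega>) \<partial>lborel)"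

definition distr_partial_fourier ::
    "('a::euclidean_space \<times> 'a) distr \<Rightarrow> ('a \<times> 'a) distr" where
  "distr_partial_fourier T = (\<lambda>\<Phi>. T (partial_fourier \<Phi>))"

text \<open>
  The pullback \<open>F(x + y/2, x - y/2)\<close> of a distribution \<open>F\<close> in \<open>(u, v)\<close>: the test function is
  composed with the inverse substitution \<open>x = (u + v)/2\<close>, \<open>y = u - v\<close>; the Jacobian has absolute
  value 1.
\<close>

definition distr_wigner_subst ::
    "('a::euclidean_space \<times> 'a) distr \<Rightarrow> ('a \<times> 'a) distr" where
  "distr_wigner_subst F = (\<lambda>\<Phi>. F (\<lambda>(u, v). \<Phi> ((1 / 2) *\<^sub>R (u + v), u - v)))"

definition wigner :: "'a::euclidean_space distr \<Rightarrow> ('a \<times> 'a) distr" where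
  "wigner f = distr_partial_fourier (distr_wigner_subst (distr_tensor f (distr_cnj f)))"

definition symp :: "'a::euclidean_space \<times> 'a \<Rightarrow> 'a \<times> 'a \<Rightarrow> real" where
  "symp z \<zeta> = snd z \<bullet> fst \<zeta> - fst z \<bullet> snd \<zeta>"

text \<open>
  For a function \<open>F\<close>, \<open>\<F>\<^sub>\<sigma> F(\<zeta>) = \<integral> exp(-2\<pi>i \<sigma>(\<zeta>,z)) F(z) dz\<close>. On distributions one
  takes the transpose; as \<open>\<sigma>\<close> is antisymmetric, the kernel is integrated against the test
  function in its first argument, so this is not \<open>T(\<F>\<^sub>\<sigma> \<phi>)\<close> but \<open>T\<close> applied to its reflection.
\<close>

definition distr_symp_fourier ::
    "('a::euclidean_space \<times> 'a) distr \<Rightarrow> ('a \<times> 'a) distr" where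
  "distr_symp_fourier T = (\<lambda>\<phi>. T (\<lambda>z. \<integral>\<zeta>. cis (- 2 * pi * symp \<zeta> z) * \<phi> \<zeta> \<partial>lborel))"

definition nsinc :: "real \<Rightarrow> real" where
  "nsinc t = (if t = 0 then 1 else sin (pi * t) / (pi * t))"

definition bj_kernel :: "nat \<Rightarrow> 'a::euclidean_space \<times> 'a \<Rightarrow> complex" where
  "bj_kernel n = (\<lambda>(x, \<omega>). complex_of_real (nsinc (x \<bullet> \<omega>) ^ n))"

definition born_jordan :: "nat \<Rightarrow> 'a::euclidean_space distr \<Rightarrow> ('a \<times> 'a) distr" where
  "born_jordan n f =
     distr_conv (wigner f) (distr_symp_fourier (distr_of_fun (bj_kernel n)))"


section \<open>Modulation spaces\<close>

text \<open>Power of an extended nonnegative number, for real exponents \<open>r > 0\<close>.\<close>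

definition epowr :: "ennreal \<Rightarrow> real \<Rightarrow> ennreal" where
  "epowr x r = (if x = \<infinity> then \<infinity> else ennreal (enn2real x powr r))"

definition Lp_enorm :: "ennreal \<Rightarrow> 'a measure \<Rightarrow> ('a \<Rightarrow> ennreal) \<Rightarrow> ennreal" where
  "Lp_enorm p M h =
     (if p = \<infinity> then esssup M h
      else epowr (\<integral>\<^sup>+x. epowr (h x) (enn2real p) \<partial>M) (1 / enn2real p))"

definition stft ::
    "('a::euclidean_space \<Rightarrow> complex) \<Rightarrow> 'a distr \<Rightarrow> 'a \<Rightarrow> 'a \<Rightarrow> complex" where
  "stft g F x \<omega> = F (\<lambda>y. cnj (g (y - x)) * cis (- 2 * pi * (y \<bullet> \<omega>)))"

definition modulation_norm ::
    "('a::euclidean_space \<Rightarrow> complex) \<Rightarrow> ennreal \<Rightarrow> ennreal \<Rightarrow> 'a distr \<Rightarrow> ennreal" where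
  "modulation_norm g p q F =
     Lp_enorm q lborel (\<lambda>\<omega>. Lp_enorm p lborel (\<lambda>x. ennreal (norm (stft g F x \<omega>))))"

text \<open>
  For \<open>1 \<le> p, q \<le> \<infinity>\<close> all nonzero Schwartz windows give equivalent norms, so the space does not
  depend on the window \<open>g\<close>.
\<close>

definition modulation_space :: "ennreal \<Rightarrow> ennreal \<Rightarrow> 'a::euclidean_space distr set" where
  "modulation_space p q =
     {F. tempered F \<and>
        (\<exists>g. schwartz g \<and> g \<noteq> (\<lambda>_. 0) \<and> modulation_norm g p q F < \<infinity>)}"


section \<open>Fourier--Lebesgue wave-front set\<close>

text \<open>
  The Fourier transform of the compactly supported distribution \<open>\<phi>F\<close>, which is the smooth
  function obtained by pairing \<open>F\<close> with \<open>\<phi>\<close> times the exponential.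
\<close>

definition localized_fourier ::
    "('a::euclidean_space \<Rightarrow> complex) \<Rightarrow> 'a distr \<Rightarrow> 'a \<Rightarrow> complex" where
  "localized_fourier \<phi> F \<omega> = F (\<lambda>x. \<phi> x * cis (- 2 * pi * (x \<bullet> \<omega>)))"

definition jbracket :: "'a::euclidean_space \<Rightarrow> real" where
  "jbracket \<omega> = sqrt (1 + (norm \<omega>)\<^sup>2)"

text \<open>Unlike cones for the library predicate \<open>conic\<close>, these do not contain the origin.\<close>

definition open_conic_nbhd :: "'a::euclidean_space \<Rightarrow> 'a set \<Rightarrow> bool" where
  "open_conic_nbhd \<omega>\<^sub>0 \<Gamma> \<longleftrightarrow>
     open \<Gamma> \<and> 0 \<notin> \<Gamma> \<and> \<omega>\<^sub>0 \<in> \<Gamma> \<and> (\<forall>\<omega>\<in>\<Gamma>. \<forall>t>0. t *\<^sub>R \<omega> \<in> \<Gamma>)"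

definition WF_FL :: "ennreal \<Rightarrow> real \<Rightarrow> 'a::euclidean_space distr \<Rightarrow> ('a \<times> 'a) set" where
  "WF_FL q s F =
     {(x\<^sub>0, \<omega>\<^sub>0). \<omega>\<^sub>0 \<noteq> 0 \<and>
        \<not> (\<exists>\<phi> \<Gamma>. test_fun \<phi> \<and> \<phi> x\<^sub>0 \<noteq> 0 \<and> open_conic_nbhd \<omega>\<^sub>0 \<Gamma> \<and>
              Lp_enorm q (restrict_space lborel \<Gamma>)
                (\<lambda>\<omega>. ennreal (norm (localized_fourier \<phi> F \<omega>) * jbracket \<omega> powr s)) < \<infinity>)}"

end

theory Submission
  imports Defs "HOL-Probability.Probability"
begin

text \<open>
  Let \<open>\<phi>\<close> be a cut-off function, \<open>W = Wf\<close> and \<open>[\<omega>] = \<omega>\<^sub>1 \<cdot> \<omega>\<^sub>2\<close>. The Fourier transform of \<open>\<phi> Q\<^sup>nf\<close> at \<open>\<omega>\<close> is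
  \<open>W\<close> applied to a Fourier integral with amplitude \<open>sinc\<^sup>n [\<eta> - \<omega>] \<theta>(\<eta>)\<close>, where \<open>\<theta>\<close> is a Schwartz
  function obtained from the Fourier transform of \<open>\<phi>\<close>. Expanding it in time-frequency shifts of a
  window \<open>g\<close> bounds it by the convolution of \<open>\<omega> \<mapsto> sup\<^sub>x |V\<^sub>gW(x, \<omega>)|\<close>, which belongs to \<open>L\<^sup>q\<close>, with an
  amplitude norm. Now sinc is an average of the characters \<open>t \<mapsto> cis (\<pi> r t)\<close>, \<open>|r| \<le> 1\<close>, and replacing the
  chirp \<open>cis (\<pi> r [\<eta>])\<close> by \<open>cis (\<pi> r [\<eta> - \<omega>])\<close> does not change the amplitude norm. Hence the estimate is
  uniform in \<open>\<omega>\<close>. Finally \<open>t sinc t = sin (\<pi> t) / \<pi>\<close> at \<open>t = [\<eta> - \<omega>]\<close>, where \<open>t - [\<omega>]\<close> is only linear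
  in \<open>\<omega>\<close>, so that each factor sinc gains two powers of \<open>|\<omega>|\<close> in a cone on which \<open>[\<omega>]\<close> is elliptic,
  and Young's inequality applies.
\<close>

section \<open>A calculus of smooth functions\<close>

text \<open>The derivatives of \<open>\<eta> \<mapsto> nsinc (qf (\<eta> - \<omega>))\<close> can
  grow with \<open>\<omega>\<close>, so Schwartz seminorms of the amplitude would lose powers of
  \<open>\<omega>\<close>. For a chirp the loss comes from its linear phase, which merely translates
  the transform in position. Amplitudes are therefore measured by an L^1 norm in position, dual to a
  bound of the short-time transform of \<open>W\<close> that is uniform in position.

  \<open>W\<close> is a functional whose values are meaningful on Schwartz functions only.
  Exchanging it with integrals over time-frequency shifts rests on smooth families of Schwartz
  functions with explicit growth in the parameter. The window \<open>g\<close> is the one provided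
  by the modulation norm; the expansion calls for a partner \<open>b\<close> with nonzero pairing.
  It is the Fourier transform of \<open>g\<close>, and the pairing is nonzero by injectivity of that
  transform.

  The recurring exponent \<open>2 * DIM\<close> is one for which \<open>1 / (1 + norm x) ^ k\<close>
  is integrable by comparison with a product. It makes the amplitude norm finite and its decay in
  frequency a kernel for Young's inequality.\<close>

abbreviation pd :: "'a::euclidean_space \<Rightarrow> ('a \<Rightarrow> complex) \<Rightarrow> 'a \<Rightarrow> complex" where
  "pd v f \<equiv> (\<lambda>x. frechet_derivative f (at x) v)"

lemma iter_deriv_append: "iter_deriv (vs @ ws) f = iter_deriv vs (iter_deriv ws f)"
  by (induction vs) auto

lemma pd_eqI:
  assumes "(f has_derivative f') (at x)"
  shows "frechet_derivative f (at x) v = f' v"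
  using frechet_derivative_at[OF assms] by simp

lemma frechet_euclidean:
  assumes "f differentiable (at x)"
  shows "frechet_derivative f (at x) h = (\<Sum>b\<in>Basis. (h \<bullet> b) *\<^sub>R frechet_derivative f (at x) b)"
proof -
  interpret linear "frechet_derivative f (at x)"
    using assms by (rule linear_frechet_derivative)
  have "frechet_derivative f (at x) h = frechet_derivative f (at x) (\<Sum>b\<in>Basis. (h \<bullet> b) *\<^sub>R b)"
    by (simp add: euclidean_representation)
  then show ?thesis by (simp add: sum scale)
qed

text \<open>A partial derivative of a product or of a composition is in general not of the same form
  but a sum of such functions. Closure under addition lets the coinduction below work with the
  family of products or compositions itself.\<close>

inductive_set addcl :: "('a \<Rightarrow> complex) set \<Rightarrow> ('a \<Rightarrow> complex) set" for F where
  base: "f \<in> F \<Longrightarrow> f \<in> addcl F"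
| add: "f \<in> addcl F \<Longrightarrow> g \<in> addcl F \<Longrightarrow> (\<lambda>x. f x + g x) \<in> addcl F"

lemma addcl_sum:
  assumes "finite S" "\<And>i. i \<in> S \<Longrightarrow> f i \<in> addcl F" "(\<lambda>_. 0) \<in> F"
  shows "(\<lambda>x. \<Sum>i\<in>S. f i x) \<in> addcl F"
  using assms
proof (induction rule: finite_induct)
  case empty then show ?case by (simp add: addcl.base)
next
  case (insert i S)
  then show ?case using addcl.add[of "f i" F "\<lambda>x. \<Sum>i\<in>S. f i x"] by simp
qed

text \<open>One notion for several classes: with \<open>P\<close> trivial, a growth condition or a
  decay condition on all derivatives, it yields smooth functions, symbols of polynomial growth and
  Schwartz functions.\<close>

definition smooth_in :: "(('a::euclidean_space \<Rightarrow> complex) \<Rightarrow> bool) \<Rightarrow> ('a \<Rightarrow> complex) \<Rightarrow> bool" where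
  "smooth_in P f \<longleftrightarrow> smooth f \<and> (\<forall>vs\<in>lists Basis. P (iter_deriv vs f))"

definition add_closed :: "(('a \<Rightarrow> complex) \<Rightarrow> bool) \<Rightarrow> bool" where
  "add_closed P \<longleftrightarrow> (\<forall>f g. P f \<longrightarrow> P g \<longrightarrow> P (\<lambda>x. f x + g x))"

text \<open>One partial derivative maps \<open>addcl F\<close> into itself, hence so does every
  \<open>iter_deriv\<close>. Smoothness of all orders is thus reduced to computing first derivatives
  of the members of \<open>F\<close>.\<close>

lemma smooth_in_coinduct:
  assumes "f \<in> F"
    and diff: "\<And>f x. f \<in> F \<Longrightarrow> f differentiable (at x)"
    and pd: "\<And>f b. f \<in> F \<Longrightarrow> b \<in> Basis \<Longrightarrow> pd b f \<in> addcl F"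
    and P: "\<And>f. f \<in> F \<Longrightarrow> P f" and add: "add_closed P"
  shows "smooth_in P f"
proof -
  have 1: "(\<forall>x. f differentiable (at x)) \<and> P f \<and> (\<forall>b\<in>Basis. pd b f \<in> addcl F)"
    if "f \<in> addcl F" for f
    using that
  proof induction
    case (base f) then show ?case using diff pd P by blast
  next
    case (add f g)
    have "pd b (\<lambda>x. f x + g x) = (\<lambda>x. pd b f x + pd b g x)" for b
      using add by (auto intro!: ext pd_eqI has_derivative_add simp flip: frechet_derivative_works)
    with add show ?case
      using \<open>add_closed P\<close> by (auto simp: add_closed_def intro!: addcl.add)
  qed
  have 2: "iter_deriv vs f \<in> addcl F" if "vs \<in> lists Basis" for vs
    using that by (induction vs) (use 1 \<open>f \<in> F\<close> in \<open>auto intro: addcl.base\<close>)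
  show ?thesis using 1 2 by (auto simp: smooth_in_def smooth_def)
qed

lemma smooth_in_imp: "smooth_in P f \<Longrightarrow> P f"
  by (auto simp: smooth_in_def dest!: bspec[of _ _ "[]"])

lemma smooth_in_differentiable: "smooth_in P f \<Longrightarrow> f differentiable (at x)"
  by (auto simp: smooth_in_def smooth_def dest!: bspec[of _ _ "[]"])

lemma smooth_in_continuous: "smooth_in P f \<Longrightarrow> continuous_on A f"
  by (meson continuous_at_imp_continuous_on differentiable_imp_continuous_within
      smooth_in_differentiable)

lemma smooth_in_iter_deriv:
  "smooth_in P f \<Longrightarrow> vs \<in> lists Basis \<Longrightarrow> smooth_in P (iter_deriv vs f)"
  by (auto simp: smooth_in_def smooth_def iter_deriv_append[symmetric])

lemma smooth_in_pd: "smooth_in P f \<Longrightarrow> b \<in> Basis \<Longrightarrow> smooth_in P (pd b f)"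
  using smooth_in_iter_deriv[of P f "[b]"] by simp

lemma smooth_in_mono: "smooth_in P f \<Longrightarrow> (\<And>f. P f \<Longrightarrow> Q f) \<Longrightarrow> smooth_in Q f"
  by (auto simp: smooth_in_def)

lemma smooth_in_smooth: "smooth_in P f \<Longrightarrow> smooth f"
  by (simp add: smooth_in_def)

lemma smooth_in_True: "smooth f \<longleftrightarrow> smooth_in (\<lambda>_. True) f"
  by (simp add: smooth_in_def)

lemma pd_add:
  "f differentiable (at x) \<Longrightarrow> g differentiable (at x) \<Longrightarrow>
   frechet_derivative (\<lambda>x. f x + g x) (at x) v = frechet_derivative f (at x) v + frechet_derivative g (at x) v"
  by (auto intro!: pd_eqI has_derivative_add simp flip: frechet_derivative_works)

lemma pd_mult:
  fixes f g :: "'a::euclidean_space \<Rightarrow> complex"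
  shows "f differentiable (at x) \<Longrightarrow> g differentiable (at x) \<Longrightarrow>
   frechet_derivative (\<lambda>x. f x * g x) (at x) v = frechet_derivative f (at x) v * g x + f x * frechet_derivative g (at x) v"
  using pd_eqI[OF has_derivative_mult[of f "frechet_derivative f (at x)" x UNIV g "frechet_derivative g (at x)"], of v]
  by (simp add: frechet_derivative_works add.commute)

lemma smooth_in_add:
  assumes "smooth_in P f" "smooth_in P g" "add_closed P"
  shows "smooth_in P (\<lambda>x. f x + g x)"
proof (rule smooth_in_coinduct[where F = "{\<lambda>x. f x + g x |f g. smooth_in P f \<and> smooth_in P g}"])
  fix h assume "h \<in> {\<lambda>x. f x + g x |f g. smooth_in P f \<and> smooth_in P g}"
  then obtain f g where h: "h = (\<lambda>x. f x + g x)" "smooth_in P f" "smooth_in P g" by auto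
  show "h differentiable (at x)" for x
    unfolding h(1) using h(2,3) by (intro differentiable_add smooth_in_differentiable)
  show "P h"
    unfolding h(1) using smooth_in_imp[OF h(2)] smooth_in_imp[OF h(3)] \<open>add_closed P\<close>
    by (simp add: add_closed_def)
  fix b :: 'a assume b: "b \<in> Basis"
  have "pd b h = (\<lambda>x. pd b f x + pd b g x)"
    unfolding h(1) using h(2,3) by (intro ext pd_add smooth_in_differentiable)
  then show "pd b h \<in> addcl {\<lambda>x. f x + g x |f g. smooth_in P f \<and> smooth_in P g}"
    by (simp only:) (intro addcl.base CollectI exI[of _ "pd b f"] exI[of _ "pd b g"] conjI refl
        smooth_in_pd h(2,3) b)
qed (use assms in auto)

text \<open>Three predicates, because the factors may be of different kinds: a rapidly decaying
  function times one of polynomial growth is rapidly decaying. The Leibniz rule keeps the family of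
  all products closed up to sums.\<close>

lemma smooth_in_mult:
  assumes "smooth_in P f" "smooth_in Q g" "add_closed R"
    and PQ: "\<And>f g. P f \<Longrightarrow> Q g \<Longrightarrow> R (\<lambda>x. f x * g x)"
  shows "smooth_in R (\<lambda>x. f x * g x)"
proof (rule smooth_in_coinduct[where F = "{\<lambda>x. f x * g x |f g. smooth_in P f \<and> smooth_in Q g}"])
  fix h assume "h \<in> {\<lambda>x. f x * g x |f g. smooth_in P f \<and> smooth_in Q g}"
  then obtain f g where h: "h = (\<lambda>x. f x * g x)" "smooth_in P f" "smooth_in Q g" by auto
  show "h differentiable (at x)" for x
    unfolding h(1) using h(2,3) by (intro differentiable_mult smooth_in_differentiable)
  show "R h"
    unfolding h(1) using smooth_in_imp[OF h(2)] smooth_in_imp[OF h(3)] by (rule PQ)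
  fix b :: 'a assume b: "b \<in> Basis"
  have "pd b h = (\<lambda>x. pd b f x * g x + f x * pd b g x)"
    unfolding h(1) using h(2,3) by (intro ext pd_mult smooth_in_differentiable)
  moreover have "(\<lambda>x. pd b f x * g x + f x * pd b g x) \<in>
      addcl {\<lambda>x. f x * g x |f g. smooth_in P f \<and> smooth_in Q g}"
  proof (intro addcl.add[OF addcl.base addcl.base] CollectI)
    show "\<exists>f' g'. (\<lambda>x. pd b f x * g x) = (\<lambda>x. f' x * g' x) \<and> smooth_in P f' \<and> smooth_in Q g'"
      by (intro exI[of _ "pd b f"] exI[of _ g] conjI refl smooth_in_pd h(2,3) b)
    show "\<exists>f' g'. (\<lambda>x. f x * pd b g x) = (\<lambda>x. f' x * g' x) \<and> smooth_in P f' \<and> smooth_in Q g'"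
      by (intro exI[of _ f] exI[of _ "pd b g"] conjI refl smooth_in_pd h(2,3) b)
  qed
  ultimately show "pd b h \<in> addcl {\<lambda>x. f x * g x |f g. smooth_in P f \<and> smooth_in Q g}"
    by simp
qed (use assms in auto)

lemma smooth_in_const:
  assumes "\<And>c. P (\<lambda>_. c)" "add_closed P"
  shows "smooth_in P (\<lambda>_. c)"
  by (rule smooth_in_coinduct[where F = "range (\<lambda>c _. c)"])
    (use assms in \<open>auto intro!: addcl.base\<close>)

lemma smooth_in_linear:
  assumes "bounded_linear l" "P l" "\<And>c. P (\<lambda>_. c)" "add_closed P"
  shows "smooth_in P l"
proof (rule smooth_in_coinduct[where F = "{l} \<union> range (\<lambda>c _. c)"])
  fix f :: "'a \<Rightarrow> complex" and b :: 'a assume f: "f \<in> {l} \<union> range (\<lambda>c _. c)"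
  have "pd b l = (\<lambda>_. l b)"
    by (intro ext pd_eqI bounded_linear_imp_has_derivative assms)
  then show "pd b f \<in> addcl ({l} \<union> range (\<lambda>c _. c))" using f by (auto intro!: addcl.base)
qed (use assms in \<open>auto simp: bounded_linear_imp_differentiable\<close>)

text \<open>The chain rule produces the coefficients \<open>L b \<bullet> i\<close>; the family must
  therefore contain all multiples of compositions, which is the reason for the factor
  \<open>k\<close> in the hypothesis on \<open>Q\<close>.\<close>

lemma smooth_in_affine_comp:
  fixes f :: "'b::euclidean_space \<Rightarrow> complex" and L :: "'a::euclidean_space \<Rightarrow> 'b"
  assumes "smooth_in P f" and L: "bounded_linear L"
    and Q: "\<And>f k. P f \<Longrightarrow> Q (\<lambda>x. k * f (L x + c))" and "add_closed Q"
  shows "smooth_in Q (\<lambda>x. f (L x + c))"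
proof (rule smooth_in_coinduct[where F = "{\<lambda>x. k * f (L x + c) |k f. smooth_in P f}"])
  have diff: "((\<lambda>x. k * f (L x + c)) has_derivative (\<lambda>h. k * frechet_derivative f (at (L x + c)) (L h))) (at x)"
    if "smooth_in P f" for f k x
  proof -
    have 1: "((\<lambda>x. L x + c) has_derivative L) (at x)"
      using bounded_linear_imp_has_derivative[OF L] by (intro has_derivative_eq_rhs[OF has_derivative_add[OF _ has_derivative_const]]) auto
    have 2: "(f has_derivative frechet_derivative f (at (L x + c))) (at (L x + c))"
      using smooth_in_differentiable[OF that] frechet_derivative_works by blast
    show ?thesis
      by (rule has_derivative_mult_right[OF has_derivative_compose[OF 1 2]])
  qed
  fix h assume "h \<in> {\<lambda>x. k * f (L x + c) |k f. smooth_in P f}"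
  then obtain k f where h: "h = (\<lambda>x. k * f (L x + c))" "smooth_in P f" by auto
  show "h differentiable (at x)" for x using diff[OF h(2)] h(1) by (auto simp: differentiable_def)
  show "Q h" using h Q smooth_in_imp by auto
  fix b :: 'a assume "b \<in> Basis"
  have "pd b h = (\<lambda>x. \<Sum>i\<in>Basis. (k * of_real (L b \<bullet> i)) * pd i f (L x + c))"
    unfolding h(1)
    by (subst pd_eqI[OF diff[OF h(2)]], subst frechet_euclidean)
      (auto simp: smooth_in_differentiable[OF h(2)] scaleR_conv_of_real sum_distrib_left mult.assoc)
  also have "\<dots> \<in> addcl {\<lambda>x. k * f (L x + c) |k f. smooth_in P f}"
  proof (rule addcl_sum)
    have "(\<lambda>x. 0) = (\<lambda>x. 0 * f (L x + c))" by simp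
    then show "(\<lambda>_. 0) \<in> {\<lambda>x. k * f (L x + c) |k f. smooth_in P f}" using h(2) by blast
  next
    fix i :: 'b assume "i \<in> Basis"
    then show "(\<lambda>x. k * of_real (L b \<bullet> i) * pd i f (L x + c)) \<in> addcl {\<lambda>x. k * f (L x + c) |k f. smooth_in P f}"
      by (intro addcl.base CollectI exI[of _ "k * of_real (L b \<bullet> i)"] exI[of _ "pd i f"] conjI refl
          smooth_in_pd h(2))
  qed simp
  finally show "pd b h \<in> addcl {\<lambda>x. k * f (L x + c) |k f. smooth_in P f}" .
next
  have "(\<lambda>x. f (L x + c)) = (\<lambda>x. 1 * f (L x + c))" by simp
  then show "(\<lambda>x. f (L x + c)) \<in> {\<lambda>x. k * f (L x + c) |k f. smooth_in P f}" using assms(1) by blast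
qed fact

text \<open>
  Allowing the derivative to be a sum of two members of \<open>G\<close> covers the exponential bump, whose
  derivatives are \<open>exp (-1/t)\<close> times polynomials in \<open>1/t\<close>.
\<close>

lemma smooth_in_real_comp:
  fixes \<tau> :: "'a::euclidean_space \<Rightarrow> real"
  assumes q: "smooth_in P q" and \<tau>: "smooth_in P (\<lambda>x. complex_of_real (\<tau> x))" and \<phi>: "\<phi> \<in> G"
    and G: "\<And>\<phi>. \<phi> \<in> G \<Longrightarrow> \<exists>\<phi>1\<in>G. \<exists>\<phi>2\<in>G. \<forall>t. (\<phi> has_vector_derivative (\<phi>1 t + \<phi>2 t)) (at t)"
    and P: "\<And>f g. P f \<Longrightarrow> P g \<Longrightarrow> P (\<lambda>x. f x * g x)" and addP: "add_closed P"
    and Q: "\<And>q \<phi>. P q \<Longrightarrow> \<phi> \<in> G \<Longrightarrow> Q (\<lambda>x. q x * \<phi> (\<tau> x))" and addQ: "add_closed Q"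
  shows "smooth_in Q (\<lambda>x. q x * \<phi> (\<tau> x))"
proof (rule smooth_in_coinduct[where F = "{\<lambda>x. q x * \<phi> (\<tau> x) |q \<phi>. smooth_in P q \<and> \<phi> \<in> G}"])
  show "(\<lambda>x. q x * \<phi> (\<tau> x)) \<in> {\<lambda>x. q x * \<phi> (\<tau> x) |q \<phi>. smooth_in P q \<and> \<phi> \<in> G}"
    using q \<phi> by auto
  define \<tau>' where "\<tau>' x = frechet_derivative (\<lambda>x. complex_of_real (\<tau> x)) (at x)" for x
  have \<tau>1: "((\<lambda>x. complex_of_real (\<tau> x)) has_derivative \<tau>' x) (at x)" for x
    unfolding \<tau>'_def using smooth_in_differentiable[OF \<tau>] frechet_derivative_works by blast
  then have \<tau>2: "(\<tau> has_derivative (\<lambda>h. Re (\<tau>' x h))) (at x)" for x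
    using has_derivative_Re[OF \<tau>1] by simp
  \<comment> \<open>The calculus is complex while \<open>\<tau>\<close> is real. Its complex
    derivative takes real values, so the real and the complex chain rule agree.\<close>
  have "(\<lambda>h. of_real (Re (\<tau>' x h))) = \<tau>' x" for x
    using has_derivative_unique[OF has_derivative_of_real[OF \<tau>2] \<tau>1] by simp
  then have Re: "of_real (Re (\<tau>' x h)) = \<tau>' x h" for x h by metis
  fix h assume "h \<in> {\<lambda>x. q x * \<phi> (\<tau> x) |q \<phi>. smooth_in P q \<and> \<phi> \<in> G}"
  then obtain q \<phi> where h: "h = (\<lambda>x. q x * \<phi> (\<tau> x))" "smooth_in P q" "\<phi> \<in> G" by auto
  obtain \<phi>1 \<phi>2 where 1: "\<phi>1 \<in> G" "\<phi>2 \<in> G"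
    "\<And>t. (\<phi> has_vector_derivative (\<phi>1 t + \<phi>2 t)) (at t)" using G[OF h(3)] by auto
  have 2: "((\<lambda>x. \<phi> (\<tau> x)) has_derivative (\<lambda>h. \<tau>' x h * (\<phi>1 (\<tau> x) + \<phi>2 (\<tau> x)))) (at x)" for x
    using has_derivative_compose[OF \<tau>2 1(3)[unfolded has_vector_derivative_def], of x]
    by (simp add: scaleR_conv_of_real Re)
  have qd: "q differentiable (at x)" for x using h smooth_in_differentiable by auto
  show "h differentiable (at x)" for x
    unfolding h(1) using qd differentiableI[OF 2] by (intro differentiable_mult)
  show "Q h" unfolding h(1) using Q smooth_in_imp h by blast
  fix b :: 'a assume b: "b \<in> Basis"
  have "pd b h = (\<lambda>x. (pd b q x * \<phi> (\<tau> x) + (q x * \<tau>' x b) * \<phi>1 (\<tau> x)) + (q x * \<tau>' x b) * \<phi>2 (\<tau> x))"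
  proof (rule ext, goal_cases)
    case (1 x)
    have "(\<lambda>x. \<phi> (\<tau> x)) differentiable (at x)" using 2 by (auto simp: differentiable_def)
    then show ?case unfolding h(1) using pd_mult[OF qd, of "\<lambda>x. \<phi> (\<tau> x)" x b] pd_eqI[OF 2, of x b]
      by (simp add: algebra_simps)
  qed
  moreover have "smooth_in P (\<lambda>x. q x * \<tau>' x b)"
    unfolding \<tau>'_def
    by (rule smooth_in_mult[where P = P and Q = P]) (rule h(2) smooth_in_pd[OF \<tau> b] addP P | assumption)+
  moreover have I: "(\<lambda>x. q x * \<phi> (\<tau> x)) \<in> addcl {\<lambda>x. q x * \<phi> (\<tau> x) |q \<phi>. smooth_in P q \<and> \<phi> \<in> G}"
    if "smooth_in P q" "\<phi> \<in> G" for q \<phi>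
    by (intro addcl.base CollectI exI[of _ q] exI[of _ \<phi>] conjI refl that)
  ultimately show "pd b h \<in> addcl {\<lambda>x. q x * \<phi> (\<tau> x) |q \<phi>. smooth_in P q \<and> \<phi> \<in> G}"
    using smooth_in_pd[OF h(2) b] h(3) 1(1,2) by (simp only:) (intro addcl.add I)
qed fact

section \<open>Polynomial growth and rapid decay with respect to weights\<close>

definition growth :: "('a \<Rightarrow> real) \<Rightarrow> ('a \<Rightarrow> complex) \<Rightarrow> bool" where
  "growth w f \<longleftrightarrow> (\<exists>C. \<exists>K::nat. \<forall>x. norm (f x) \<le> C * w x ^ K)"

text \<open>Here \<open>\<rho>\<close> measures the variable in which the function decays and
  \<open>w\<close> a parameter on which the bound may depend polynomially, with a power that varies
  with \<open>k\<close>. For \<open>w = 1\<close> this is the decay of a Schwartz function.\<close>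

definition decay :: "('a \<Rightarrow> real) \<Rightarrow> ('a \<Rightarrow> real) \<Rightarrow> ('a \<Rightarrow> complex) \<Rightarrow> bool" where
  "decay \<rho> w f \<longleftrightarrow> (\<forall>k::nat. \<exists>C. \<exists>K::nat. \<forall>x. \<rho> x ^ k * norm (f x) \<le> C * w x ^ K)"

definition weight :: "('a \<Rightarrow> real) \<Rightarrow> bool" where
  "weight w \<longleftrightarrow> (\<forall>x. 1 \<le> w x)"

lemma weight_const [simp]: "weight (\<lambda>_. 1)"
  and weight_norm [simp]: "weight (\<lambda>x. 1 + norm (f x))"
  and weight_abs [simp]: "weight (\<lambda>x. 1 + \<bar>g x\<bar>)"
  by (auto simp: weight_def)

lemma weight_mult [simp]: "weight w \<Longrightarrow> weight v \<Longrightarrow> weight (\<lambda>x. w x * v x)"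
  unfolding weight_def by (metis mult_mono mult_1 zero_le_one order_trans)

lemma weight_power_le:
  assumes "1 \<le> (a::real)" "K \<le> L"
  shows "C * a ^ K \<le> \<bar>C\<bar> * a ^ L"
proof -
  have "C * a ^ K \<le> \<bar>C\<bar> * a ^ K" using assms by (intro mult_right_mono) auto
  also have "\<dots> \<le> \<bar>C\<bar> * a ^ L" using assms by (intro mult_left_mono power_increasing) auto
  finally show ?thesis .
qed

lemma growthI: "(\<And>x. norm (f x) \<le> C * w x ^ K) \<Longrightarrow> growth w f"
  by (auto simp: growth_def)

lemma growthE:
  assumes "growth w f" "weight w"
  obtains C K where "0 \<le> C" "\<And>x. norm (f x) \<le> C * w x ^ K"
proof -
  obtain C K where "\<And>x. norm (f x) \<le> C * w x ^ K" using assms by (auto simp: growth_def)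
  then have "norm (f x) \<le> \<bar>C\<bar> * w x ^ K" for x
    by (rule order_trans) (use assms in \<open>auto simp: weight_def intro!: weight_power_le\<close>)
  then show ?thesis by (rule that[rotated]) simp
qed

lemma decayE:
  assumes "decay \<rho> w f" "weight w"
  obtains C K where "0 \<le> C" "\<And>x. \<rho> x ^ k * norm (f x) \<le> C * w x ^ K"
proof -
  obtain C K where "\<And>x. \<rho> x ^ k * norm (f x) \<le> C * w x ^ K"
    using assms(1)[unfolded decay_def, rule_format, of k] by blast
  then have "\<rho> x ^ k * norm (f x) \<le> \<bar>C\<bar> * w x ^ K" for x
    by (rule order_trans) (use assms in \<open>auto simp: weight_def intro!: weight_power_le\<close>)
  then show ?thesis by (rule that[rotated]) simp
qed

lemma growth_add:
  assumes "growth w f" "growth w g" "weight w"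
  shows "growth w (\<lambda>x. f x + g x)"
proof -
  obtain C K where f: "0 \<le> C" "\<And>x. norm (f x) \<le> C * w x ^ K" using growthE assms by metis
  obtain D L where g: "0 \<le> D" "\<And>x. norm (g x) \<le> D * w x ^ L" using growthE assms by metis
  have "norm (f x + g x) \<le> (C + D) * w x ^ (K + L)" for x
  proof -
    have "C * w x ^ K \<le> C * w x ^ (K + L)" "D * w x ^ L \<le> D * w x ^ (K + L)"
      using assms f g by (auto simp: weight_def intro!: mult_left_mono power_increasing)
    then show ?thesis using f(2)[of x] g(2)[of x] norm_triangle_ineq[of "f x" "g x"]
      by (simp add: algebra_simps)
  qed
  then show ?thesis by (rule growthI)
qed

lemma growth_mult:
  assumes "growth w f" "growth w g" "weight w"
  shows "growth w (\<lambda>x. f x * g x)"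
proof -
  obtain C K where f: "0 \<le> C" "\<And>x. norm (f x) \<le> C * w x ^ K" using growthE assms by metis
  obtain D L where g: "0 \<le> D" "\<And>x. norm (g x) \<le> D * w x ^ L" using growthE assms by metis
  have "norm (f x * g x) \<le> (C * D) * w x ^ (K + L)" for x
    using mult_mono'[OF f(2)[of x] g(2)[of x]] by (simp add: norm_mult power_add mult_ac)
  then show ?thesis by (rule growthI)
qed

lemma growth_const: "weight w \<Longrightarrow> growth w (\<lambda>_. c)"
  by (rule growthI[of _ "norm c" _ 0]) simp

lemma growth_bounded: "(\<And>x. norm (f x) \<le> C) \<Longrightarrow> growth w f"
  by (rule growthI[of _ C _ 0]) simp

lemma growth_mono:
  assumes "growth w f" "weight w" "\<And>x. w x \<le> v x"
  shows "growth v f"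
proof -
  obtain C K where f: "0 \<le> C" "\<And>x. norm (f x) \<le> C * w x ^ K" using growthE assms by metis
  have "norm (f x) \<le> C * v x ^ K" for x
    using assms f by (intro order_trans[OF f(2)] mult_left_mono power_mono)
      (auto simp: weight_def intro: order_trans[OF zero_le_one])
  then show ?thesis by (rule growthI)
qed

lemma decay_add:
  assumes "decay \<rho> w f" "decay \<rho> w g" "weight w" "weight \<rho>"
  shows "decay \<rho> w (\<lambda>x. f x + g x)"
  unfolding decay_def
proof
  fix k
  obtain C K where f: "0 \<le> C" "\<And>x. \<rho> x ^ k * norm (f x) \<le> C * w x ^ K" using decayE assms by metis
  obtain D L where g: "0 \<le> D" "\<And>x. \<rho> x ^ k * norm (g x) \<le> D * w x ^ L" using decayE assms by metis
  have "\<rho> x ^ k * norm (f x + g x) \<le> (C + D) * w x ^ (K + L)" for x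
  proof -
    have "C * w x ^ K \<le> C * w x ^ (K + L)" "D * w x ^ L \<le> D * w x ^ (K + L)"
      using assms f g by (auto simp: weight_def intro!: mult_left_mono power_increasing)
    moreover have "0 \<le> \<rho> x ^ k"
      using assms(4) by (auto simp: weight_def intro!: zero_le_power order_trans[OF zero_le_one])
    ultimately show ?thesis using f(2)[of x] g(2)[of x]
        mult_left_mono[OF norm_triangle_ineq[of "f x" "g x"], of "\<rho> x ^ k"]
      by (simp add: algebra_simps)
  qed
  then show "\<exists>C K. \<forall>x. \<rho> x ^ k * norm (f x + g x) \<le> C * w x ^ K" by blast
qed

text \<open>The \<open>L\<close> powers of \<open>\<rho>\<close> in the bound of \<open>g\<close>
  are absorbed by using the decay of \<open>f\<close> at order \<open>k + L\<close>; the powers of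
  \<open>w\<close> are simply collected.\<close>

lemma decay_growth_mult:
  assumes "decay \<rho> w f" "growth (\<lambda>x. \<rho> x * w x) g" "weight w" "weight \<rho>"
  shows "decay \<rho> w (\<lambda>x. f x * g x)"
  unfolding decay_def
proof
  fix k
  obtain D L where g: "0 \<le> D" "\<And>x. norm (g x) \<le> D * (\<rho> x * w x) ^ L"
    using growthE[OF assms(2)] assms by (metis weight_mult)
  obtain C K where f: "0 \<le> C" "\<And>x. \<rho> x ^ (k + L) * norm (f x) \<le> C * w x ^ K" using decayE assms by metis
  have "\<rho> x ^ k * norm (f x * g x) \<le> (C * D) * w x ^ (K + L)" for x
  proof -
    have p: "0 \<le> \<rho> x" "0 \<le> w x" using assms by (auto simp: weight_def intro: order_trans[OF zero_le_one])
    have "\<rho> x ^ k * norm (f x * g x) \<le> \<rho> x ^ k * (norm (f x) * (D * (\<rho> x * w x) ^ L))"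
      using g(2)[of x] p by (auto simp: norm_mult intro!: mult_left_mono)
    also have "\<dots> = (\<rho> x ^ (k + L) * norm (f x)) * (D * w x ^ L)"
      by (simp add: power_mult_distrib power_add algebra_simps)
    also have "\<dots> \<le> (C * w x ^ K) * (D * w x ^ L)"
      using f(2)[of x] p g(1) by (intro mult_right_mono) auto
    finally show ?thesis by (simp add: power_add algebra_simps)
  qed
  then show "\<exists>C K. \<forall>x. \<rho> x ^ k * norm (f x * g x) \<le> C * w x ^ K" by blast
qed

lemma add_closed_growth [simp]: "weight w \<Longrightarrow> add_closed (growth w)"
  by (simp add: add_closed_def growth_add)

lemma add_closed_decay [simp]: "weight w \<Longrightarrow> weight \<rho> \<Longrightarrow> add_closed (decay \<rho> w)"
  by (simp add: add_closed_def decay_add)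

lemma add_closed_True [simp]: "add_closed (\<lambda>_. True)"
  by (simp add: add_closed_def)

section \<open>Moderate functions and Schwartz functions\<close>

abbreviation sgrowth where "sgrowth w \<equiv> smooth_in (growth w)"
abbreviation sdecay where "sdecay \<rho> w \<equiv> smooth_in (decay \<rho> w)"
abbreviation moderate :: "('a::euclidean_space \<Rightarrow> complex) \<Rightarrow> bool" where
  "moderate \<equiv> sgrowth (\<lambda>x. 1 + norm x)"
abbreviation rapid :: "('a::euclidean_space \<Rightarrow> complex) \<Rightarrow> bool" where
  "rapid \<equiv> decay (\<lambda>x. 1 + norm x) (\<lambda>_. 1)"

lemma schwartz_iff: "schwartz f \<longleftrightarrow> smooth_in rapid f"
proof -
  have eq: "bdd_above (range (\<lambda>x. (1 + norm x) ^ k * norm (h x))) \<longleftrightarrow>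
      (\<exists>C. \<exists>K::nat. \<forall>x. (1 + norm x) ^ k * norm (h x) \<le> C * 1 ^ K)" for k and h :: "'a \<Rightarrow> complex"
    by (auto simp: bdd_above_def)
  then show ?thesis unfolding schwartz_def smooth_in_def decay_def
    by (simp only: eq) blast
qed

lemma sgrowth_const: "weight w \<Longrightarrow> sgrowth w (\<lambda>_. c)"
  by (intro smooth_in_const growth_const add_closed_growth)

lemma sgrowth_add: "weight w \<Longrightarrow> sgrowth w f \<Longrightarrow> sgrowth w g \<Longrightarrow> sgrowth w (\<lambda>x. f x + g x)"
  by (intro smooth_in_add add_closed_growth)

lemma sgrowth_mult: "weight w \<Longrightarrow> sgrowth w f \<Longrightarrow> sgrowth w g \<Longrightarrow> sgrowth w (\<lambda>x. f x * g x)"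
  by (erule (1) smooth_in_mult) (auto intro: growth_mult)

lemma sgrowth_sum:
  assumes "weight w" "\<And>i. i \<in> S \<Longrightarrow> sgrowth w (f i)"
  shows "sgrowth w (\<lambda>x. \<Sum>i\<in>S. f i x)"
  using assms by (induction S rule: infinite_finite_induct) (auto intro: sgrowth_add sgrowth_const)

lemma sgrowth_power: "weight w \<Longrightarrow> sgrowth w f \<Longrightarrow> sgrowth w (\<lambda>x. f x ^ n)"
  by (induction n) (auto intro: sgrowth_mult sgrowth_const)

lemma sgrowth_linear:
  "weight w \<Longrightarrow> bounded_linear l \<Longrightarrow> growth w l \<Longrightarrow> sgrowth w l"
  by (intro smooth_in_linear growth_const add_closed_growth)

lemma moderate_linear: 
  assumes "bounded_linear l"
  shows "moderate l"
proof (intro sgrowth_linear assms weight_norm)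
  obtain K where K: "\<And>x. norm (l x) \<le> norm x * K" "K > 0" using bounded_linear.pos_bounded[OF assms] by auto
  have "norm (l x) \<le> K * (1 + norm x) ^ 1" for x
    using K(1)[of x] K(2) by (simp add: algebra_simps)
  then show "growth (\<lambda>x. 1 + norm x) l" by (rule growthI)
qed

lemma moderate_inner: "moderate (\<lambda>x. complex_of_real (x \<bullet> v))"
  by (intro moderate_linear bounded_linear_compose[OF bounded_linear_of_real bounded_linear_inner_left])

lemma sgrowth_real_comp:
  assumes "weight w" "sgrowth w (\<lambda>x. complex_of_real (\<tau> x))" "\<phi> \<in> G"
    and G: "\<And>\<phi>. \<phi> \<in> G \<Longrightarrow> \<exists>\<phi>1\<in>G. \<exists>\<phi>2\<in>G. \<forall>t. (\<phi> has_vector_derivative (\<phi>1 t + \<phi>2 t)) (at t)"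
    and bd: "\<And>\<phi>. \<phi> \<in> G \<Longrightarrow> \<exists>B. \<forall>t. norm (\<phi> t) \<le> B"
  shows "sgrowth w (\<lambda>x. \<phi> (\<tau> x))"
proof -
  have "sgrowth w (\<lambda>x. 1 * \<phi> (\<tau> x))"
  proof (rule smooth_in_real_comp[where P = "growth w" and G = G])
    fix q \<phi> assume "growth w q" "\<phi> \<in> G"
    then show "growth w (\<lambda>x. q x * \<phi> (\<tau> x))"
      using bd growth_bounded[of "\<lambda>x. \<phi> (\<tau> x)"] growth_mult[OF _ _ \<open>weight w\<close>] by metis
  qed (use assms in \<open>auto intro: sgrowth_const growth_mult\<close>)
  then show ?thesis by simp
qed

lemma has_vector_derivative_cis:
  "((\<lambda>t. cis (c * t)) has_vector_derivative (\<i> * of_real c * cis (c * t))) (at t)"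
proof -
  have "((\<lambda>t. exp (\<i> * of_real (c * t))) has_vector_derivative (\<i> * of_real c * exp (\<i> * of_real (c * t)))) (at t)"
    by (rule has_vector_derivative_real_field[THEN has_vector_derivative_eq_rhs] derivative_eq_intros refl | simp)+
  then show ?thesis by (simp add: cis_conv_exp)
qed

lemma sgrowth_cis:
  assumes "weight w" "sgrowth w (\<lambda>x. complex_of_real (\<tau> x))"
  shows "sgrowth w (\<lambda>x. cis (c * \<tau> x))"
proof (rule sgrowth_real_comp[where \<phi> = "\<lambda>t. cis (c * t)" and G = "range (\<lambda>a t. a * cis (c * t))"])
  have "(\<lambda>t. cis (c * t)) = (\<lambda>t. 1 * cis (c * t))" by simp
  then show "(\<lambda>t. cis (c * t)) \<in> range (\<lambda>a t. a * cis (c * t))" by blast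
next
  fix \<phi> :: "real \<Rightarrow> complex" assume "\<phi> \<in> range (\<lambda>a t. a * cis (c * t))"
  then obtain a where a: "\<phi> = (\<lambda>t. a * cis (c * t))" by auto
  have "((\<lambda>t. a * cis (c * t)) has_vector_derivative (a * (\<i> * of_real c * cis (c * t)))) (at t)" for t
    by (intro has_vector_derivative_mult_right has_vector_derivative_cis)
  then show "\<exists>\<phi>1\<in>range (\<lambda>a t. a * cis (c * t)). \<exists>\<phi>2\<in>range (\<lambda>a t. a * cis (c * t)).
      \<forall>t. (\<phi> has_vector_derivative (\<phi>1 t + \<phi>2 t)) (at t)"
    unfolding a by (intro bexI[of _ "\<lambda>t. (a * (\<i> * of_real c)) * cis (c * t)"] bexI[of _ "\<lambda>t. 0 * cis (c * t)"] rangeI)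
      (simp add: mult.assoc)
  show "\<exists>B. \<forall>t. norm (\<phi> t) \<le> B" unfolding a by (auto simp: norm_mult)
qed fact+

lemma smooth_in_cnj:
  assumes "smooth_in P f" "\<And>f. P f \<Longrightarrow> P (\<lambda>x. cnj (f x))" "add_closed P"
  shows "smooth_in P (\<lambda>x. cnj (f x))"
proof (rule smooth_in_coinduct[where F = "{\<lambda>x. cnj (f x) |f. smooth_in P f}"])
  fix h assume "h \<in> {\<lambda>x. cnj (f x) |f. smooth_in P f}"
  then obtain f where h: "h = (\<lambda>x. cnj (f x))" "smooth_in P f" by auto
  have 1: "((\<lambda>x. cnj (f x)) has_derivative (\<lambda>v. cnj (frechet_derivative f (at x) v))) (at x)" for x
    using smooth_in_differentiable[OF h(2)] by (intro has_derivative_cnj) (simp add: frechet_derivative_works)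
  show "h differentiable (at x)" for x unfolding h(1) using 1 by (auto simp: differentiable_def)
  show "P h" using h assms smooth_in_imp by auto
  fix b :: 'a assume b: "b \<in> Basis"
  have "pd b h = (\<lambda>x. cnj (pd b f x))" unfolding h(1) by (intro ext pd_eqI 1)
  then show "pd b h \<in> addcl {\<lambda>x. cnj (f x) |f. smooth_in P f}"
    by (simp only:) (intro addcl.base CollectI exI[of _ "pd b f"] conjI refl smooth_in_pd h(2) b)
qed (use assms in auto)

lemma sdecay_add: "weight w \<Longrightarrow> weight \<rho> \<Longrightarrow> sdecay \<rho> w f \<Longrightarrow> sdecay \<rho> w g \<Longrightarrow> sdecay \<rho> w (\<lambda>x. f x + g x)"
  by (intro smooth_in_add add_closed_decay)

lemma sdecay_mult:
  "weight w \<Longrightarrow> weight \<rho> \<Longrightarrow> sdecay \<rho> w f \<Longrightarrow> sgrowth (\<lambda>x. \<rho> x * w x) g \<Longrightarrow> sdecay \<rho> w (\<lambda>x. f x * g x)"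
  by (erule (1) smooth_in_mult) (auto intro: decay_growth_mult)

lemma schwartz_mult: "schwartz f \<Longrightarrow> moderate g \<Longrightarrow> schwartz (\<lambda>x. f x * g x)"
  unfolding schwartz_iff by (rule sdecay_mult) auto

lemma schwartz_mult': "moderate g \<Longrightarrow> schwartz f \<Longrightarrow> schwartz (\<lambda>x. g x * f x)"
  using schwartz_mult[of f g] by (simp add: mult.commute)

lemma schwartz_add: "schwartz f \<Longrightarrow> schwartz g \<Longrightarrow> schwartz (\<lambda>x. f x + g x)"
  unfolding schwartz_iff by (rule sdecay_add) auto

lemma schwartz_scale: "schwartz f \<Longrightarrow> schwartz (\<lambda>x. c * f x)"
  by (intro schwartz_mult' sgrowth_const weight_norm)

lemma schwartz_cnj: "schwartz f \<Longrightarrow> schwartz (\<lambda>x. cnj (f x))"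
  unfolding schwartz_iff by (rule smooth_in_cnj) (auto simp: decay_def)

lemma schwartz_pd: "schwartz f \<Longrightarrow> b \<in> Basis \<Longrightarrow> schwartz (pd b f)"
  unfolding schwartz_iff by (rule smooth_in_pd)

lemma schwartz_iter_deriv: "schwartz f \<Longrightarrow> vs \<in> lists Basis \<Longrightarrow> schwartz (iter_deriv vs f)"
  unfolding schwartz_iff by (rule smooth_in_iter_deriv)

lemma schwartz_bound:
  assumes "schwartz f"
  obtains C where "0 \<le> C" "\<And>x. (1 + norm x) ^ k * norm (f x) \<le> C"
  using smooth_in_imp[OF assms[unfolded schwartz_iff]] decayE[of "\<lambda>x. 1 + norm x" "\<lambda>_. 1" f k]
  by (auto simp: power_one)

lemma schwartz_continuous: "schwartz f \<Longrightarrow> continuous_on A f"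
  unfolding schwartz_iff by (rule smooth_in_continuous)

lemma schwartz_moderate:
  assumes "schwartz f"
  shows "moderate f"
proof (rule smooth_in_mono[OF assms[unfolded schwartz_iff]])
  fix f :: "'a \<Rightarrow> complex" assume "rapid f"
  then obtain C where "\<And>x. (1 + norm x) ^ 0 * norm (f x) \<le> C"
    using decayE[of "\<lambda>x. 1 + norm x" "\<lambda>_. 1" f 0] by (auto simp: power_one)
  then show "growth (\<lambda>x. 1 + norm x) f" by (intro growth_bounded[of f C]) simp
qed

text \<open>Peetre's inequality: it transfers polynomial weights from a sum to its terms, and in the
  form below from a variable to its translate.\<close>

lemma one_plus_norm_triangle: "1 + norm (x + y) \<le> (1 + norm x) * (1 + norm y)"
  using norm_triangle_ineq[of x y] by (simp add: algebra_simps) (smt (verit) mult_nonneg_nonneg norm_ge_zero)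

lemma one_plus_norm_triangle_sub: "1 + norm x \<le> (1 + norm (x - y)) * (1 + norm y)"
  using one_plus_norm_triangle[of "x - y" y] by simp

lemma moderate_character: "moderate (\<lambda>x. cis (c * (x \<bullet> v)))"
  by (intro sgrowth_cis weight_norm moderate_inner)

section \<open>Integration on Euclidean space\<close>

lemma lborel_distr_isometry:
  fixes t :: "'a::euclidean_space"
  assumes "\<bar>c\<bar> = 1"
  shows "distr lborel borel (\<lambda>x. t + c *\<^sub>R x) = lborel"
proof -
  have "c \<noteq> 0" using assms by auto
  from lborel_affine[OF this, of t] show ?thesis using assms by (simp add: density_1)
qed

lemma lborel_distr_translate: "distr lborel borel (\<lambda>x. x + t) = (lborel :: 'a::euclidean_space measure)"
  using lborel_distr_isometry[of 1 t] by (simp add: add.commute)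

lemma lborel_distr_reflect: "distr lborel borel (\<lambda>x. t - x) = (lborel :: 'a::euclidean_space measure)"
  using lborel_distr_isometry[of "-1" t] by simp

lemma lborel_translate:
  fixes f :: "'a::euclidean_space \<Rightarrow> 'b::{banach, second_countable_topology}"
  assumes [measurable]: "f \<in> borel_measurable borel"
  shows "(\<integral>x. f (x + t) \<partial>lborel) = (\<integral>x. f x \<partial>lborel)"
    and "integrable lborel (\<lambda>x. f (x + t)) \<longleftrightarrow> integrable lborel f"
  using integral_distr[of "\<lambda>x. x + t" lborel borel f] integrable_distr_eq[of "\<lambda>x. x + t" lborel borel f]
  by (simp_all add: lborel_distr_translate)

lemma lborel_reflect:
  fixes f :: "'a::euclidean_space \<Rightarrow> 'b::{banach, second_countable_topology}"
  assumes [measurable]: "f \<in> borel_measurable borel"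
  shows "(\<integral>x. f (t - x) \<partial>lborel) = (\<integral>x. f x \<partial>lborel)"
    and "integrable lborel (\<lambda>x. f (t - x)) \<longleftrightarrow> integrable lborel f"
  using integral_distr[of "\<lambda>x. t - x" lborel borel f] integrable_distr_eq[of "\<lambda>x. t - x" lborel borel f]
  by (simp_all add: lborel_distr_reflect)

lemma nn_integral_lborel_translate:
  fixes f :: "'a::euclidean_space \<Rightarrow> ennreal"
  assumes [measurable]: "f \<in> borel_measurable borel"
  shows "(\<integral>\<^sup>+x. f (x + t) \<partial>lborel) = (\<integral>\<^sup>+x. f x \<partial>lborel)"
  using nn_integral_distr[of "\<lambda>x. x + t" lborel borel f] by (simp add: lborel_distr_translate)

lemma integrable_real_decay: "integrable lborel (\<lambda>x::real. inverse (1 + x\<^sup>2))"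
  using integrable_inverse_1_plus_square by (simp add: set_integrable_def einterval_eq)

text \<open>Each factor \<open>1 + (x \<bullet> b)^2\<close> is at most
  \<open>(1 + norm x)^2\<close>. The product over the basis explains the exponent
  \<open>2 * DIM('a)\<close> and reduces the claim to one integral on the real line.\<close>

lemma integrable_decay:
  assumes "2 * DIM('a::euclidean_space) \<le> k"
  shows "integrable lborel (\<lambda>x::'a. 1 / (1 + norm x) ^ k)"
proof -
  have "integrable lborel (\<lambda>x::'a. \<Prod>b\<in>Basis. inverse (1 + (x \<bullet> b)\<^sup>2))"
  proof (rule integrableI_bounded)
    have "integral\<^sup>N lborel (\<lambda>x::'a. ennreal (norm (\<Prod>b\<in>Basis. inverse (1 + (x \<bullet> b)\<^sup>2)))) =
        integral\<^sup>N lborel (\<lambda>x::'a. \<Prod>b\<in>Basis. ennreal (inverse (1 + (x \<bullet> b)\<^sup>2)))"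
      by (intro nn_integral_cong) (auto simp: prod_ennreal prod_nonneg)
    also have "\<dots> = (\<Prod>b\<in>(Basis::'a set). \<integral>\<^sup>+x. ennreal (inverse (1 + x\<^sup>2)) \<partial>lborel)"
      by (rule nn_integral_lborel_prod) auto
    also have "(\<integral>\<^sup>+x. ennreal (inverse (1 + x\<^sup>2)) \<partial>lborel) < (\<infinity>::ennreal)"
      using integrableD(2)[OF integrable_real_decay] by (simp add: less_top)
    then have "(\<Prod>b\<in>(Basis::'a set). \<integral>\<^sup>+x. ennreal (inverse (1 + x\<^sup>2)) \<partial>lborel) < \<infinity>"
      by (simp add: power_less_top_ennreal)
    finally show "integral\<^sup>N lborel (\<lambda>x::'a. ennreal (norm (\<Prod>b\<in>Basis. inverse (1 + (x \<bullet> b)\<^sup>2)))) < \<infinity>" .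
  qed simp
  then show ?thesis
  proof (rule Bochner_Integration.integrable_bound, goal_cases)
    case 2
    have "norm (1 / (1 + norm x) ^ k) \<le> norm (\<Prod>b\<in>Basis. inverse (1 + (x \<bullet> b)\<^sup>2))" for x :: 'a
    proof -
      have "(\<Prod>b\<in>Basis. 1 + (x \<bullet> b)\<^sup>2) \<le> (\<Prod>b\<in>(Basis::'a set). (1 + norm x)\<^sup>2)"
      proof (rule prod_mono, safe)
        fix b :: 'a assume "b \<in> Basis"
        have "(x \<bullet> b)\<^sup>2 \<le> (norm x)\<^sup>2" using Basis_le_norm[OF \<open>b \<in> Basis\<close>, of x]
          by (intro abs_le_square_iff[THEN iffD1]) simp
        moreover have "(1 + norm x)\<^sup>2 = 1 + 2 * norm x + (norm x)\<^sup>2" by (simp add: power2_sum)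
        ultimately show "1 + (x \<bullet> b)\<^sup>2 \<le> (1 + norm x)\<^sup>2" using norm_ge_zero[of x] by linarith
      qed simp
      also have "\<dots> = (1 + norm x) ^ (2 * DIM('a))" by (simp add: power_mult)
      also have "\<dots> \<le> (1 + norm x) ^ k" using assms by (intro power_increasing) auto
      finally have "1 / (1 + norm x) ^ k \<le> 1 / (\<Prod>b\<in>Basis. 1 + (x \<bullet> b)\<^sup>2)"
        by (intro divide_left_mono) (auto intro!: prod_pos mult_pos_pos zero_less_power add_pos_nonneg)
      also have "\<dots> = (\<Prod>b\<in>Basis. inverse (1 + (x \<bullet> b)\<^sup>2))" by (simp add: inverse_eq_divide prod_dividef)
      finally show ?thesis by (simp add: prod_nonneg abs_of_nonneg)
    qed
    then show ?case by simp
  qed measurable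
qed

lemma decay_pointwise:
  assumes "(1 + norm x) ^ k * a \<le> C"
  shows "a \<le> C * (1 / (1 + norm x) ^ k)"
proof -
  have "0 < (1 + norm x) ^ k" by (intro zero_less_power add_pos_nonneg) auto
  then show ?thesis using assms by (simp add: pos_le_divide_eq mult.commute)
qed

lemma integrable_of_decay:
  fixes f :: "'a::euclidean_space \<Rightarrow> complex"
  assumes [measurable]: "f \<in> borel_measurable borel"
    and b: "\<And>x. (1 + norm x) ^ k * norm (f x) \<le> C" and k: "2 * DIM('a) \<le> k"
  shows "integrable lborel f"
proof (rule Bochner_Integration.integrable_bound)
  show "integrable lborel (\<lambda>x::'a. C * (1 / (1 + norm x) ^ k))"
    by (intro integrable_mult_right integrable_decay k)
  show "AE x in lborel. norm (f x) \<le> norm (C * (1 / (1 + norm x) ^ k))"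
    using decay_pointwise[OF b] by (intro AE_I2) (metis abs_ge_self order_trans real_norm_def)
qed simp

lemma schwartz_measurable [measurable_dest]: "schwartz f \<Longrightarrow> f \<in> borel_measurable borel"
  by (intro borel_measurable_continuous_onI schwartz_continuous)

lemma schwartz_integrable:
  fixes f :: "'a::euclidean_space \<Rightarrow> complex"
  assumes "schwartz f" shows "integrable lborel f"
proof -
  obtain C where "\<And>x. (1 + norm x) ^ (2 * DIM('a)) * norm (f x) \<le> C"
    using schwartz_bound[OF assms] by blast
  then show ?thesis using schwartz_measurable[OF assms] by (intro integrable_of_decay) auto
qed

section \<open>Taylor estimates\<close>

lemma increment_le:
  fixes f :: "'a::euclidean_space \<Rightarrow> complex"
  assumes d: "\<And>x. f differentiable (at x)"
    and M: "\<And>b s. b \<in> Basis \<Longrightarrow> 0 \<le> s \<Longrightarrow> s \<le> 1 \<Longrightarrow> norm (pd b f (x + s *\<^sub>R h)) \<le> M"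
  shows "norm (f (x + h) - f x) \<le> real DIM('a) * M * norm h"
proof -
  have "norm (f (x + h) - f x) \<le> norm h * (real DIM('a) * M)"
  proof (rule differentiable_bound_segment[where G = UNIV and f' = "\<lambda>x. frechet_derivative f (at x)"])
    fix s :: real assume s: "s \<in> {0..1}"
    show "onorm (frechet_derivative f (at (x + s *\<^sub>R h))) \<le> real DIM('a) * M"
    proof (rule onorm_le)
      fix v
      have "norm (frechet_derivative f (at (x + s *\<^sub>R h)) v) \<le>
          (\<Sum>b\<in>Basis. norm ((v \<bullet> b) *\<^sub>R pd b f (x + s *\<^sub>R h)))"
        by (subst frechet_euclidean[OF d]) (rule norm_sum)
      also have "\<dots> \<le> (\<Sum>b\<in>(Basis::'a set). norm v * M)"
        using s by (intro sum_mono) (auto intro!: mult_mono M Basis_le_norm)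
      finally show "norm (frechet_derivative f (at (x + s *\<^sub>R h)) v) \<le> real DIM('a) * M * norm v"
        by (simp add: algebra_simps)
    qed
  qed (use d frechet_derivative_works in auto)
  then show ?thesis by (simp add: algebra_simps)
qed

text \<open>The mean value inequality is used twice, for every \<open>pd b f\<close> and for
  \<open>f\<close> minus its linear part. Each use expands a direction in the basis, which costs one
  factor \<open>DIM('a)\<close>.\<close>

lemma taylor_le:
  fixes f :: "'a::euclidean_space \<Rightarrow> complex"
  assumes f: "smooth_in P f"
    and M: "\<And>b c s. b \<in> Basis \<Longrightarrow> c \<in> Basis \<Longrightarrow> 0 \<le> s \<Longrightarrow> s \<le> 1 \<Longrightarrow> norm (pd b (pd c f) (x + s *\<^sub>R h)) \<le> M"
  shows "norm (f (x + h) - f x - frechet_derivative f (at x) h) \<le> (real DIM('a))\<^sup>2 * M * (norm h)\<^sup>2"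
proof -
  let ?S = "(\<lambda>s. x + s *\<^sub>R h) ` {0..1}"
  have d: "f differentiable (at x)" for x using f by (rule smooth_in_differentiable)
  have "norm (f (x + h) - f x - frechet_derivative f (at x) ((x + h) - x)) \<le>
      norm ((x + h) - x) * ((real DIM('a))\<^sup>2 * M * norm h)"
  proof (rule differentiable_bound_linearization[where S = ?S and f' = "\<lambda>x. frechet_derivative f (at x)"])
    fix y assume "y \<in> ?S"
    then obtain s where s: "0 \<le> s" "s \<le> 1" "y = x + s *\<^sub>R h" by auto
    show "(f has_derivative frechet_derivative f (at y)) (at y within ?S)"
      using d frechet_derivative_works has_derivative_at_withinI by blast
    show "onorm (frechet_derivative f (at y) - frechet_derivative f (at x)) \<le> (real DIM('a))\<^sup>2 * M * norm h"
    proof (rule onorm_le)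
      fix v
      have inc: "norm (pd b f y - pd b f x) \<le> real DIM('a) * M * norm h" if "b \<in> Basis" for b
      proof -
        have "norm (pd b f (x + s *\<^sub>R h) - pd b f x) \<le> real DIM('a) * M * norm (s *\<^sub>R h)"
        proof (rule increment_le)
          show "pd b f differentiable (at x)" for x
            by (rule smooth_in_differentiable[OF smooth_in_pd[OF f that]])
          fix c :: 'a and r :: real assume "c \<in> Basis" "0 \<le> r" "r \<le> 1"
          then show "norm (pd c (pd b f) (x + r *\<^sub>R s *\<^sub>R h)) \<le> M"
            using M[of c b "r * s"] that s by (simp add: mult_le_one)
        qed
        also have "\<dots> \<le> real DIM('a) * M * norm h"
          using s order_trans[OF norm_ge_zero M[of b b 0]] that
          by (intro mult_left_mono) (auto simp: mult_left_le_one_le)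
        finally show ?thesis using s by simp
      qed
      have "norm ((frechet_derivative f (at y) - frechet_derivative f (at x)) v) =
          norm (\<Sum>b\<in>Basis. (v \<bullet> b) *\<^sub>R (pd b f y - pd b f x))"
        using frechet_euclidean[OF d, of y v] frechet_euclidean[OF d, of x v]
        by (simp add: sum_subtractf algebra_simps)
      also have "\<dots> \<le> (\<Sum>b\<in>Basis. norm ((v \<bullet> b) *\<^sub>R (pd b f y - pd b f x)))"
        by (rule norm_sum)
      also have "\<dots> \<le> (\<Sum>b\<in>(Basis::'a set). norm v * (real DIM('a) * M * norm h))"
        by (intro sum_mono) (auto intro!: mult_mono inc Basis_le_norm)
      finally show "norm ((frechet_derivative f (at y) - frechet_derivative f (at x)) v) \<le>
          (real DIM('a))\<^sup>2 * M * norm h * norm v"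
        by (simp add: algebra_simps power2_eq_square)
    qed
  next
    show "x \<in> ?S" by (rule image_eqI[of _ _ 0]) auto
  qed auto
  then show ?thesis by (simp add: algebra_simps power2_eq_square)
qed

text \<open>The integral of \<open>f (x + h b) - f x\<close> vanishes for every \<open>h\<close>; compare with first order Taylor expansion.\<close>

lemma integral_pd_eq_0:
  fixes f :: "'a::euclidean_space \<Rightarrow> complex"
  assumes f: "schwartz f" and b: "b \<in> Basis"
  shows "(\<integral>x. pd b f x \<partial>lborel) = 0"
proof -
  define k where "k = 2 * DIM('a)"
  have "\<exists>C\<ge>0. \<forall>x. (1 + norm x) ^ k * norm (pd c (pd c' f) x) \<le> C" if "c \<in> Basis" "c' \<in> Basis" for c c'
    using schwartz_bound[OF schwartz_pd[OF schwartz_pd[OF f]], OF that(2,1)] by metis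
  then obtain C where C: "\<And>c c'. c \<in> Basis \<Longrightarrow> c' \<in> Basis \<Longrightarrow> 0 \<le> C c c'"
      "\<And>c c' x. c \<in> Basis \<Longrightarrow> c' \<in> Basis \<Longrightarrow> (1 + norm x) ^ k * norm (pd c (pd c' f) x) \<le> C c c'"
    by metis
  define D where "D = (\<Sum>c\<in>Basis. \<Sum>c'\<in>Basis. C c c')"
  have CD: "C c c' \<le> D" if "c \<in> Basis" "c' \<in> Basis" for c c'
  proof -
    have "C c c' \<le> (\<Sum>c'\<in>Basis. C c c')" using that C(1) by (intro member_le_sum) auto
    also have "\<dots> \<le> D" unfolding D_def using that C(1) by (intro member_le_sum) (auto intro: sum_nonneg)
    finally show ?thesis .
  qed
  have D0: "0 \<le> D" unfolding D_def using C(1) by (auto intro!: sum_nonneg)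
  define E where "E = (real DIM('a))\<^sup>2 * (D * 2 ^ k)"
  have fm [measurable]: "f \<in> borel_measurable borel" using f by (rule schwartz_measurable)
  have fi: "integrable lborel f" and pi: "integrable lborel (pd b f)"
    using f b by (auto intro: schwartz_integrable schwartz_pd)
  have fi': "integrable lborel (\<lambda>x. f (x + t))" for t using lborel_translate(2)[OF fm] fi by auto
  have bound: "norm (f (x + h *\<^sub>R b) - f x - h *\<^sub>R pd b f x) \<le> E * h\<^sup>2 * (1 / (1 + norm x) ^ k)"
    if "0 < h" "h \<le> 1" for h x
  proof -
    have "norm (f (x + h *\<^sub>R b) - f x - frechet_derivative f (at x) (h *\<^sub>R b)) \<le>
       (real DIM('a))\<^sup>2 * (D * 2 ^ k * (1 / (1 + norm x) ^ k)) * (norm (h *\<^sub>R b))\<^sup>2"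
    proof (rule taylor_le[OF f[unfolded schwartz_iff]])
      fix c c' :: 'a and s :: real
      assume c: "c \<in> Basis" "c' \<in> Basis" and s: "0 \<le> s" "s \<le> 1"
      let ?y = "x + s *\<^sub>R h *\<^sub>R b"
      \<comment> \<open>Moving by at most 1 changes \<open>1 + norm x\<close> by a factor of at most
        2. The second derivatives along the segment are thus bounded by the decay at its starting
        point, at the price of \<open>2 ^ k\<close>.\<close>
      have "norm (s *\<^sub>R h *\<^sub>R b) \<le> 1"
        using s that b mult_le_one[of s h] by (simp add: abs_mult)
      then have "1 + norm x \<le> 2 * (1 + norm ?y)"
        using norm_triangle_ineq4[of ?y "s *\<^sub>R h *\<^sub>R b"] norm_ge_zero[of ?y]
        by (simp del: scaleR_scaleR norm_scaleR norm_ge_zero)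
      then have "(1 + norm x) ^ k \<le> (2 * (1 + norm ?y)) ^ k" by (intro power_mono) auto
      then have "(1 + norm x) ^ k * norm (pd c (pd c' f) ?y) \<le> (2 * (1 + norm ?y)) ^ k * norm (pd c (pd c' f) ?y)"
        by (intro mult_right_mono) auto
      also have "\<dots> = 2 ^ k * ((1 + norm ?y) ^ k * norm (pd c (pd c' f) ?y))"
        by (simp only: power_mult_distrib mult.assoc)
      also have "\<dots> \<le> 2 ^ k * D"
        using C(2)[OF c, of ?y] CD[OF c] by (intro mult_left_mono) auto
      finally show "norm (pd c (pd c' f) ?y) \<le> D * 2 ^ k * (1 / (1 + norm x) ^ k)"
        by (intro decay_pointwise) (simp add: mult.commute)
    qed
    moreover have "frechet_derivative f (at x) (h *\<^sub>R b) = h *\<^sub>R pd b f x"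
      using smooth_in_differentiable[OF f[unfolded schwartz_iff]]
      by (intro linear_scale linear_frechet_derivative)
    ultimately show ?thesis using b by (simp add: E_def algebra_simps)
  qed
  define I where "I = integral\<^sup>L lborel (\<lambda>x::'a. 1 / (1 + norm x) ^ k)"
  \<comment> \<open>The translated integrals cancel, which leaves a term linear in \<open>h\<close>
    bounded by a remainder of order \<open>h^2\<close>. Dividing by \<open>h\<close> and letting it
    tend to 0 gives the claim.\<close>
  have key: "norm (\<integral>x. pd b f x \<partial>lborel) \<le> h * (E * I)" if "0 < h" "h \<le> 1" for h
  proof -
    have "(\<integral>x. f (x + h *\<^sub>R b) - f x - h *\<^sub>R pd b f x \<partial>lborel) = - (h *\<^sub>R (\<integral>x. pd b f x \<partial>lborel))"
      using fi fi' pi lborel_translate(1)[OF fm] by simp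
    moreover have "norm (\<integral>x. f (x + h *\<^sub>R b) - f x - h *\<^sub>R pd b f x \<partial>lborel) \<le>
        integral\<^sup>L lborel (\<lambda>x::'a. E * h\<^sup>2 * (1 / (1 + norm x) ^ k))"
      by (rule Bochner_Integration.integral_norm_bound_integral)
        (rule Bochner_Integration.integrable_diff integrable_scaleR_right fi fi' pi integrable_mult_right
          integrable_decay bound that k_def[symmetric, THEN eq_refl])+
    moreover have "integral\<^sup>L lborel (\<lambda>x::'a. E * h\<^sup>2 * (1 / (1 + norm x) ^ k)) = E * h\<^sup>2 * I"
      unfolding I_def by (rule integral_mult_right_zero)
    ultimately have "h * norm (\<integral>x. pd b f x \<partial>lborel) \<le> h * (h * (E * I))"
      using that by (simp add: power2_eq_square mult_ac)
    then show ?thesis using that by simp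
  qed
  have "((\<lambda>h. h * (E * I)) \<longlongrightarrow> 0) (at_right 0)"
    by (auto intro!: tendsto_eq_intros)
  moreover have "\<forall>\<^sub>F h in at_right 0. norm (\<integral>x. pd b f x \<partial>lborel) \<le> h * (E * I)"
    unfolding eventually_at_right_field by (rule exI[of _ 1]) (use key in auto)
  ultimately have "norm (\<integral>x. pd b f x \<partial>lborel) \<le> 0"
    by (rule tendsto_le[OF _ _ tendsto_const, rotated]) auto
  then show ?thesis by simp
qed

section \<open>The Fourier transform of Schwartz functions\<close>

text \<open>The sign is that of the inverse Fourier transform, since amplitudes are functions of
  frequency. The Fourier transform itself appears as \<open>ift f (- \<eta>)\<close>.\<close>

definition ift :: "('a::euclidean_space \<Rightarrow> complex) \<Rightarrow> 'a \<Rightarrow> complex" where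
  "ift f x = (\<integral>\<eta>. f \<eta> * cis (2 * pi * (x \<bullet> \<eta>)) \<partial>lborel)"

lemma norm_ift_le: "norm (ift f x) \<le> (\<integral>\<eta>. norm (f \<eta>) \<partial>lborel)"
  unfolding ift_def by (rule order_trans[OF integral_norm_bound]) (simp add: norm_mult)

lemma integrable_mult_bounded:
  fixes f g :: "'a \<Rightarrow> complex"
  assumes "integrable M f" "g \<in> borel_measurable M" "\<And>x. norm (g x) \<le> B"
  shows "integrable M (\<lambda>x. f x * g x)"
proof (rule Bochner_Integration.integrable_bound[where f = "\<lambda>x. norm (f x) * B"])
  have [measurable]: "f \<in> borel_measurable M" using assms(1) by simp
  show "(\<lambda>x. f x * g x) \<in> borel_measurable M" using assms(2) by measurable
  show "AE x in M. norm (f x * g x) \<le> norm (norm (f x) * B)"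
    using assms(3) order_trans[OF norm_ge_zero assms(3)]
    by (auto simp: norm_mult intro!: AE_I2 mult_left_mono)
qed (use assms(1) in auto)

lemma cis_measurable [measurable (raw)]:
  "f \<in> borel_measurable M \<Longrightarrow> (\<lambda>x. cis (f x)) \<in> borel_measurable M"
  unfolding cis_conv_exp by measurable

lemma integrable_mult_cis:
  fixes f :: "'a \<Rightarrow> complex"
  assumes "integrable M f" "\<theta> \<in> borel_measurable M"
  shows "integrable M (\<lambda>x. f x * cis (\<theta> x))"
  by (rule integrable_mult_bounded[where B = 1]) (use assms in auto)

lemma has_derivative_character:
  fixes x :: "'a::euclidean_space"
  shows "((\<lambda>y. cis (c * (x \<bullet> y))) has_derivative (\<lambda>h. \<i> * of_real (c * (x \<bullet> h)) * cis (c * (x \<bullet> y)))) (at y)"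
proof -
  have "((\<lambda>y. x \<bullet> y) has_derivative (\<lambda>h. x \<bullet> h)) (at y)"
    by (intro bounded_linear_imp_has_derivative bounded_linear_inner_right)
  from has_derivative_compose[OF this has_vector_derivative_cis[unfolded has_vector_derivative_def]]
  show ?thesis by (rule has_derivative_eq_rhs) (auto simp: scaleR_conv_of_real)
qed

lemma moderate_character': "moderate (\<lambda>y. cis (c * (x \<bullet> y)))"
  using moderate_character[of c x] by (simp add: inner_commute)

text \<open>Integration by parts: \<open>f\<close> times a character is a Schwartz function, so the
  integral of its derivative vanishes and the Leibniz rule splits it into the two sides.\<close>

lemma ift_pd:
  assumes f: "schwartz f" and b: "b \<in> Basis"
  shows "ift (pd b f) x = - (2 * pi * \<i> * of_real (x \<bullet> b)) * ift f x"
proof -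
  have s: "schwartz (\<lambda>\<eta>. f \<eta> * cis (2 * pi * (x \<bullet> \<eta>)))"
    by (rule schwartz_mult[OF f moderate_character'])
  have "pd b (\<lambda>\<eta>. f \<eta> * cis (2 * pi * (x \<bullet> \<eta>))) =
      (\<lambda>\<eta>. pd b f \<eta> * cis (2 * pi * (x \<bullet> \<eta>)) + (2 * pi * \<i> * of_real (x \<bullet> b)) * (f \<eta> * cis (2 * pi * (x \<bullet> \<eta>))))"
    by (intro ext, subst pd_mult[OF smooth_in_differentiable[OF f[unfolded schwartz_iff]] differentiableI[OF has_derivative_character]],
        subst pd_eqI[OF has_derivative_character[of "2 * pi" x]])
      (simp add: algebra_simps)
  then have "0 = (\<integral>\<eta>. pd b f \<eta> * cis (2 * pi * (x \<bullet> \<eta>)) + (2 * pi * \<i> * of_real (x \<bullet> b)) * (f \<eta> * cis (2 * pi * (x \<bullet> \<eta>))) \<partial>lborel)"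
    using integral_pd_eq_0[OF s b] by simp
  also have "\<dots> = ift (pd b f) x + (2 * pi * \<i> * of_real (x \<bullet> b)) * ift f x"
    unfolding ift_def
    using schwartz_integrable[OF schwartz_mult[OF schwartz_pd[OF f b] moderate_character'[of "2 * pi" x]]]
      schwartz_integrable[OF s]
    by (subst Bochner_Integration.integral_add) auto
  finally show ?thesis by (simp add: eq_neg_iff_add_eq_0)
qed

section \<open>Schwartz functions depending on a parameter\<close>

text \<open>
  Families of Schwartz functions of \<open>y\<close> with parameter \<open>p\<close> are jointly smooth functions of
  \<open>(p, y)\<close> all of whose derivatives decay rapidly in \<open>y\<close> and are bounded by a power of \<open>w p\<close>.
\<close>

abbreviation schwartz_family :: "('p::euclidean_space \<Rightarrow> real) \<Rightarrow> ('p \<times> 'a::euclidean_space \<Rightarrow> complex) \<Rightarrow> bool" where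
  "schwartz_family w \<equiv> sdecay (\<lambda>z. 1 + norm (snd z)) (\<lambda>z. w (fst z))"

lemma lists_Pair0: "vs \<in> lists Basis \<Longrightarrow> map (Pair 0) vs \<in> lists (Basis :: ('p::euclidean_space \<times> 'a::euclidean_space) set)"
  by (auto simp: Basis_prod_def)

lemma iter_deriv_slice:
  fixes f :: "'p::euclidean_space \<times> 'a::euclidean_space \<Rightarrow> complex"
  assumes "smooth f" "vs \<in> lists Basis"
  shows "iter_deriv vs (\<lambda>y. f (p, y)) = (\<lambda>y. iter_deriv (map (Pair 0) vs) f (p, y))"
  using assms(2)
proof (induction vs)
  case (Cons v vs)
  have "map (Pair 0) vs \<in> lists (Basis :: ('p \<times> 'a) set)" using Cons.hyps by (intro lists_Pair0) auto
  then have d: "iter_deriv (map (Pair 0) vs) f differentiable (at (p, y))" for y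
    using assms(1) by (auto simp: smooth_def)
  have "frechet_derivative (\<lambda>y. iter_deriv (map (Pair 0) vs) f (p, y)) (at y) v =
      frechet_derivative (iter_deriv (map (Pair 0) vs) f) (at (p, y)) (0, v)" for y
  proof (rule pd_eqI)
    have 1: "((\<lambda>y. (p, y)) has_derivative (\<lambda>h. (0, h))) (at y)"
      by (auto intro!: derivative_eq_intros)
    show "((\<lambda>y. iter_deriv (map (Pair 0) vs) f (p, y)) has_derivative
        (\<lambda>v. frechet_derivative (iter_deriv (map (Pair 0) vs) f) (at (p, y)) (0, v))) (at y)"
      by (rule has_derivative_compose[OF 1]) (use d in \<open>simp add: frechet_derivative_works\<close>)
  qed
  then show ?case using Cons by simp
qed simp

lemma smooth_slice: 
  assumes "smooth f"
  shows "smooth (\<lambda>y. f (p, y))"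
  unfolding smooth_def
proof safe
  fix vs :: "'b list" and x assume "\<forall>x\<in>set vs. x \<in> Basis"
  then have vs: "vs \<in> lists Basis" by auto
  have d: "iter_deriv (map (Pair 0) vs) f differentiable (at (p, x))"
    using assms lists_Pair0[OF vs] by (auto simp: smooth_def)
  have 1: "((\<lambda>y. (p, y)) has_derivative (\<lambda>h. (0, h))) (at x)"
    by (auto intro!: derivative_eq_intros)
  show "iter_deriv vs (\<lambda>y. f (p, y)) differentiable (at x)"
    unfolding iter_deriv_slice[OF assms vs]
    by (rule differentiableI[OF has_derivative_compose[OF 1 d[unfolded frechet_derivative_works]]])
qed

lemma schwartz_family_slice:
  assumes "schwartz_family w f"
  shows "schwartz (\<lambda>y. f (p, y))"
  unfolding schwartz_iff smooth_in_def
proof safe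
  show sm: "smooth (\<lambda>y. f (p, y))" by (rule smooth_slice[OF smooth_in_smooth[OF assms]])
  fix vs :: "'b list" assume "\<forall>x\<in>set vs. x \<in> Basis"
  then have vs: "vs \<in> lists Basis" by auto
  show "rapid (iter_deriv vs (\<lambda>y. f (p, y)))"
    unfolding iter_deriv_slice[OF smooth_in_smooth[OF assms] vs] decay_def
  proof
    fix k
    have "decay (\<lambda>z. 1 + norm (snd z)) (\<lambda>z. w (fst z)) (iter_deriv (map (Pair 0) vs) f)"
      using assms lists_Pair0[OF vs] unfolding smooth_in_def by blast
    then obtain C K where "\<And>z. (1 + norm (snd z)) ^ k * norm (iter_deriv (map (Pair 0) vs) f z) \<le> C * w (fst z) ^ K"
      unfolding decay_def by blast
    from this[of "(p, _)"] show "\<exists>C K. \<forall>x. (1 + norm x) ^ k * cmod (iter_deriv (map (Pair 0) vs) f (p, x)) \<le> C * 1 ^ K"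
      by (intro exI[of _ "C * w p ^ K"]) simp
  qed
qed

lemma integral_family_le:
  fixes f :: "'p::euclidean_space \<times> 'a::euclidean_space \<Rightarrow> complex"
  assumes f: "schwartz_family w f" and w: "weight w"
  shows "\<exists>C\<ge>0. \<exists>K. \<forall>p. (\<integral>y. norm (f (p, y)) \<partial>lborel) \<le> C * w p ^ K"
proof -
  have w': "weight (\<lambda>z::'p \<times> 'a. w (fst z))" using w by (simp add: weight_def)
  obtain C K where C: "0 \<le> C" "\<And>z. (1 + norm (snd z)) ^ (2 * DIM('a)) * norm (f z) \<le> C * w (fst z) ^ K"
    using decayE[OF smooth_in_imp[OF f] w', of "2 * DIM('a)"] by blast
  let ?I = "integral\<^sup>L lborel (\<lambda>x::'a. 1 / (1 + norm x) ^ (2 * DIM('a)))"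
  have "(\<integral>y. norm (f (p, y)) \<partial>lborel) \<le> C * ?I * w p ^ K" for p
  proof -
    have "(\<integral>y. norm (f (p, y)) \<partial>lborel) \<le> (\<integral>y. (C * w p ^ K) * (1 / (1 + norm (y::'a)) ^ (2 * DIM('a))) \<partial>lborel)"
      using C(2)[of "(p, _)"]
      by (intro integral_mono integrable_norm integrable_mult_right integrable_decay decay_pointwise
          schwartz_integrable schwartz_family_slice[OF f]) auto
    also have "\<dots> = (C * w p ^ K) * ?I" by (rule integral_mult_right_zero)
    finally show ?thesis by (simp add: mult_ac)
  qed
  moreover have "0 \<le> C * ?I" using C by (auto intro!: mult_nonneg_nonneg integral_nonneg_AE)
  ultimately show ?thesis by blast
qed

text \<open>A factor \<open>1 + norm x\<close> is at most one plus the sum of the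
  \<open>norm (x \<bullet> b)\<close>, and \<open>ift_pd\<close> trades each
  \<open>x \<bullet> b\<close> for a derivative of the family. These derivatives are families with
  the same weight, so the induction on \<open>k\<close> runs over all \<open>f\<close> and keeps the
  bound polynomial in \<open>w p\<close>.\<close>

lemma ift_family_decay:
  fixes f :: "'p::euclidean_space \<times> 'a::euclidean_space \<Rightarrow> complex"
  assumes "schwartz_family w f" and w: "weight w"
  shows "\<exists>C\<ge>0. \<exists>K. \<forall>p x. (1 + norm x) ^ k * norm (ift (\<lambda>y. f (p, y)) x) \<le> C * w p ^ K"
  using assms(1)
proof (induction k arbitrary: f)
  case 0
  from integral_family_le[OF 0 w] obtain C K where "0 \<le> C" "\<And>p. (\<integral>y. norm (f (p, y)) \<partial>lborel) \<le> C * w p ^ K" by blast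
  then show ?case by (intro exI[of _ C] exI[of _ K] conjI allI) (auto intro: order_trans[OF norm_ift_le])
next
  case (Suc k)
  have w1: "0 \<le> w p" "1 \<le> w p" for p using w by (auto simp: weight_def intro: order_trans[OF zero_le_one])
  let ?d = "\<lambda>b. pd (0, b) f"
  have B0: "(0, b) \<in> Basis" if "b \<in> Basis" for b :: 'a using that by (simp add: Basis_prod_def)
  have d: "schwartz_family w (?d b)" if "b \<in> Basis" for b
    using smooth_in_pd[OF Suc.prems B0[OF that]] .
  have "\<forall>b\<in>Basis. \<exists>C\<ge>0. \<exists>K. \<forall>p x. (1 + norm x) ^ k * norm (ift (\<lambda>y. ?d b (p, y)) x) \<le> C * w p ^ K"
    using Suc.IH[OF d] by blast
  then obtain C K where C: "\<And>b. b \<in> Basis \<Longrightarrow> 0 \<le> C b"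
      "\<And>b p x. b \<in> Basis \<Longrightarrow> (1 + norm x) ^ k * norm (ift (\<lambda>y. ?d b (p, y)) x) \<le> C b * w p ^ K b"
    by metis
  obtain C0 K0 where C0: "0 \<le> C0" "\<And>p x. (1 + norm x) ^ k * norm (ift (\<lambda>y. f (p, y)) x) \<le> C0 * w p ^ K0"
    using Suc.IH[OF Suc.prems] by blast
  define L where "L = K0 + (\<Sum>b\<in>Basis. K b)"
  have KL: "w p ^ K b \<le> w p ^ L" if "b \<in> Basis" for p b
    using that w1 member_le_sum[of b Basis K] by (intro power_increasing) (auto simp: L_def)
  have K0L: "w p ^ K0 \<le> w p ^ L" for p
    using w1 by (intro power_increasing) (auto simp: L_def)
  have "(1 + norm x) ^ Suc k * norm (ift (\<lambda>y. f (p, y)) x) \<le> (C0 + (\<Sum>b\<in>Basis. C b)) * w p ^ L" for p x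
  proof -
    let ?F = "ift (\<lambda>y. f (p, y)) x"
    have 1: "norm (x \<bullet> b) * norm ?F \<le> norm (ift (\<lambda>y. ?d b (p, y)) x)" if "b \<in> Basis" for b
    proof -
      have "pd b (\<lambda>y. f (p, y)) = (\<lambda>y. ?d b (p, y))"
        using iter_deriv_slice[OF smooth_in_smooth[OF Suc.prems], of "[b]" p] that by simp
      then have "norm (ift (\<lambda>y. ?d b (p, y)) x) = norm (2 * pi * \<i> * of_real (x \<bullet> b) * ?F)"
        using ift_pd[OF schwartz_family_slice[OF Suc.prems] that] by (metis norm_minus_cancel mult_minus_left)
      also have "\<dots> = (2 * pi) * (norm (x \<bullet> b) * norm ?F)" by (simp add: norm_mult)
      also have "\<dots> \<ge> 1 * (norm (x \<bullet> b) * norm ?F)"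
        using pi_ge_two by (intro mult_right_mono) auto
      finally show ?thesis by simp
    qed
    have "(1 + norm x) * norm ?F \<le> norm ?F + (\<Sum>b\<in>Basis. norm (x \<bullet> b)) * norm ?F"
      using mult_right_mono[OF norm_le_l1[of x], of "norm ?F"] by (simp add: algebra_simps)
    also have "\<dots> \<le> norm ?F + (\<Sum>b\<in>Basis. norm (ift (\<lambda>y. ?d b (p, y)) x))"
      using 1 by (auto simp: sum_distrib_right intro!: sum_mono)
    finally have "(1 + norm x) ^ k * ((1 + norm x) * norm ?F) \<le>
        (1 + norm x) ^ k * (norm ?F + (\<Sum>b\<in>Basis. norm (ift (\<lambda>y. ?d b (p, y)) x)))"
      by (intro mult_left_mono) auto
    also have "\<dots> = (1 + norm x) ^ k * norm ?F + (\<Sum>b\<in>Basis. (1 + norm x) ^ k * norm (ift (\<lambda>y. ?d b (p, y)) x))"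
      by (simp add: algebra_simps sum_distrib_left)
    also have "\<dots> \<le> C0 * w p ^ L + (\<Sum>b\<in>Basis. C b * w p ^ L)"
      by (intro add_mono sum_mono order_trans[OF C0(2)] order_trans[OF C(2)] mult_left_mono K0L KL C C0) auto
    finally show ?thesis by (simp add: algebra_simps sum_distrib_right)
  qed
  moreover have "0 \<le> C0 + (\<Sum>b\<in>Basis. C b)" using C0 C by (auto intro!: add_nonneg_nonneg sum_nonneg)
  ultimately show ?case by blast
qed

lemma schwartz_family_const:
  assumes "schwartz f"
  shows "schwartz_family (\<lambda>_::'p::euclidean_space. 1) (\<lambda>z. f (snd z))"
proof -
  have "schwartz_family (\<lambda>_::'p. 1) (\<lambda>z. f (snd z + 0))"
  proof (rule smooth_in_affine_comp[OF assms[unfolded schwartz_iff] bounded_linear_snd])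
    fix f :: "'a \<Rightarrow> complex" and k assume f: "rapid f"
    show "decay (\<lambda>z::'p \<times> 'a. 1 + norm (snd z)) (\<lambda>z. 1) (\<lambda>x. k * f (snd x + 0))"
      unfolding decay_def
    proof
      fix m
      obtain C where "\<And>x. (1 + norm x) ^ m * norm (f x) \<le> C" using decayE[OF f, of m] by (auto simp: power_one)
      then have "(1 + norm x) ^ m * norm (k * f x) \<le> norm k * C" for x
        by (simp add: norm_mult mult.left_commute mult_left_mono)
      then show "\<exists>C K. \<forall>x::'p \<times> 'a. (1 + norm (snd x)) ^ m * norm (k * f (snd x + 0)) \<le> C * 1 ^ K"
        by (intro exI[of _ "norm k * C"]) simp
    qed
  qed simp
  then show ?thesis by simp
qed

lemma ift_rapid:
  assumes "schwartz f" shows "rapid (ift f)"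
  unfolding decay_def
proof
  fix k
  show "\<exists>C K. \<forall>x. (1 + norm x) ^ k * norm (ift f x) \<le> C * 1 ^ K"
    using ift_family_decay[OF schwartz_family_const[OF assms, where 'p = real], of k] by (auto simp: power_one)
qed

text \<open>Differentiation under an integral sign below amounts to integrating a quadratic Taylor
  remainder of the integrand and applying this criterion.\<close>

lemma has_derivative_quadratic:
  fixes f :: "'a::real_normed_vector \<Rightarrow> 'b::real_normed_vector"
  assumes D: "bounded_linear D" and q: "\<And>h. norm h \<le> 1 \<Longrightarrow> norm (f (x + h) - f x - D h) \<le> C * (norm h)\<^sup>2"
  shows "(f has_derivative D) (at x)"
  unfolding has_derivative_at
proof (intro conjI D)
  have "\<forall>\<^sub>F h in at 0. norm (norm (f (x + h) - f x - D h) / norm h) \<le> C * norm h"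
    unfolding eventually_at
  proof (intro exI[of _ 1] conjI ballI impI)
    fix h :: 'a assume "h \<noteq> 0 \<and> dist h 0 < 1"
    then show "norm (norm (f (x + h) - f x - D h) / norm h) \<le> C * norm h"
      using q[of h] by (auto simp: divide_le_eq power2_eq_square mult.assoc)
  qed auto
  moreover have "((\<lambda>h::'a. C * norm h) \<longlongrightarrow> 0) (at 0)"
    by (auto intro!: tendsto_eq_intros)
  ultimately show "(\<lambda>h. norm (f (x + h) - f x - D h) / norm h) \<midarrow>0\<rightarrow> 0"
    by (rule Lim_null_comparison)
qed

lemma cis_taylor: "norm (cis \<theta> - 1 - \<i> * of_real \<theta>) \<le> \<theta>\<^sup>2"
proof -
  have "norm (cis \<theta> - 1 - \<i> * of_real \<theta>) \<le> \<theta>\<^sup>2 / 2"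
    using iexp_approx1[of \<theta> 1] by (simp add: cis_conv_exp algebra_simps numeral_2_eq_2)
  then show ?thesis by (rule order_trans) simp
qed

lemma ift_has_derivative:
  fixes f :: "'a::euclidean_space \<Rightarrow> complex"
  assumes f: "schwartz f"
  shows "(ift f has_derivative (\<lambda>h. ift (\<lambda>\<eta>. \<i> * of_real (2 * pi * (h \<bullet> \<eta>)) * f \<eta>) x)) (at x)"
proof -
  let ?m = "\<lambda>h \<eta>. \<i> * of_real (2 * pi * (h \<bullet> \<eta>)) * f \<eta>"
  have m: "schwartz (?m h)" for h
  proof -
    have "moderate (\<lambda>\<eta>. \<i> * of_real (2 * pi) * of_real (\<eta> \<bullet> h))"
      by (intro sgrowth_mult sgrowth_const weight_norm moderate_inner)
    then have "schwartz (\<lambda>\<eta>. (\<i> * of_real (2 * pi) * of_real (\<eta> \<bullet> h)) * f \<eta>)" using f by (rule schwartz_mult')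
    then show ?thesis by (simp add: inner_commute mult.assoc)
  qed
  have mi: "integrable lborel (\<lambda>\<eta>. ?m h \<eta> * cis (2 * pi * (x \<bullet> \<eta>)))" for h x
    by (rule integrable_mult_cis[OF schwartz_integrable[OF m]]) simp
  have fi: "integrable lborel (\<lambda>\<eta>. f \<eta> * cis (2 * pi * (x \<bullet> \<eta>)))" for x
    by (rule integrable_mult_cis[OF schwartz_integrable[OF f]]) simp
  \<comment> \<open>A multiple of \<open>(norm \<eta>)^2 * norm (f \<eta>)\<close>, written as the
    norm of a polynomial times \<open>f\<close> so that integrability of Schwartz functions
    applies.\<close>
  define g where "g \<eta> = norm ((2 * pi)\<^sup>2 *\<^sub>R ((\<Sum>b\<in>Basis. of_real (\<eta> \<bullet> b) * of_real (\<eta> \<bullet> b)) * f \<eta>))" for \<eta>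
  have gi: "integrable lborel g"
    unfolding g_def
    by (intro integrable_norm integrable_scaleR_right schwartz_integrable schwartz_mult' f
        sgrowth_sum sgrowth_mult weight_norm moderate_inner)
  have g: "g \<eta> = (2 * pi)\<^sup>2 * (norm \<eta>)\<^sup>2 * norm (f \<eta>)" for \<eta>
  proof -
    have "(\<Sum>b\<in>Basis. complex_of_real (\<eta> \<bullet> b) * of_real (\<eta> \<bullet> b)) = of_real ((norm \<eta>)\<^sup>2)"
      unfolding power2_norm_eq_inner by (subst (3) euclidean_inner) simp
    then show ?thesis by (simp add: g_def norm_mult norm_power)
  qed
  show ?thesis
  proof (rule has_derivative_quadratic)
    show "bounded_linear (\<lambda>h. ift (?m h) x)"
    proof (rule bounded_linear_intro)
      show "ift (?m (h + h')) x = ift (?m h) x + ift (?m h') x" for h h'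
        unfolding ift_def by (subst Bochner_Integration.integral_add[symmetric])
          (use mi in \<open>auto intro!: Bochner_Integration.integral_cong simp: algebra_simps inner_add_left\<close>)
      show "ift (?m (r *\<^sub>R h)) x = r *\<^sub>R ift (?m h) x" for r h
        unfolding ift_def by (subst integral_scaleR_right[symmetric])
          (use mi in \<open>auto intro!: Bochner_Integration.integral_cong simp: algebra_simps scaleR_conv_of_real\<close>)
      have "norm (ift (?m h) x) \<le> (\<integral>\<eta>. norm h * norm ((\<Sum>b\<in>Basis. norm (?m b \<eta>))) \<partial>lborel)" for h
      proof (rule order_trans[OF norm_ift_le], rule integral_mono)
        show "integrable lborel (\<lambda>\<eta>. norm (?m h \<eta>))"
          by (intro integrable_norm schwartz_integrable m)
        show "integrable lborel (\<lambda>\<eta>. norm h * norm (\<Sum>b\<in>Basis. norm (?m b \<eta>)))"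
          by (intro integrable_mult_right integrable_norm Bochner_Integration.integrable_sum schwartz_integrable m)
        fix \<eta>
        have "norm (?m h \<eta>) = norm (\<Sum>b\<in>Basis. of_real (h \<bullet> b) * ?m b \<eta>)"
          by (subst euclidean_inner) (simp add: sum_distrib_left sum_distrib_right inner_commute mult_ac)
        also have "\<dots> \<le> (\<Sum>b\<in>Basis. norm h * norm (?m b \<eta>))"
          by (rule sum_norm_le) (auto simp: norm_mult abs_mult intro!: mult_right_mono Basis_le_norm)
        finally show "norm (?m h \<eta>) \<le> norm h * norm (\<Sum>b\<in>Basis. norm (?m b \<eta>))"
          by (simp add: sum_distrib_left abs_of_nonneg sum_nonneg)
      qed
      then show "norm (ift (?m h) x) \<le> norm h * (\<integral>\<eta>. norm ((\<Sum>b\<in>Basis. norm (?m b \<eta>))) \<partial>lborel)" for h by simp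
    qed
    fix h :: 'a
    have "ift f (x + h) - ift f x - ift (?m h) x =
      (\<integral>\<eta>. f \<eta> * cis (2 * pi * ((x + h) \<bullet> \<eta>)) - f \<eta> * cis (2 * pi * (x \<bullet> \<eta>)) - ?m h \<eta> * cis (2 * pi * (x \<bullet> \<eta>)) \<partial>lborel)"
      unfolding ift_def using fi mi by (simp del: of_real_mult)
    also have "\<dots> = (\<integral>\<eta>. f \<eta> * cis (2 * pi * (x \<bullet> \<eta>)) * (cis (2 * pi * (h \<bullet> \<eta>)) - 1 - \<i> * of_real (2 * pi * (h \<bullet> \<eta>))) \<partial>lborel)"
      by (intro Bochner_Integration.integral_cong refl) (simp add: algebra_simps inner_add_left flip: cis_mult)
    also have "norm \<dots> \<le> (\<integral>\<eta>. (norm h)\<^sup>2 * g \<eta> \<partial>lborel)"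
    proof (rule Bochner_Integration.integral_norm_bound_integral)
      have "(\<lambda>\<eta>. f \<eta> * cis (2 * pi * (x \<bullet> \<eta>)) * (cis (2 * pi * (h \<bullet> \<eta>)) - 1 - \<i> * of_real (2 * pi * (h \<bullet> \<eta>)))) =
        (\<lambda>\<eta>. f \<eta> * cis (2 * pi * ((x + h) \<bullet> \<eta>)) - f \<eta> * cis (2 * pi * (x \<bullet> \<eta>)) - ?m h \<eta> * cis (2 * pi * (x \<bullet> \<eta>)))"
        by (simp add: algebra_simps inner_add_left fun_eq_iff flip: cis_mult)
      then show "integrable lborel (\<lambda>\<eta>. f \<eta> * cis (2 * pi * (x \<bullet> \<eta>)) * (cis (2 * pi * (h \<bullet> \<eta>)) - 1 - \<i> * of_real (2 * pi * (h \<bullet> \<eta>))))"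
        using fi mi by (simp del: of_real_mult)
      show "integrable lborel (\<lambda>\<eta>. (norm h)\<^sup>2 * g \<eta>)" using gi by simp
      fix \<eta>
      have "norm (cis (2 * pi * (h \<bullet> \<eta>)) - 1 - \<i> * of_real (2 * pi * (h \<bullet> \<eta>))) \<le> (2 * pi * (h \<bullet> \<eta>))\<^sup>2"
        by (rule cis_taylor)
      also have "\<dots> \<le> (2 * pi)\<^sup>2 * (norm h * norm \<eta>)\<^sup>2"
        unfolding power_mult_distrib[of "2 * pi"]
        using Cauchy_Schwarz_ineq2[of h \<eta>] by (intro mult_left_mono abs_le_square_iff[THEN iffD1]) auto
      finally have "norm (f \<eta>) * norm (cis (2 * pi * (h \<bullet> \<eta>)) - 1 - \<i> * of_real (2 * pi * (h \<bullet> \<eta>))) \<le> norm (f \<eta>) * ((2 * pi)\<^sup>2 * (norm h * norm \<eta>)\<^sup>2)"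
        by (rule mult_left_mono) simp
      then show "norm (f \<eta> * cis (2 * pi * (x \<bullet> \<eta>)) * (cis (2 * pi * (h \<bullet> \<eta>)) - 1 - \<i> * of_real (2 * pi * (h \<bullet> \<eta>)))) \<le> (norm h)\<^sup>2 * g \<eta>"
        by (simp add: g norm_mult power_mult_distrib mult_ac)
    qed
    also have "\<dots> = (\<integral>\<eta>. g \<eta> \<partial>lborel) * (norm h)\<^sup>2" by simp
    finally show "norm (ift f (x + h) - ift f x - ift (?m h) x) \<le> (\<integral>\<eta>. g \<eta> \<partial>lborel) * (norm h)\<^sup>2" .
  qed
qed

text \<open>A derivative of \<open>ift f\<close> multiplies the amplitude by a linear function, so
  the set of all transforms is closed under partial derivatives. By coinduction the decay of a
  single transform is enough.\<close>

lemma schwartz_ift: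
  assumes "schwartz f"
  shows "schwartz (ift f)"
  unfolding schwartz_iff
proof (rule smooth_in_coinduct[where F = "{ift f |f. schwartz f}"])
  fix h assume "h \<in> {ift f |f. schwartz (f :: 'a \<Rightarrow> complex)}"
  then obtain f where h: "h = ift f" and f: "schwartz f" by auto
  show "h differentiable (at x)" for x unfolding h using ift_has_derivative[OF f] by (rule differentiableI)
  show "rapid h" unfolding h using ift_rapid[OF f] .
  fix b :: 'a assume "b \<in> Basis"
  have m: "schwartz (\<lambda>\<eta>. \<i> * of_real (2 * pi * (b \<bullet> \<eta>)) * f \<eta>)"
  proof -
    have "moderate (\<lambda>\<eta>. \<i> * of_real (2 * pi) * of_real (\<eta> \<bullet> b))"
      by (intro sgrowth_mult sgrowth_const weight_norm moderate_inner)
    then have "schwartz (\<lambda>\<eta>. (\<i> * of_real (2 * pi) * of_real (\<eta> \<bullet> b)) * f \<eta>)" using f by (rule schwartz_mult')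
    then show ?thesis by (simp add: inner_commute mult.assoc)
  qed
  have "pd b h = ift (\<lambda>\<eta>. \<i> * of_real (2 * pi * (b \<bullet> \<eta>)) * f \<eta>)"
    unfolding h by (intro ext pd_eqI[OF ift_has_derivative[OF f]])
  then show "pd b h \<in> addcl {ift f |f. schwartz f}"
    by (simp only:) (intro addcl.base CollectI exI[of _ "\<lambda>\<eta>. \<i> * of_real (2 * pi * (b \<bullet> \<eta>)) * f \<eta>"] conjI refl m)
qed (use assms in auto)

section \<open>Injectivity of the Fourier transform\<close>

lemma integrable_tensor:
  fixes f :: "'a::euclidean_space \<Rightarrow> complex" and g :: "'b::euclidean_space \<Rightarrow> complex"
  assumes f: "integrable lborel f" and g: "integrable lborel g"
  shows "integrable (lborel \<Otimes>\<^sub>M lborel) (\<lambda>(x, y). f x * g y)"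
proof (rule lborel_pair.Fubini_integrable)
  have [measurable]: "f \<in> borel_measurable borel" "g \<in> borel_measurable borel"
    using f g by auto
  show "(\<lambda>(x, y). f x * g y) \<in> borel_measurable (lborel \<Otimes>\<^sub>M lborel)" by measurable
  have "(\<lambda>x. \<integral>y. norm (case (x, y) of (x, y) \<Rightarrow> f x * g y) \<partial>lborel) = (\<lambda>x. norm (f x) * (\<integral>y. norm (g y) \<partial>lborel))"
    by (simp add: norm_mult)
  then show "integrable lborel (\<lambda>x. \<integral>y. norm (case (x, y) of (x, y) \<Rightarrow> f x * g y) \<partial>lborel)"
    using f by simp
qed (use g in auto)

lemma integrable_tensor_bounded:
  fixes f :: "'a::euclidean_space \<Rightarrow> complex" and g :: "'b::euclidean_space \<Rightarrow> complex"
  assumes "integrable lborel f" "integrable lborel g"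
    and "h \<in> borel_measurable borel" "\<And>z. norm (h z) \<le> B"
  shows "integrable (lborel \<Otimes>\<^sub>M lborel) (\<lambda>(x, y). f x * g y * h (x, y))"
  using integrable_mult_bounded[OF integrable_tensor[OF assms(1,2)], of h B] assms(3,4)
  by (simp add: split_beta' lborel_prod)

lemma integral_lborel_prod:
  fixes f :: "'a::euclidean_space \<Rightarrow> real \<Rightarrow> complex"
  assumes f: "\<And>b. b \<in> Basis \<Longrightarrow> integrable lborel (f b)"
  shows "(\<integral>x. (\<Prod>b\<in>Basis. f b (x \<bullet> b)) \<partial>lborel) = (\<Prod>b\<in>Basis. \<integral>t. f b t \<partial>lborel)"
    and "integrable lborel (\<lambda>x. \<Prod>b\<in>Basis. f b (x \<bullet> b))"
proof -
  interpret product_sigma_finite "\<lambda>_::'a. lborel :: real measure" by standard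
  have [measurable]: "f b \<in> borel_measurable borel" if "b \<in> Basis" for b using f[OF that] by simp
  have m: "(\<lambda>g. \<Sum>b\<in>Basis. g b *\<^sub>R b) \<in> (\<Pi>\<^sub>M b\<in>Basis. lborel) \<rightarrow>\<^sub>M (borel :: 'a measure)" by measurable
  have m': "(\<lambda>x::'a. \<Prod>b\<in>Basis. f b (x \<bullet> b)) \<in> borel_measurable borel" by measurable
  have e: "(\<Prod>b\<in>Basis. f b ((\<Sum>c\<in>Basis. g c *\<^sub>R c) \<bullet> b)) = (\<Prod>b\<in>Basis. f b (g b))" for g :: "'a \<Rightarrow> real"
    by (intro prod.cong refl) simp
  show "(\<integral>x. (\<Prod>b\<in>Basis. f b (x \<bullet> b)) \<partial>lborel) = (\<Prod>b\<in>Basis. \<integral>t. f b t \<partial>lborel)"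
    unfolding lborel_eq[where 'a = 'a] integral_distr[OF m m'] e using f by (intro product_integral_prod) auto
  show "integrable lborel (\<lambda>x. \<Prod>b\<in>Basis. f b (x \<bullet> b))"
    unfolding lborel_eq[where 'a = 'a] integrable_distr_eq[OF m m'] e using f by (intro product_integrable_prod) auto
qed

lemma gaussian_1d:
  "(\<integral>x. complex_of_real (std_normal_density x) * cis (t * x) \<partial>lborel) = complex_of_real (exp (- t\<^sup>2 / 2))"
proof -
  have "char std_normal_distribution t = (\<integral>x. std_normal_density x *\<^sub>R iexp (t * x) \<partial>lborel)"
    unfolding char_def by (subst integral_density) auto
  then show ?thesis unfolding char_std_normal_distribution by (simp add: scaleR_conv_of_real cis_conv_exp)
qed

text \<open>The coordinates separate, and in one variable this is the characteristic function of the
  standard normal distribution.\<close>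

lemma gaussian:
  fixes y :: "'a::euclidean_space"
  defines "G \<equiv> \<lambda>\<xi>::'a. \<Prod>b\<in>Basis. complex_of_real (std_normal_density (\<xi> \<bullet> b))"
  shows "(\<integral>\<xi>. G \<xi> * cis (y \<bullet> \<xi>) \<partial>lborel) = complex_of_real (exp (- (norm y)\<^sup>2 / 2))"
    and "integrable lborel G"
proof -
  have n: "integrable lborel (\<lambda>x. complex_of_real (std_normal_density x))"
    using integrable_normal_moment[of 1 0 0] by simp
  have "G \<xi> * cis (y \<bullet> \<xi>) = (\<Prod>b\<in>Basis. complex_of_real (std_normal_density (\<xi> \<bullet> b)) * cis ((y \<bullet> b) * (\<xi> \<bullet> b)))" for \<xi>
    unfolding G_def prod.distrib by (subst euclidean_inner) (simp add: cis_conv_exp exp_sum sum_distrib_left)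
  then have "(\<integral>\<xi>. G \<xi> * cis (y \<bullet> \<xi>) \<partial>lborel) =
      (\<Prod>b\<in>Basis. \<integral>t. complex_of_real (std_normal_density t) * cis ((y \<bullet> b) * t) \<partial>lborel)"
    using integral_lborel_prod(1)[of "\<lambda>b t. complex_of_real (std_normal_density t) * cis ((y \<bullet> b) * t)"] n
    by (simp add: integrable_mult_cis)
  also have "\<dots> = (\<Prod>b\<in>Basis. complex_of_real (exp (- (y \<bullet> b)\<^sup>2 / 2)))"
    by (simp only: gaussian_1d)
  also have "\<dots> = complex_of_real (exp (\<Sum>b\<in>Basis. - (y \<bullet> b)\<^sup>2 / 2))" by (simp add: exp_sum)
  also have "(\<Sum>b\<in>Basis. - (y \<bullet> b)\<^sup>2 / 2) = - (norm y)\<^sup>2 / 2"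
    unfolding power2_norm_eq_inner by (subst (2) euclidean_inner) (simp add: sum_negf sum_divide_distrib power2_eq_square)
  finally show "(\<integral>\<xi>. G \<xi> * cis (y \<bullet> \<xi>) \<partial>lborel) = complex_of_real (exp (- (norm y)\<^sup>2 / 2))" .
  show "integrable lborel G" unfolding G_def using n by (intro integral_lborel_prod(2))
qed

text \<open>A Gaussian centred at \<open>c\<close> is itself a Fourier integral. By Fubini the
  integral of \<open>g\<close> against it is an integral of values of \<open>ift g\<close>, hence 0.
  Letting the Gaussians concentrate at \<open>c\<close> isolates \<open>g c\<close> times a nonzero
  constant.\<close>

lemma ift_injective:
  fixes g :: "'a::euclidean_space \<Rightarrow> complex"
  assumes g: "schwartz g" and 0: "\<And>x. ift g x = 0"
  shows "g c = 0"
proof -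
  define G where "G = (\<lambda>\<xi>::'a. \<Prod>b\<in>Basis. complex_of_real (std_normal_density (\<xi> \<bullet> b)))"
  define \<gamma> where "\<gamma> y = complex_of_real (exp (- (norm y)\<^sup>2 / 2))" for y :: 'a
  have Gi: "integrable lborel G" and G\<gamma>: "(\<integral>\<xi>. G \<xi> * cis (y \<bullet> \<xi>) \<partial>lborel) = \<gamma> y" for y
    unfolding G_def \<gamma>_def using gaussian by auto
  have gi: "integrable lborel g" using g by (rule schwartz_integrable)
  have [measurable]: "g \<in> borel_measurable borel" "G \<in> borel_measurable borel" "\<gamma> \<in> borel_measurable borel"
    using gi Gi by (auto simp: \<gamma>_def[abs_def])
  have z: "(\<integral>y. g y * \<gamma> (k *\<^sub>R (y - c)) \<partial>lborel) = 0" for k :: real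
  proof -
    have "(\<integral>y. g y * \<gamma> (k *\<^sub>R (y - c)) \<partial>lborel) =
        (\<integral>y. \<integral>\<xi>. g y * G \<xi> * cis (k * ((y - c) \<bullet> \<xi>)) \<partial>lborel \<partial>lborel)"
      unfolding G\<gamma>[symmetric] by (simp add: mult.assoc)
    also have "\<dots> = (\<integral>\<xi>. \<integral>y. g y * G \<xi> * cis (k * ((y - c) \<bullet> \<xi>)) \<partial>lborel \<partial>lborel)"
    proof (intro lborel_pair.Fubini_integral[symmetric])
      have "(\<lambda>z. cis (k * ((fst z - c) \<bullet> snd z))) \<in> borel_measurable borel"
        by (intro borel_measurable_continuous_onI continuous_on_cis continuous_intros)
      from integrable_tensor_bounded[OF gi Gi this, of 1]
      show "integrable (lborel \<Otimes>\<^sub>M lborel) (\<lambda>(y, \<xi>). g y * G \<xi> * cis (k * ((y - c) \<bullet> \<xi>)))" by simp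
    qed
    also have "\<dots> = (\<integral>\<xi>. (G \<xi> * cis (- k * (c \<bullet> \<xi>))) * ift g ((k / (2 * pi)) *\<^sub>R \<xi>) \<partial>lborel)"
    proof (rule Bochner_Integration.integral_cong[OF refl])
      fix \<xi>
      have "cis (k * ((y - c) \<bullet> \<xi>)) = cis (- k * (c \<bullet> \<xi>)) * cis (2 * pi * (((k / (2 * pi)) *\<^sub>R \<xi>) \<bullet> y))" for y
        by (simp add: cis_mult inner_diff_left inner_commute algebra_simps)
      then have "g y * G \<xi> * cis (k * ((y - c) \<bullet> \<xi>)) =
          (G \<xi> * cis (- k * (c \<bullet> \<xi>))) * (g y * cis (2 * pi * (((k / (2 * pi)) *\<^sub>R \<xi>) \<bullet> y)))" for y
        by (simp only: mult_ac)
      then show "(\<integral>y. g y * G \<xi> * cis (k * ((y - c) \<bullet> \<xi>)) \<partial>lborel) =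
          (G \<xi> * cis (- k * (c \<bullet> \<xi>))) * ift g ((k / (2 * pi)) *\<^sub>R \<xi>)"
        unfolding ift_def by (simp only: integral_mult_right_zero)
    qed
    also have "\<dots> = 0" by (simp only: 0 mult_zero_right Bochner_Integration.integral_zero)
    finally show ?thesis .
  qed
  obtain B where B: "\<And>x. norm (g x) \<le> B"
    using schwartz_bound[OF g, of 0] by auto
  have \<gamma>i: "integrable lborel \<gamma>"
  proof -
    have "\<gamma> = (\<lambda>y. (sqrt (2 * pi) ^ DIM('a)) *\<^sub>R G y)"
    proof
      fix y :: 'a
      have "(norm y)\<^sup>2 = (\<Sum>b\<in>Basis. (y \<bullet> b)\<^sup>2)"
        unfolding power2_norm_eq_inner by (subst euclidean_inner) (simp add: power2_eq_square)
      then have "\<gamma> y = (\<Prod>b\<in>Basis. complex_of_real (exp (- (y \<bullet> b)\<^sup>2 / 2)))"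
        by (simp add: \<gamma>_def sum_negf[symmetric] sum_divide_distrib exp_sum)
      also have "\<dots> = (\<Prod>b\<in>(Basis::'a set). complex_of_real (sqrt (2 * pi)) * complex_of_real (std_normal_density (y \<bullet> b)))"
        by (intro prod.cong refl) (simp add: std_normal_density_def)
      finally show "\<gamma> y = (sqrt (2 * pi) ^ DIM('a)) *\<^sub>R G y"
        by (simp add: prod.distrib G_def scaleR_conv_of_real)
    qed
    then show ?thesis using Gi by simp
  qed
  \<comment> \<open>The dilation is moved from the Gaussian to the argument of \<open>g\<close>: the
    bounded function \<open>g\<close> then supplies pointwise convergence, and the fixed Gaussian
    the dominating function.\<close>
  have s: "(\<integral>x. g (c + (1 / real (Suc n)) *\<^sub>R x) * \<gamma> x \<partial>lborel) = 0" for n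
  proof -
    define r where "r = 1 / real (Suc n)"
    have r: "r \<noteq> 0" "r > 0" by (auto simp: r_def)
    have "0 = (\<integral>y. g y * \<gamma> ((1 / r) *\<^sub>R (y - c)) \<partial>lborel)" using z by simp
    also have "\<dots> = (\<integral>x. r ^ DIM('a) *\<^sub>R (g (c + r *\<^sub>R x) * \<gamma> x) \<partial>lborel)"
      by (subst lborel_affine[OF r(1), of c], subst integral_density)
        (use r in \<open>auto simp: integral_distr\<close>)
    finally show ?thesis using r by (simp add: r_def)
  qed
  have "(\<lambda>n. \<integral>x. g (c + (1 / real (Suc n)) *\<^sub>R x) * \<gamma> x \<partial>lborel) \<longlonglongrightarrow> (\<integral>x. g c * \<gamma> x \<partial>lborel)"
  proof (rule integral_dominated_convergence[where w = "\<lambda>x. B * norm (\<gamma> x)"])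
    show "AE x in lborel. (\<lambda>n. g (c + (1 / real (Suc n)) *\<^sub>R x) * \<gamma> x) \<longlonglongrightarrow> g c * \<gamma> x"
    proof (intro AE_I2 tendsto_mult tendsto_const)
      fix x
      have "(\<lambda>n. c + (1 / real (Suc n)) *\<^sub>R x) \<longlonglongrightarrow> c + 0 *\<^sub>R x"
        by (intro tendsto_intros lim_1_over_n[THEN LIMSEQ_Suc])
      then show "(\<lambda>n. g (c + (1 / real (Suc n)) *\<^sub>R x)) \<longlonglongrightarrow> g c"
        using continuous_on_tendsto_compose[OF schwartz_continuous[OF g, of UNIV]] by simp
    qed
  qed (use \<gamma>i B in \<open>auto simp: norm_mult intro!: mult_right_mono\<close>)
  then have "(\<integral>x. g c * \<gamma> x \<partial>lborel) = 0" unfolding s by (simp add: LIMSEQ_const_iff)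
  moreover have "(\<integral>x. \<gamma> x \<partial>lborel) \<noteq> 0"
  proof -
    have "integral\<^sup>L lborel (\<lambda>x::'a. exp (- (norm x)\<^sup>2 / 2)) \<noteq> 0"
    proof
      assume "integral\<^sup>L lborel (\<lambda>x::'a. exp (- (norm x)\<^sup>2 / 2)) = 0"
      moreover have "integrable lborel (\<lambda>x::'a. exp (- (norm x)\<^sup>2 / 2))"
        using \<gamma>i unfolding \<gamma>_def[abs_def] complex_of_real_integrable_eq .
      ultimately have "AE x in (lborel :: 'a measure). exp (- (norm x)\<^sup>2 / 2) = 0"
        by (subst (asm) integral_nonneg_eq_0_iff_AE) auto
      then show False using AE_iff_measurable[of "UNIV :: 'a set" lborel "\<lambda>_. False"] by simp
    qed
    then show ?thesis unfolding \<gamma>_def by simp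
  qed
  ultimately show ?thesis by simp
qed

section \<open>Test functions\<close>

definition flat :: "nat \<Rightarrow> real \<Rightarrow> complex" where
  "flat k t = (if t > 0 then complex_of_real (exp (- 1 / t) / t ^ k) else 0)"

lemma has_vector_derivative_flat:
  "(flat k has_vector_derivative (flat (k + 2) t - of_nat k * flat (k + 1) t)) (at t)"
proof -
  consider "t > 0" | "t < 0" | "t = 0" by linarith
  then show ?thesis
  proof cases
    case 1
    have "((\<lambda>t. exp (- 1 / t) / t ^ k) has_real_derivative (exp (- 1 / t) / t ^ (k + 2) - k * (exp (- 1 / t) / t ^ (k + 1)))) (at t)"
      using 1 by (auto intro!: derivative_eq_intros simp: field_simps power2_eq_square)
        (cases k; simp add: field_simps)+
    then have "((\<lambda>t. complex_of_real (exp (- 1 / t) / t ^ k)) has_vector_derivative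
        complex_of_real (exp (- 1 / t) / t ^ (k + 2) - k * (exp (- 1 / t) / t ^ (k + 1)))) (at t)"
      unfolding has_real_derivative_iff_has_vector_derivative
      by (rule bounded_linear.has_vector_derivative[OF bounded_linear_of_real])
    then have "(flat k has_vector_derivative
        complex_of_real (exp (- 1 / t) / t ^ (k + 2) - k * (exp (- 1 / t) / t ^ (k + 1)))) (at t)"
      by (rule has_vector_derivative_transform_within_open[where S = "{0<..}"]) (use 1 in \<open>auto simp: flat_def\<close>)
    then show ?thesis using 1 by (simp add: flat_def)
  next
    case 2
    have "((\<lambda>_. 0 :: complex) has_vector_derivative 0) (at t)" by simp
    then have "(flat k has_vector_derivative 0) (at t)"
      by (rule has_vector_derivative_transform_within_open[where S = "{..<0}"]) (use 2 in \<open>auto simp: flat_def\<close>)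
    then show ?thesis using 2 by (simp add: flat_def)
  next
    case 3
    have "(flat k has_derivative (\<lambda>_. 0)) (at 0)"
    proof (rule has_derivative_quadratic)
      fix h :: real
      show "norm (flat k (0 + h) - flat k 0 - 0) \<le> fact (k + 2) * (norm h)\<^sup>2"
      proof (cases "h > 0")
        case True
        \<comment> \<open>The exponential series has nonnegative terms, so
          \<open>exp (1 / h)\<close> dominates its term of degree \<open>k + 2\<close>. Of these
          powers, \<open>k\<close> cancel the denominator of \<open>flat k\<close> and 2 give the
          quadratic bound at the origin.\<close>
        have "(1 / h) ^ (k + 2) / fact (k + 2) \<le> exp (1 / h)"
        proof -
          have "(\<Sum>n<k + 3. inverse (fact n) *\<^sub>R (1 / h) ^ n) \<le> exp (1 / h)"
            unfolding exp_def using True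
            by (intro sum_le_suminf summable_exp_generic) auto
          moreover have "inverse (fact (k + 2)) *\<^sub>R (1 / h) ^ (k + 2) \<le> (\<Sum>n<k + 3. inverse (fact n) *\<^sub>R (1 / h) ^ n)"
            using True by (intro member_le_sum) auto
          ultimately show ?thesis by (simp add: divide_inverse mult.commute)
        qed
        then have "1 \<le> exp (1 / h) * (fact (k + 2) * h ^ (k + 2))"
          using True by (simp add: field_simps del: fact_Suc power_Suc)
        then have "exp (- (1 / h)) * 1 \<le> exp (- (1 / h)) * (exp (1 / h) * (fact (k + 2) * h ^ (k + 2)))"
          by (rule mult_left_mono) simp
        also have "\<dots> = fact (k + 2) * h ^ (k + 2)"
          by (simp only: mult.assoc[symmetric] mult_exp_exp) simp
        finally have "exp (- (1 / h)) \<le> fact (k + 2) * h ^ (k + 2)" by simp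
        then have "exp (- 1 / h) / h ^ k \<le> fact (k + 2) * h\<^sup>2"
          using True power_add[of h k 2] by (simp only: pos_divide_le_eq zero_less_power) (simp add: mult_ac)
        then show ?thesis using True by (simp add: flat_def norm_divide norm_power del: of_real_exp of_real_divide fact_Suc)
      qed (simp add: flat_def)
    qed simp
    then show ?thesis using 3 by (simp add: has_vector_derivative_def flat_def)
  qed
qed

lemma moderate_norm_sq: "moderate (\<lambda>x::'a::euclidean_space. complex_of_real (1 - (norm (x - z))\<^sup>2))"
proof -
  have "moderate (\<lambda>x. 1 + (- 1) * (\<Sum>b\<in>Basis. (complex_of_real (x \<bullet> b) + - of_real (z \<bullet> b)) ^ 2))"
    by (intro sgrowth_add sgrowth_mult sgrowth_const sgrowth_sum sgrowth_power moderate_inner weight_norm)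
  also have "(\<lambda>x. 1 + (- 1) * (\<Sum>b\<in>Basis. (complex_of_real (x \<bullet> b) + - of_real (z \<bullet> b)) ^ 2)) =
      (\<lambda>x. complex_of_real (1 - (norm (x - z))\<^sup>2))"
    unfolding power2_norm_eq_inner
    by (subst euclidean_inner[of "_ - z"]) (simp add: inner_diff_left power2_eq_square)
  finally show ?thesis .
qed

lemma exists_test_fun: "\<exists>\<theta>. test_fun \<theta> \<and> \<theta> (z :: 'a::euclidean_space) \<noteq> 0"
proof (intro exI conjI)
  let ?\<theta> = "\<lambda>x::'a. flat 0 (1 - (norm (x - z))\<^sup>2)"
  have "smooth_in (\<lambda>_. True) (\<lambda>x. 1 * flat 0 (1 - (norm (x - z))\<^sup>2))"
  proof (rule smooth_in_real_comp[where P = "\<lambda>_. True" and G = "{\<lambda>t. c * flat k t |c k. True}"])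
    show "smooth_in (\<lambda>_. True) (\<lambda>x. complex_of_real (1 - (norm (x - z))\<^sup>2))"
      by (rule smooth_in_mono[OF moderate_norm_sq]) simp
    have "flat 0 = (\<lambda>t. 1 * flat 0 t)" by simp
    then show "flat 0 \<in> {\<lambda>t. c * flat k t |c k. True}" by blast
    fix \<phi> assume "\<phi> \<in> {\<lambda>t. c * flat k t |c k. True}"
    then obtain c k where \<phi>: "\<phi> = (\<lambda>t. c * flat k t)" by auto
    have "(\<phi> has_vector_derivative (c * flat (k + 2) t + (- c * of_nat k) * flat (k + 1) t)) (at t)" for t
      using has_vector_derivative_mult_right[OF has_vector_derivative_flat[of k t], of c]
      by (simp add: \<phi> algebra_simps)
    then show "\<exists>\<phi>1\<in>{\<lambda>t. c * flat k t |c k. True}. \<exists>\<phi>2\<in>{\<lambda>t. c * flat k t |c k. True}.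
        \<forall>t. (\<phi> has_vector_derivative (\<phi>1 t + \<phi>2 t)) (at t)"
      by (intro bexI[of _ "\<lambda>t. c * flat (k + 2) t"] bexI[of _ "\<lambda>t. (- c * of_nat k) * flat (k + 1) t"]) blast+
  qed (auto intro!: smooth_in_const)
  then have "smooth ?\<theta>" by (simp add: smooth_in_True)
  moreover have "{x. ?\<theta> x \<noteq> 0} \<subseteq> cball z 1"
    by (auto simp: flat_def dist_norm norm_minus_commute power_less_one_iff split: if_splits)
  then have "compact (closure {x. ?\<theta> x \<noteq> 0})"
    using bounded_subset[OF bounded_cball] compact_closure by blast
  ultimately show "test_fun ?\<theta>" by (simp add: test_fun_def)
  show "?\<theta> z \<noteq> 0" by (simp add: flat_def)
qed

lemma test_fun_schwartz:
  assumes "test_fun \<theta>" shows "schwartz \<theta>"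
  unfolding schwartz_iff smooth_in_def
proof (intro conjI ballI)
  show sm: "smooth \<theta>" using assms by (simp add: test_fun_def)
  define K where "K = closure {x. \<theta> x \<noteq> 0}"
  have K: "compact K" using assms by (simp add: test_fun_def K_def)
  fix vs :: "'a list" assume vs: "vs \<in> lists Basis"
  have zero: "iter_deriv vs \<theta> x = 0" if "x \<notin> K" for x
    using vs that
  proof (induction vs arbitrary: x)
    case Nil
    then show ?case using closure_subset[of "{x. \<theta> x \<noteq> 0}"] by (auto simp: K_def)
  next
    case (Cons v vs)
    have "((\<lambda>_. 0) has_derivative (\<lambda>_. 0)) (at x)" by simp
    then have "(iter_deriv vs \<theta> has_derivative (\<lambda>_. 0)) (at x)"
      by (rule has_derivative_transform_within_open[where s = "- K"])
        (use Cons K in \<open>auto simp: compact_imp_closed\<close>)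
    then show ?case by (simp add: pd_eqI)
  qed
  have "continuous_on UNIV (iter_deriv vs \<theta>)"
    using sm vs by (intro smooth_in_continuous[of "\<lambda>_. True"] smooth_in_iter_deriv) (simp_all add: smooth_in_True)
  then have c: "continuous_on K (iter_deriv vs \<theta>)" by (rule continuous_on_subset) simp
  show "rapid (iter_deriv vs \<theta>)"
    unfolding decay_def
  proof
    fix k
    have "compact ((\<lambda>x. (1 + norm x) ^ k * norm (iter_deriv vs \<theta> x)) ` K)"
      by (intro compact_continuous_image K continuous_intros c)
    from compact_imp_bounded[OF this] obtain B where
      "\<forall>y\<in>(\<lambda>x. (1 + norm x) ^ k * norm (iter_deriv vs \<theta> x)) ` K. norm y \<le> B"
      unfolding bounded_iff by blast
    then have B: "\<And>x. x \<in> K \<Longrightarrow> norm ((1 + norm x) ^ k * norm (iter_deriv vs \<theta> x)) \<le> B" by simp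
    have "(1 + norm x) ^ k * norm (iter_deriv vs \<theta> x) \<le> \<bar>B\<bar> * 1 ^ 0" for x
      using B[of x] zero[of x] by (cases "x \<in> K") auto
    then show "\<exists>C K. \<forall>x. (1 + norm x) ^ k * norm (iter_deriv vs \<theta> x) \<le> C * 1 ^ K" by blast
  qed
qed

section \<open>Tempered distributions and integrals of families\<close>

text \<open>A common pointwise bound for all derivatives of order at most \<open>N\<close>. In this
  form a bound can be scaled and integrated over a parameter, whereas the sum of suprema in
  \<open>tempered\<close> cannot be handled termwise so directly.\<close>

definition seminorm_le :: "nat \<Rightarrow> ('a::euclidean_space \<Rightarrow> complex) \<Rightarrow> real \<Rightarrow> bool" where
  "seminorm_le N \<phi> e \<longleftrightarrow>
     (\<forall>vs\<in>lists Basis. length vs \<le> N \<longrightarrow> (\<forall>x. (1 + norm x) ^ N * norm (iter_deriv vs \<phi> x) \<le> e))"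

lemma tempered_add: "tempered T \<Longrightarrow> schwartz \<phi> \<Longrightarrow> schwartz \<psi> \<Longrightarrow> T (\<lambda>x. \<phi> x + \<psi> x) = T \<phi> + T \<psi>"
  by (auto simp: tempered_def)

lemma tempered_scale: "tempered T \<Longrightarrow> schwartz \<phi> \<Longrightarrow> T (\<lambda>x. c * \<phi> x) = c * T \<phi>"
  by (auto simp: tempered_def)

lemma finite_multi_indices: "finite {vs. vs \<in> lists (Basis :: 'a::euclidean_space set) \<and> length vs \<le> N}"
  using finite_lists_length_le[of "Basis :: 'a set" N] by (simp add: lists_eq_set)

lemma tempered_bound:
  assumes "tempered (T :: 'a::euclidean_space distr)"
  obtains C N where "0 \<le> C" "\<And>\<phi> e. schwartz \<phi> \<Longrightarrow> seminorm_le N \<phi> e \<Longrightarrow> norm (T \<phi>) \<le> C * e"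
proof -
  obtain C N where CN: "\<And>\<phi>. schwartz \<phi> \<Longrightarrow>
      norm (T \<phi>) \<le> C * (\<Sum>vs | vs \<in> lists Basis \<and> length vs \<le> N. schwartz_seminorm N vs \<phi>)"
    using assms unfolding tempered_def by blast
  let ?V = "{vs. vs \<in> lists (Basis :: 'a set) \<and> length vs \<le> N}"
  have "norm (T \<phi>) \<le> (\<bar>C\<bar> * card ?V) * e" if \<phi>: "schwartz \<phi>" and e: "seminorm_le N \<phi> e" for \<phi> e
  proof -
    have "schwartz_seminorm N vs \<phi> \<le> e" "0 \<le> schwartz_seminorm N vs \<phi>" if "vs \<in> ?V" for vs
    proof -
      show "schwartz_seminorm N vs \<phi> \<le> e"
        unfolding schwartz_seminorm_def using e that by (intro cSUP_least) (auto simp: seminorm_le_def)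
      have "bdd_above (range (\<lambda>x. (1 + norm x) ^ N * norm (iter_deriv vs \<phi> x)))"
        using \<phi> that by (auto simp: schwartz_def)
      then show "0 \<le> schwartz_seminorm N vs \<phi>"
        unfolding schwartz_seminorm_def by (rule cSUP_upper2[of _ _ 0]) auto
    qed
    then have "(\<Sum>vs\<in>?V. schwartz_seminorm N vs \<phi>) \<le> card ?V * e" "0 \<le> (\<Sum>vs\<in>?V. schwartz_seminorm N vs \<phi>)"
      using sum_bounded_above[of ?V "\<lambda>vs. schwartz_seminorm N vs \<phi>" e]
        sum_nonneg[of ?V "\<lambda>vs. schwartz_seminorm N vs \<phi>"] by blast+
    then have "\<bar>C\<bar> * (\<Sum>vs\<in>?V. schwartz_seminorm N vs \<phi>) \<le> \<bar>C\<bar> * (card ?V * e)"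
      and "C * (\<Sum>vs\<in>?V. schwartz_seminorm N vs \<phi>) \<le> \<bar>C\<bar> * (\<Sum>vs\<in>?V. schwartz_seminorm N vs \<phi>)"
      by (auto intro!: mult_left_mono mult_right_mono)
    then show ?thesis using CN[OF \<phi>] by (simp add: mult.assoc)
  qed
  then show ?thesis
    by (rule that[of "\<bar>C\<bar> * card ?V" N, rotated]) simp_all
qed

lemma iter_deriv_diff:
  assumes f: "smooth f" and g: "smooth g" and vs: "vs \<in> lists Basis"
  shows "iter_deriv vs (\<lambda>x. f x - g x) = (\<lambda>x. iter_deriv vs f x - iter_deriv vs g x)"
  using vs
proof (induction rule: lists.induct)
  case (Cons v vs)
  have "(iter_deriv vs f has_derivative frechet_derivative (iter_deriv vs f) (at x)) (at x)"
    "(iter_deriv vs g has_derivative frechet_derivative (iter_deriv vs g) (at x)) (at x)" for x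
    using f g Cons.hyps by (auto simp: smooth_def simp flip: frechet_derivative_works)
  from pd_eqI[OF has_derivative_diff[OF this]] show ?case using Cons by simp
qed simp

lemma iter_deriv_scale:
  assumes g: "schwartz g" and vs: "vs \<in> lists Basis"
  shows "iter_deriv vs (\<lambda>y. c * g y) = (\<lambda>y. c * iter_deriv vs g y)"
  using vs
proof (induction rule: lists.induct)
  case (Cons v vs)
  have "iter_deriv vs g differentiable (at x)" for x
    using schwartz_iter_deriv[OF g Cons.hyps(2)] smooth_in_differentiable schwartz_iff by blast
  then have "(iter_deriv vs g has_derivative frechet_derivative (iter_deriv vs g) (at x)) (at x)" for x
    by (simp add: frechet_derivative_works)
  from pd_eqI[OF has_derivative_mult_right[OF this]] show ?case using Cons by simp
qed simp

lemma uniform_polynomial_bound: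
  fixes F :: "'i \<Rightarrow> 'z \<Rightarrow> real"
  assumes "finite S" "weight w" "\<And>i. i \<in> S \<Longrightarrow> \<exists>C\<ge>0. \<exists>K::nat. \<forall>z. F i z \<le> C * w z ^ K"
  obtains C and K :: nat where "0 \<le> C" "\<And>i z. i \<in> S \<Longrightarrow> F i z \<le> C * w z ^ K"
proof -
  obtain C K where CK: "\<And>i. i \<in> S \<Longrightarrow> 0 \<le> C i" "\<And>i z. i \<in> S \<Longrightarrow> F i z \<le> C i * w z ^ K i"
    using assms(3) by metis
  have "F i z \<le> (\<Sum>i\<in>S. C i) * w z ^ (\<Sum>i\<in>S. K i)" if "i \<in> S" for i z
  proof -
    have "F i z \<le> C i * w z ^ K i" using CK that by auto
    also have "\<dots> \<le> (\<Sum>i\<in>S. C i) * w z ^ (\<Sum>i\<in>S. K i)"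
      using assms(1,2) that CK(1)
      by (intro mult_mono power_increasing member_le_sum sum_nonneg)
        (auto simp: weight_def intro!: zero_le_power order_trans[OF zero_le_one])
    finally show ?thesis .
  qed
  then show ?thesis using CK(1) by (intro that[of "\<Sum>i\<in>S. C i"]) (auto intro: sum_nonneg)
qed

section \<open>Seminorms and superpositions of families\<close>

lemma family_seminorm:
  fixes f :: "'p::euclidean_space \<times> 'a::euclidean_space \<Rightarrow> complex"
  assumes f: "schwartz_family w f" and w: "weight w"
  obtains C and K :: nat where "0 \<le> C" "\<And>p. seminorm_le N (\<lambda>y. f (p, y)) (C * w p ^ K)"
proof -
  let ?V = "{vs. vs \<in> lists (Basis :: 'a set) \<and> length vs \<le> N}"
  have w': "weight (\<lambda>z::'p \<times> 'a. w (fst z))" using w by (simp add: weight_def)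
  obtain C and K :: nat where CK: "0 \<le> C"
    "\<And>vs z. vs \<in> ?V \<Longrightarrow> (1 + norm (snd z)) ^ N * norm (iter_deriv (map (Pair 0) vs) f z) \<le> C * w (fst z) ^ K"
  proof (rule uniform_polynomial_bound[OF finite_multi_indices w',
        where F = "\<lambda>vs z. (1 + norm (snd z)) ^ N * norm (iter_deriv (map (Pair 0) vs) f z)"])
    fix vs :: "'a list" assume "vs \<in> ?V"
    then have "decay (\<lambda>z. 1 + norm (snd z)) (\<lambda>z. w (fst z)) (iter_deriv (map (Pair 0) vs) f)"
      using f lists_Pair0[of vs] unfolding smooth_in_def by blast
    from decayE[OF this w', of N]
    show "\<exists>C\<ge>0. \<exists>K. \<forall>z. (1 + norm (snd z)) ^ N * norm (iter_deriv (map (Pair 0) vs) f z) \<le> C * w (fst z) ^ K"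
      by metis
  qed blast
  show ?thesis
  proof (rule that[OF CK(1)])
    show "seminorm_le N (\<lambda>y. f (p, y)) (C * w p ^ K)" for p
      unfolding seminorm_le_def
    proof (intro ballI impI allI)
      fix vs :: "'a list" and x assume vs: "vs \<in> lists Basis" "length vs \<le> N"
      then show "(1 + norm x) ^ N * norm (iter_deriv vs (\<lambda>y. f (p, y)) x) \<le> C * w p ^ K"
        using CK(2)[of vs "(p, x)"] by (simp add: iter_deriv_slice[OF smooth_in_smooth[OF f]])
    qed
  qed
qed

abbreviation tame_family :: "('p::euclidean_space \<times> 'a::euclidean_space \<Rightarrow> complex) \<Rightarrow> bool" where
  "tame_family \<equiv> schwartz_family (\<lambda>p. 1 + norm p)"

text \<open>The two slices are joined by a segment in the parameter direction, along which
  \<open>increment_le\<close> applies to every derivative. On a segment of length at most 1 the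
  weight \<open>1 + norm p\<close> at most doubles, hence the \<open>2 ^ K\<close>.\<close>

lemma family_lipschitz:
  fixes f :: "'p::euclidean_space \<times> 'a::euclidean_space \<Rightarrow> complex"
  assumes f: "tame_family f"
  obtains C and K :: nat where "0 \<le> C"
    "\<And>p p'. norm (p - p') \<le> 1 \<Longrightarrow> seminorm_le N (\<lambda>y. f (p, y) - f (p', y)) (C * (1 + norm p') ^ K * norm (p - p'))"
proof -
  let ?V = "{vs. vs \<in> lists (Basis :: 'a set) \<and> length vs \<le> N} \<times> (Basis :: ('p \<times> 'a) set)"
  let ?D = "\<lambda>vs. iter_deriv (map (Pair 0) vs) f"
  have w': "weight (\<lambda>z::'p \<times> 'a. 1 + norm (fst z))" by simp
  obtain C and K :: nat where CK: "0 \<le> C"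
    "\<And>i z. i \<in> ?V \<Longrightarrow> (1 + norm (snd z)) ^ N * norm (pd (snd i) (?D (fst i)) z) \<le> C * (1 + norm (fst z)) ^ K"
  proof (rule uniform_polynomial_bound[OF finite_cartesian_product[OF finite_multi_indices finite_Basis] w',
        where F = "\<lambda>i z. (1 + norm (snd z)) ^ N * norm (pd (snd i) (?D (fst i)) z)"])
    fix i assume "i \<in> ?V"
    then have "tame_family (pd (snd i) (?D (fst i)))"
      by (intro smooth_in_pd smooth_in_iter_deriv f lists_Pair0) auto
    from decayE[OF smooth_in_imp[OF this] w', of N]
    show "\<exists>C\<ge>0. \<exists>K. \<forall>z. (1 + norm (snd z)) ^ N * norm (pd (snd i) (?D (fst i)) z) \<le> C * (1 + norm (fst z)) ^ K"
      by metis
  qed blast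
  let ?C = "real DIM('p \<times> 'a) * (C * 2 ^ K)"
  show ?thesis
  proof (rule that[of ?C K])
    show "0 \<le> ?C" using CK(1) by simp
    fix p p' :: 'p assume p: "norm (p - p') \<le> 1"
    show "seminorm_le N (\<lambda>y. f (p, y) - f (p', y)) (?C * (1 + norm p') ^ K * norm (p - p'))"
      unfolding seminorm_le_def
    proof (intro ballI impI allI)
      fix vs :: "'a list" and x assume vs: "vs \<in> lists Basis" "length vs \<le> N"
      have "norm (?D vs ((p', x) + (p - p', 0)) - ?D vs (p', x)) \<le>
          real DIM('p \<times> 'a) * (C * (2 * (1 + norm p')) ^ K * (1 / (1 + norm x) ^ N)) * norm (p - p', 0 :: 'a)"
      proof (rule increment_le)
        show "?D vs differentiable (at z)" for z
          using vs by (intro smooth_in_differentiable[OF smooth_in_iter_deriv[OF f]] lists_Pair0)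
        fix b :: "'p \<times> 'a" and s :: real assume b: "b \<in> Basis" and s: "0 \<le> s" "s \<le> 1"
        have "(1 + norm x) ^ N * norm (pd b (?D vs) ((p', x) + s *\<^sub>R (p - p', 0))) \<le>
            C * (1 + norm (p' + s *\<^sub>R (p - p'))) ^ K"
          using CK(2)[of "(vs, b)" "(p', x) + s *\<^sub>R (p - p', 0)"] vs b by simp
        also have "\<dots> \<le> C * (2 * (1 + norm p')) ^ K"
        proof (intro mult_left_mono power_mono)
          have "norm (p' + s *\<^sub>R (p - p')) \<le> norm p' + s * norm (p - p')"
            using s by (intro norm_triangle_le) simp
          also have "\<dots> \<le> norm p' + 1" using s p mult_le_one[of s "norm (p - p')"] by simp
          finally have "1 + norm (p' + s *\<^sub>R (p - p')) \<le> 1 + (norm p' + 1)" by simp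
          also have "\<dots> \<le> 2 * (1 + norm p')" by simp
          finally show "1 + norm (p' + s *\<^sub>R (p - p')) \<le> 2 * (1 + norm p')" .
        qed (use CK in auto)
        finally show "norm (pd b (?D vs) ((p', x) + s *\<^sub>R (p - p', 0))) \<le> C * (2 * (1 + norm p')) ^ K * (1 / (1 + norm x) ^ N)"
          by (rule decay_pointwise)
      qed
      then have "norm (?D vs (p, x) - ?D vs (p', x)) \<le>
          (?C * (1 + norm p') ^ K * norm (p - p')) * (1 / (1 + norm x) ^ N)"
        by (simp only: power_mult_distrib) (simp add: mult_ac del: DIM_prod)
      moreover have "0 < (1 + norm x) ^ N" by (intro zero_less_power add_pos_nonneg) auto
      ultimately have "(1 + norm x) ^ N * norm (?D vs (p, x) - ?D vs (p', x)) \<le> ?C * (1 + norm p') ^ K * norm (p - p')"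
        by (simp add: pos_le_divide_eq mult.commute)
      then show "(1 + norm x) ^ N * norm (iter_deriv vs (\<lambda>y. f (p, y) - f (p', y)) x) \<le> ?C * (1 + norm p') ^ K * norm (p - p')"
        using smooth_slice[OF smooth_in_smooth[OF f]] vs
        by (simp add: iter_deriv_diff iter_deriv_slice[OF smooth_in_smooth[OF f]])
    qed
  qed
qed

text \<open>Only measurability and finite moments are asked of the amplitudes of a superposition, so
  that they may be cut by indicator functions.\<close>

definition rapid_measurable :: "('p::euclidean_space \<Rightarrow> complex) \<Rightarrow> bool" where
  "rapid_measurable A \<longleftrightarrow> A \<in> borel_measurable borel \<and>
     (\<forall>k::nat. integrable lborel (\<lambda>p. (1 + norm p) ^ k * norm (A p)))"

lemma rapid_measurable_mult:
  assumes A: "rapid_measurable A" and g: "g \<in> borel_measurable borel" and b: "\<And>p. norm (g p) \<le> C * (1 + norm p) ^ K"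
  shows "integrable lborel (\<lambda>p. A p * g p)"
proof (rule Bochner_Integration.integrable_bound)
  show "integrable lborel (\<lambda>p. C * ((1 + norm p) ^ K * norm (A p)))"
    using A by (auto simp: rapid_measurable_def)
  have [measurable]: "A \<in> borel_measurable borel" "g \<in> borel_measurable borel"
    using A g by (auto simp: rapid_measurable_def)
  show "(\<lambda>p. A p * g p) \<in> borel_measurable lborel" by measurable
  have "norm (A p * g p) \<le> C * ((1 + norm p) ^ K * norm (A p))" for p
    using mult_left_mono[OF b[of p], of "norm (A p)"] by (simp add: norm_mult mult_ac)
  then show "AE p in lborel. norm (A p * g p) \<le> norm (C * ((1 + norm p) ^ K * norm (A p)))"
    by (intro AE_I2) (metis abs_ge_self order_trans real_norm_def)
qed

lemma rapid_measurable_indicator: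
  assumes A: "rapid_measurable A" and [measurable]: "S \<in> sets borel"
  shows "rapid_measurable (\<lambda>p. indicator S p * A p)"
  unfolding rapid_measurable_def
proof (intro conjI allI)
  have [measurable]: "A \<in> borel_measurable borel" using A by (simp add: rapid_measurable_def)
  show "(\<lambda>p. indicator S p * A p) \<in> borel_measurable borel" by measurable
  fix k
  show "integrable lborel (\<lambda>p. (1 + norm p) ^ k * norm (indicator S p * A p))"
    by (rule Bochner_Integration.integrable_bound[where f = "\<lambda>p. (1 + norm p) ^ k * norm (A p)"])
      (use A in \<open>auto simp: rapid_measurable_def indicator_def\<close>)
qed

lemma family_continuous: "tame_family f \<Longrightarrow> continuous_on S f"
  by (rule smooth_in_continuous)

lemma family_slice_measurable:
  assumes "tame_family f"
  shows "(\<lambda>p. f (p, y)) \<in> borel_measurable borel"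
  by (intro borel_measurable_continuous_onI continuous_on_compose2[OF family_continuous[OF assms, of UNIV]] continuous_intros) auto

lemma family_integrable:
  assumes A: "rapid_measurable A" and f: "tame_family f"
  shows "integrable lborel (\<lambda>p. A p * f (p, y))"
proof -
  obtain C K where "\<And>z. (1 + norm (snd z)) ^ 0 * norm (f z) \<le> C * (1 + norm (fst z)) ^ K"
    using decayE[OF smooth_in_imp[OF f] weight_norm, of 0] by blast
  from this[of "(_, y)"] show ?thesis
    by (intro rapid_measurable_mult[OF A family_slice_measurable[OF f]]) auto
qed

definition superpose :: "('p::euclidean_space \<Rightarrow> complex) \<Rightarrow> ('p \<times> 'a::euclidean_space \<Rightarrow> complex) \<Rightarrow> 'a \<Rightarrow> complex" where
  "superpose A f y = (\<integral>p. A p * f (p, y) \<partial>lborel)"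

lemma superpose_has_derivative:
  fixes f :: "'p::euclidean_space \<times> 'a::euclidean_space \<Rightarrow> complex"
  assumes A: "rapid_measurable A" and f: "tame_family f"
  shows "(superpose A f has_derivative (\<lambda>h. \<Sum>b\<in>Basis. (h \<bullet> b) *\<^sub>R superpose A (pd (0, b) f) y)) (at y)"
proof -
  have B0: "(0, b) \<in> Basis" if "b \<in> Basis" for b :: 'a using that by (simp add: Basis_prod_def)
  have pdf: "tame_family (pd (0, b) f)" if "b \<in> Basis" for b using smooth_in_pd[OF f B0[OF that]] .
  have slice: "pd b (\<lambda>y. f (p, y)) = (\<lambda>y. pd (0, b) f (p, y))" if "b \<in> Basis" for b p
    using iter_deriv_slice[OF smooth_in_smooth[OF f], of "[b]" p] that by simp
  \<comment> \<open>Order 2 because the Taylor remainder of a slice involves its second derivatives;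
    the resulting bound is uniform in the point and integrable against \<open>A\<close>.\<close>
  obtain C K where C: "0 \<le> C" "\<And>p. seminorm_le 2 (\<lambda>y. f (p, y)) (C * (1 + norm p) ^ K)"
    using family_seminorm[OF f, of 2] by auto
  define E where "E = (real DIM('a))\<^sup>2 * C * (\<integral>p. (1 + norm p) ^ K * norm (A p) \<partial>lborel)"
  show ?thesis
  proof (rule has_derivative_quadratic[where C = E])
  show "bounded_linear (\<lambda>h. \<Sum>b\<in>Basis. (h \<bullet> b) *\<^sub>R superpose A (pd (0, b) f) y)"
    by (intro bounded_linear_sum bounded_linear_scaleR_left bounded_linear_compose[OF bounded_linear_scaleR_left]
        bounded_linear_inner_left)
  fix h :: 'a
  have "superpose A f (y + h) - superpose A f y - (\<Sum>b\<in>Basis. (h \<bullet> b) *\<^sub>R superpose A (pd (0, b) f) y) =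
      (\<integral>p. A p * f (p, y + h) - A p * f (p, y) - (\<Sum>b\<in>Basis. (h \<bullet> b) *\<^sub>R (A p * pd (0, b) f (p, y))) \<partial>lborel)"
    unfolding superpose_def
    by (simp add: family_integrable[OF A f] family_integrable[OF A pdf])
  also have "\<dots> = (\<integral>p. A p * (f (p, y + h) - f (p, y) - frechet_derivative (\<lambda>y. f (p, y)) (at y) h) \<partial>lborel)"
  proof -
    have "(\<Sum>b\<in>Basis. (h \<bullet> b) *\<^sub>R (A p * pd (0, b) f (p, y))) = A p * frechet_derivative (\<lambda>y. f (p, y)) (at y) h" for p
    proof -
      have "smooth_in rapid (\<lambda>y. f (p, y))"
        using schwartz_family_slice[OF f, of p] by (simp only: schwartz_iff)
      then have d: "(\<lambda>y. f (p, y)) differentiable (at y)" by (rule smooth_in_differentiable)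
      show ?thesis
        unfolding frechet_euclidean[OF d, of h] sum_distrib_left
        by (intro sum.cong refl) (simp add: slice[THEN fun_cong])
    qed
    then show ?thesis by (simp only: right_diff_distrib)
  qed
  also have "norm \<dots> \<le> (\<integral>p. (real DIM('a))\<^sup>2 * C * ((1 + norm p) ^ K * norm (A p)) * (norm h)\<^sup>2 \<partial>lborel)"
  proof (rule order_trans[OF integral_norm_bound], rule integral_mono_AE')
    show "integrable lborel (\<lambda>p. (real DIM('a))\<^sup>2 * C * ((1 + norm p) ^ K * norm (A p)) * (norm h)\<^sup>2)"
      using A by (auto simp: rapid_measurable_def)
    have "norm (A p) * norm (f (p, y + h) - f (p, y) - frechet_derivative (\<lambda>y. f (p, y)) (at y) h) \<le>
        norm (A p) * ((real DIM('a))\<^sup>2 * (C * (1 + norm p) ^ K) * (norm h)\<^sup>2)" for p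
    proof (intro mult_left_mono taylor_le[where P = rapid])
      fix b c :: 'a and s :: real assume bc: "b \<in> Basis" "c \<in> Basis"
      let ?y = "y + s *\<^sub>R h" and ?g = "\<lambda>y. f (p, y)"
      have "norm (pd b (pd c ?g) ?y) \<le> (1 + norm ?y) ^ 2 * norm (pd b (pd c ?g) ?y)"
        by (simp add: mult_left_le_one_le mult_le_cancel_right1 mult_le_cancel_right2 one_le_power)
      also have "\<dots> \<le> C * (1 + norm p) ^ K"
        using C(2)[of p] bc unfolding seminorm_le_def by (elim ballE[of _ _ "[b, c]"]) auto
      finally show "norm (pd b (pd c ?g) ?y) \<le> C * (1 + norm p) ^ K" .
    qed (use schwartz_family_slice[OF f] in \<open>auto simp: schwartz_iff\<close>)
    then show "AE p in lborel. norm (A p * (f (p, y + h) - f (p, y) - frechet_derivative (\<lambda>y. f (p, y)) (at y) h)) \<le>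
       (real DIM('a))\<^sup>2 * C * ((1 + norm p) ^ K * norm (A p)) * (norm h)\<^sup>2"
      by (simp add: norm_mult mult_ac)
  qed (use C in simp)
  also have "\<dots> = E * (norm h)\<^sup>2" by (simp add: E_def)
  finally show "norm (superpose A f (y + h) - superpose A f y - (\<Sum>b\<in>Basis. (h \<bullet> b) *\<^sub>R superpose A (pd (0, b) f) y)) \<le> E * (norm h)\<^sup>2" .
qed
qed

lemma iter_deriv_superpose:
  fixes f :: "'p::euclidean_space \<times> 'a::euclidean_space \<Rightarrow> complex"
  assumes A: "rapid_measurable A" and f: "tame_family f" and vs: "vs \<in> lists Basis"
  shows "iter_deriv vs (superpose A f) = superpose A (iter_deriv (map (Pair 0) vs) f)"
  using vs
proof (induction rule: lists.induct)
  case (Cons v vs)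
  have t: "tame_family (iter_deriv (map (Pair 0) vs) f)" using Cons.hyps f by (intro smooth_in_iter_deriv lists_Pair0)
  have "(\<Sum>b\<in>Basis. (v \<bullet> b) *\<^sub>R superpose A (pd (0, b) g) y) = superpose A (pd (0, v) g) y" for g :: "'p \<times> 'a \<Rightarrow> complex" and y
    using Cons.hyps by (subst sum.remove[of _ v]) (auto simp: inner_Basis split: if_splits intro!: sum.neutral)
  then have "pd v (superpose A (iter_deriv (map (Pair 0) vs) f)) = superpose A (pd (0, v) (iter_deriv (map (Pair 0) vs) f))"
    by (intro ext, subst pd_eqI[OF superpose_has_derivative[OF A t]])
  then show ?case using Cons.IH by simp
qed simp

text \<open>Derivatives of a superposition are superpositions of derivatives, so pointwise seminorm
  bounds may be integrated over the parameter.\<close>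

lemma superpose_seminorm:
  fixes f :: "'p::euclidean_space \<times> 'a::euclidean_space \<Rightarrow> complex"
  assumes A: "rapid_measurable A" and f: "tame_family f"
    and B: "integrable lborel B" "\<And>p. seminorm_le N (\<lambda>y. A p * f (p, y)) (B p)"
  shows "seminorm_le N (superpose A f) (\<integral>p. B p \<partial>lborel)"
  unfolding seminorm_le_def
proof (intro ballI impI allI)
  fix vs :: "'a list" and x assume vs: "vs \<in> lists Basis" "length vs \<le> N"
  let ?D = "iter_deriv (map (Pair 0) vs) f"
  have D: "tame_family ?D" using vs f by (intro smooth_in_iter_deriv lists_Pair0)
  have sl: "schwartz (\<lambda>y. f (p, y))" for p by (rule schwartz_family_slice[OF f])
  have "(1 + norm x) ^ N * norm (iter_deriv vs (superpose A f) x) = norm (\<integral>p. (1 + norm x) ^ N *\<^sub>R (A p * ?D (p, x)) \<partial>lborel)"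
    by (simp add: iter_deriv_superpose[OF A f vs(1)] superpose_def)
  also have "\<dots> \<le> (\<integral>p. B p \<partial>lborel)"
  proof (rule Bochner_Integration.integral_norm_bound_integral)
    show "integrable lborel (\<lambda>p. (1 + norm x) ^ N *\<^sub>R (A p * ?D (p, x)))"
      by (intro integrable_scaleR_right family_integrable[OF A D])
    fix p
    have "(1 + norm x) ^ N * norm (iter_deriv vs (\<lambda>y. A p * f (p, y)) x) \<le> B p"
      using B(2)[of p] vs unfolding seminorm_le_def by blast
    then show "norm ((1 + norm x) ^ N *\<^sub>R (A p * ?D (p, x))) \<le> B p"
      by (simp add: iter_deriv_scale[OF sl vs(1)] iter_deriv_slice[OF smooth_in_smooth[OF f] vs(1)] norm_mult)
  qed fact
  finally show "(1 + norm x) ^ N * norm (iter_deriv vs (superpose A f) x) \<le> (\<integral>p. B p \<partial>lborel)" .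
qed

lemma seminorm_le_scale:
  assumes "seminorm_le N g e" "schwartz g"
  shows "seminorm_le N (\<lambda>y. c * g y) (norm c * e)"
  unfolding seminorm_le_def
proof (intro ballI impI allI)
  fix vs :: "'a list" and x assume vs: "vs \<in> lists Basis" "length vs \<le> N"
  have "iter_deriv vs (\<lambda>y. c * g y) = (\<lambda>y. c * iter_deriv vs g y)"
    by (rule iter_deriv_scale[OF assms(2) vs(1)])
  moreover have "(1 + norm x) ^ N * norm (iter_deriv vs g x) \<le> e"
    using assms(1) vs by (auto simp: seminorm_le_def)
  from mult_left_mono[OF this, of "norm c"]
  have "norm c * ((1 + norm x) ^ N * norm (iter_deriv vs g x)) \<le> norm c * e" by simp
  ultimately show "(1 + norm x) ^ N * norm (iter_deriv vs (\<lambda>y. c * g y) x) \<le> norm c * e"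
    by (simp add: norm_mult mult_ac)
qed

lemma schwartz_superpose:
  fixes f :: "'p::euclidean_space \<times> 'a::euclidean_space \<Rightarrow> complex"
  assumes A: "rapid_measurable A" and f: "tame_family f"
  shows "schwartz (superpose A f)"
proof -
  have 1: "iter_deriv vs (superpose A f) differentiable (at x)" if vs: "vs \<in> lists Basis" for vs x
  proof -
    have "tame_family (iter_deriv (map (Pair 0) vs) f)"
      by (rule smooth_in_iter_deriv[OF f lists_Pair0[OF vs]])
    from superpose_has_derivative[OF A this, of x]
    show ?thesis unfolding iter_deriv_superpose[OF A f vs] by (rule differentiableI)
  qed
  have 2: "rapid (iter_deriv vs (superpose A f))" if vs: "vs \<in> lists Basis" for vs
    unfolding decay_def
  proof
    fix k
    \<comment> \<open>In \<open>seminorm_le\<close> a single number bounds both the exponent of the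
      weight and the order of the derivatives, so it has to dominate \<open>k\<close> and the length
      of \<open>vs\<close>.\<close>
    define N where "N = max k (length vs)"
    obtain C K where C: "0 \<le> C" "\<And>p. seminorm_le N (\<lambda>y. f (p, y)) (C * (1 + norm p) ^ K)"
      using family_seminorm[OF f, of N] by auto
    have "seminorm_le N (superpose A f) (\<integral>p. norm (A p) * (C * (1 + norm p) ^ K) \<partial>lborel)"
    proof (rule superpose_seminorm[OF A f])
      have "integrable lborel (\<lambda>p. C * ((1 + norm p) ^ K * norm (A p)))"
        using A by (auto simp: rapid_measurable_def)
      then show "integrable lborel (\<lambda>p. norm (A p) * (C * (1 + norm p) ^ K))" by (simp add: mult_ac)
    qed (intro seminorm_le_scale C schwartz_family_slice[OF f])
    then have "(1 + norm x) ^ N * norm (iter_deriv vs (superpose A f) x) \<le> (\<integral>p. norm (A p) * (C * (1 + norm p) ^ K) \<partial>lborel)" for x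
      using vs by (auto simp: seminorm_le_def N_def)
    moreover have "(1 + norm x) ^ k * norm (iter_deriv vs (superpose A f) x) \<le> (1 + norm x) ^ N * norm (iter_deriv vs (superpose A f) x)" for x
      by (intro mult_right_mono power_increasing) (auto simp: N_def)
    ultimately show "\<exists>C K. \<forall>x. (1 + norm x) ^ k * norm (iter_deriv vs (superpose A f) x) \<le> C * 1 ^ K"
      by (intro exI allI) (auto intro: order_trans simp: power_one)
  qed
  show ?thesis unfolding schwartz_iff smooth_in_def smooth_def using 1 2 by blast
qed

lemma decay_weight_1:
  assumes "decay \<rho> (\<lambda>_. 1) f"
  shows "decay \<rho> w f"
  unfolding decay_def
proof
  fix k
  obtain C K where "\<And>x. \<rho> x ^ k * norm (f x) \<le> C * 1 ^ K" using assms unfolding decay_def by blast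
  then show "\<exists>C K. \<forall>x. \<rho> x ^ k * norm (f x) \<le> C * w x ^ K" by (intro exI[of _ C] exI[of _ 0]) simp
qed

lemma tempered_diff:
  assumes "tempered T" "schwartz \<phi>" "schwartz \<psi>"
  shows "T (\<lambda>x. \<phi> x - \<psi> x) = T \<phi> - T \<psi>"
  using tempered_add[OF assms(1,2) schwartz_scale[OF assms(3), of "-1"]] tempered_scale[OF assms(1,3), of "-1"]
  by simp

lemma seminorm_le_mono: "seminorm_le N g e \<Longrightarrow> e \<le> e' \<Longrightarrow> seminorm_le N g e'"
  unfolding seminorm_le_def by (meson order_trans)

text \<open>
  The error \<open>T (\<integral> A p f(p, .) dp) - \<integral> A p T(f(p, .)) dp\<close> is additive in \<open>A\<close>, of order
  \<open>\<delta> \<integral> |A|\<close> if \<open>A\<close> is supported in a ball of radius \<open>\<delta>\<close>, and small if \<open>A\<close> is supported far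
  from the origin. Hence it vanishes.
\<close>

theorem tempered_superpose:
  fixes f :: "'p::euclidean_space \<times> 'a::euclidean_space \<Rightarrow> complex"
  assumes T: "tempered T" and f: "tame_family f"
  shows continuous_tempered_family: "continuous_on UNIV (\<lambda>p. T (\<lambda>y. f (p, y)))"
    and bounded_tempered_family: "\<exists>C K. \<forall>p. norm (T (\<lambda>y. f (p, y))) \<le> C * (1 + norm p) ^ K"
    and tempered_superpose_eq: "rapid_measurable A \<Longrightarrow> T (superpose A f) = (\<integral>p. A p * T (\<lambda>y. f (p, y)) \<partial>lborel)"
proof -
  define \<theta> where "\<theta> p = T (\<lambda>y. f (p, y))" for p
  obtain D N where D: "0 \<le> D" "\<And>\<phi> e. schwartz \<phi> \<Longrightarrow> seminorm_le N \<phi> e \<Longrightarrow> norm (T \<phi>) \<le> D * e"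
    using tempered_bound[OF T] by blast
  obtain C and K :: nat where C: "0 \<le> C" "\<And>p. seminorm_le N (\<lambda>y. f (p, y)) (C * (1 + norm p) ^ K)"
    using family_seminorm[OF f weight_norm, of N] by blast
  obtain L and M :: nat where L: "0 \<le> L"
    "\<And>p p'. norm (p - p') \<le> 1 \<Longrightarrow> seminorm_le N (\<lambda>y. f (p, y) - f (p', y)) (L * (1 + norm p') ^ M * norm (p - p'))"
    using family_lipschitz[OF f, of N] by blast
  have sl: "schwartz (\<lambda>y. f (p, y))" for p by (rule schwartz_family_slice[OF f])
  have \<theta>_bound: "norm (\<theta> p) \<le> (D * C) * (1 + norm p) ^ K" for p
    using D(2)[OF sl C(2)] by (simp add: \<theta>_def mult.assoc)
  then show "\<exists>C K. \<forall>p. norm (T (\<lambda>y. f (p, y))) \<le> C * (1 + norm p) ^ K" unfolding \<theta>_def by blast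
  have \<theta>_lip: "norm (\<theta> p - \<theta> p') \<le> D * (L * (1 + norm p') ^ M * norm (p - p'))" if "norm (p - p') \<le> 1" for p p'
    using D(2)[OF _ L(2)[OF that]] schwartz_add[OF sl schwartz_scale[OF sl, of "-1"], of p p']
    by (simp add: \<theta>_def tempered_diff[OF T sl sl])
  have cont: "isCont \<theta> p'" for p'
    unfolding isCont_def
  proof (subst Lim_null, rule Lim_null_comparison)
    show "\<forall>\<^sub>F p in at p'. norm (\<theta> p - \<theta> p') \<le> D * (L * (1 + norm p') ^ M * norm (p - p'))"
      unfolding eventually_at by (rule exI[of _ 1]) (auto simp: dist_norm intro!: \<theta>_lip)
    show "((\<lambda>p. D * (L * (1 + norm p') ^ M * norm (p - p'))) \<longlongrightarrow> 0) (at p')"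
      by (auto intro!: tendsto_eq_intros)
  qed
  then show "continuous_on UNIV (\<lambda>p. T (\<lambda>y. f (p, y)))"
    by (simp add: \<theta>_def[abs_def] continuous_on_eq_continuous_at)
  have \<theta>m [measurable]: "\<theta> \<in> borel_measurable borel"
    using cont by (intro borel_measurable_continuous_onI) (simp add: continuous_on_eq_continuous_at)
  define E where "E A = T (superpose A f) - (\<integral>p. A p * \<theta> p \<partial>lborel)" for A
  have A\<theta>: "integrable lborel (\<lambda>p. A p * \<theta> p)" if "rapid_measurable A" for A
    by (rule rapid_measurable_mult[OF that \<theta>m \<theta>_bound])
  have Ai: "integrable lborel (\<lambda>p. (1 + norm p) ^ k * norm (A p))" if "rapid_measurable A" for A :: "'p \<Rightarrow> complex" and k
    using that by (simp add: rapid_measurable_def)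
  have Ai0: "integrable lborel A" if "rapid_measurable A" for A :: "'p \<Rightarrow> complex"
    using rapid_measurable_mult[OF that, of "\<lambda>_. 1" 1 0] by simp
  have E_add: "E (\<lambda>p. A p + B p) = E A + E B" if A: "rapid_measurable A" and B: "rapid_measurable B" for A B
  proof -
    have "superpose (\<lambda>p. A p + B p) f = (\<lambda>y. superpose A f y + superpose B f y)"
      unfolding superpose_def using family_integrable[OF A f] family_integrable[OF B f] by (simp add: algebra_simps)
    then show ?thesis unfolding E_def
      using tempered_add[OF T schwartz_superpose[OF A f] schwartz_superpose[OF B f]] A\<theta>[OF A] A\<theta>[OF B]
      by (simp add: algebra_simps)
  qed
  have E_bound: "norm (E A) \<le> 2 * (D * C) * (\<integral>p. (1 + norm p) ^ K * norm (A p) \<partial>lborel)"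
    if A: "rapid_measurable A" for A
  proof -
    have i: "integrable lborel (\<lambda>p. C * ((1 + norm p) ^ K * norm (A p)))" using Ai[OF A] by simp
    have "seminorm_le N (superpose A f) (\<integral>p. C * ((1 + norm p) ^ K * norm (A p)) \<partial>lborel)"
      by (rule superpose_seminorm[OF A f i])
        (rule seminorm_le_mono[OF seminorm_le_scale[OF C(2) sl]], simp add: mult_ac)
    from D(2)[OF schwartz_superpose[OF A f] this]
    have "norm (T (superpose A f)) \<le> (D * C) * (\<integral>p. (1 + norm p) ^ K * norm (A p) \<partial>lborel)" by simp
    moreover have "norm (\<integral>p. A p * \<theta> p \<partial>lborel) \<le> (\<integral>p. (D * C) * ((1 + norm p) ^ K * norm (A p)) \<partial>lborel)"
    proof (rule Bochner_Integration.integral_norm_bound_integral[OF A\<theta>[OF A]])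
      show "integrable lborel (\<lambda>p. (D * C) * ((1 + norm p) ^ K * norm (A p)))" using Ai[OF A] by simp
      show "norm (A p * \<theta> p) \<le> (D * C) * ((1 + norm p) ^ K * norm (A p))" for p
        using mult_left_mono[OF \<theta>_bound[of p], of "norm (A p)"] by (simp add: norm_mult mult_ac)
    qed
    ultimately show ?thesis unfolding E_def using norm_triangle_ineq4[of "T (superpose A f)" "\<integral>p. A p * \<theta> p \<partial>lborel"] by simp
  qed
  have E_local: "norm (E A) \<le> 2 * (D * (L * (1 + norm c) ^ M * \<delta>)) * (\<integral>p. norm (A p) \<partial>lborel)"
    if A: "rapid_measurable A" and supp: "\<And>p. p \<notin> ball c \<delta> \<Longrightarrow> A p = 0" and \<delta>: "0 < \<delta>" "\<delta> \<le> 1" for A c \<delta>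
  proof -
    let ?l = "L * (1 + norm c) ^ M * \<delta>"
    \<comment> \<open>For a family that is constant in \<open>p\<close> the exchange is mere
      linearity. Subtracting the slice at \<open>c\<close> therefore leaves the error unchanged, and
      the Lipschitz bound makes what remains of size \<open>\<delta>\<close> on the ball.\<close>
    let ?g = "\<lambda>z. f z + (-1) * f (c, snd z)"
    have g: "tame_family ?g"
    proof (intro sdecay_add weight_norm f)
      have "tame_family (\<lambda>z::'p \<times> 'a. f (c, snd z))"
        by (rule smooth_in_mono[OF schwartz_family_const[OF sl, where 'p = 'p]]) (rule decay_weight_1)
      then have "tame_family (\<lambda>z::'p \<times> 'a. f (c, snd z) * (-1))"
        by (rule sdecay_mult[rotated 2]) (auto intro!: sgrowth_const)
      then show "tame_family (\<lambda>z::'p \<times> 'a. (-1) * f (c, snd z))" by (simp add: mult.commute)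
    qed
    have n0: "integrable lborel (\<lambda>p. norm (A p))" using Ai0[OF A] by simp
    have "seminorm_le N (\<lambda>y. A p * ?g (p, y)) (?l * norm (A p))" for p
    proof (cases "p \<in> ball c \<delta>")
      case True
      then have "norm (p - c) \<le> \<delta>" by (simp add: dist_norm norm_minus_commute)
      then have "seminorm_le N (\<lambda>y. f (p, y) - f (c, y)) ?l"
        using \<delta> L(1) by (intro seminorm_le_mono[OF L(2)] mult_left_mono) auto
      from seminorm_le_scale[OF this, of "A p"] show ?thesis
        using schwartz_family_slice[OF g, of p] by (simp add: mult.commute)
    next
      case False
      obtain e where "seminorm_le N (\<lambda>y. ?g (p, y)) e" using family_seminorm[OF g weight_norm, of N] by metis
      from seminorm_le_scale[OF this, of "A p"] show ?thesis
        using schwartz_family_slice[OF g, of p] supp[OF False] by simp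
    qed
    then have "seminorm_le N (superpose A ?g) (\<integral>p. ?l * norm (A p) \<partial>lborel)"
      using n0 by (intro superpose_seminorm[OF A g]) auto
    from D(2)[OF schwartz_superpose[OF A g] this]
    have 1: "norm (T (superpose A ?g)) \<le> D * ?l * (\<integral>p. norm (A p) \<partial>lborel)" by (simp add: mult_ac)
    have "superpose A ?g = (\<lambda>y. superpose A f y - (\<integral>p. A p \<partial>lborel) * f (c, y))"
      unfolding superpose_def using family_integrable[OF A f] Ai0[OF A] by (simp add: algebra_simps)
    then have 2: "T (superpose A ?g) = T (superpose A f) - (\<integral>p. A p \<partial>lborel) * \<theta> c"
      using tempered_diff[OF T schwartz_superpose[OF A f] schwartz_scale[OF sl]] tempered_scale[OF T sl]
      by (simp add: \<theta>_def)
    have "norm (\<integral>p. A p * \<theta> p - A p * \<theta> c \<partial>lborel) \<le> (\<integral>p. D * ?l * norm (A p) \<partial>lborel)"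
    proof (rule Bochner_Integration.integral_norm_bound_integral)
      show "integrable lborel (\<lambda>p. A p * \<theta> p - A p * \<theta> c)" using A\<theta>[OF A] Ai0[OF A] by simp
      show "integrable lborel (\<lambda>p. D * ?l * norm (A p))" using n0 by simp
      fix p
      show "norm (A p * \<theta> p - A p * \<theta> c) \<le> D * ?l * norm (A p)"
      proof (cases "p \<in> ball c \<delta>")
        case True
        then have pc: "norm (p - c) \<le> \<delta>" by (simp add: dist_norm norm_minus_commute)
        then have "norm (\<theta> p - \<theta> c) \<le> D * (L * (1 + norm c) ^ M * norm (p - c))" using \<delta> by (intro \<theta>_lip) auto
        also have "\<dots> \<le> D * ?l" using D L pc by (intro mult_left_mono) auto
        finally have "norm (A p) * norm (\<theta> p - \<theta> c) \<le> norm (A p) * (D * ?l)" by (rule mult_left_mono) simp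
        then show ?thesis by (simp add: mult.commute flip: norm_mult right_diff_distrib)
      qed (simp add: supp)
    qed
    then have 3: "norm ((\<integral>p. A p * \<theta> p \<partial>lborel) - (\<integral>p. A p \<partial>lborel) * \<theta> c) \<le> D * ?l * (\<integral>p. norm (A p) \<partial>lborel)"
      using A\<theta>[OF A] Ai0[OF A] by simp
    have "E A = T (superpose A ?g) - ((\<integral>p. A p * \<theta> p \<partial>lborel) - (\<integral>p. A p \<partial>lborel) * \<theta> c)"
      unfolding 2 E_def by simp
    then have "norm (E A) \<le> norm (T (superpose A ?g)) + norm ((\<integral>p. A p * \<theta> p \<partial>lborel) - (\<integral>p. A p \<partial>lborel) * \<theta> c)"
      by (simp only: norm_triangle_ineq4)
    then show ?thesis using 1 3 by simp
  qed
  \<comment> \<open>The constant depends on \<open>R\<close> and \<open>\<delta>\<close> but not on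
    the number of balls: \<open>A\<close> is cut into pieces with disjoint supports, whose L^1 norms
    add up to that of \<open>A\<close>.\<close>
  have E_cover: "norm (E A) \<le> 2 * (D * (L * (1 + R) ^ M * \<delta>)) * (\<integral>p. norm (A p) \<partial>lborel)"
    if "finite F" "\<And>c. c \<in> F \<Longrightarrow> norm c \<le> R" "rapid_measurable A" "\<And>p. p \<notin> (\<Union>c\<in>F. ball c \<delta>) \<Longrightarrow> A p = 0"
      "0 < \<delta>" "\<delta> \<le> 1" for F A R \<delta>
    using that
  proof (induction F arbitrary: A rule: finite_induct)
    case empty
    then have "A = (\<lambda>_. 0)" by auto
    then show ?case using E_bound[OF empty(2)] by simp
  next
    case (insert c F)
    let ?A1 = "\<lambda>p. indicator (ball c \<delta>) p * A p" and ?A2 = "\<lambda>p. indicator (- ball c \<delta>) p * A p"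
    have A1: "rapid_measurable ?A1" and A2: "rapid_measurable ?A2"
      using insert by (auto intro!: rapid_measurable_indicator)
    have "norm (E ?A1) \<le> 2 * (D * (L * (1 + norm c) ^ M * \<delta>)) * (\<integral>p. norm (?A1 p) \<partial>lborel)"
      using insert by (intro E_local[OF A1]) auto
    also have "\<dots> \<le> 2 * (D * (L * (1 + R) ^ M * \<delta>)) * (\<integral>p. norm (?A1 p) \<partial>lborel)"
      using insert(4)[of c] insert(7,8) D(1) L(1)
      by (intro mult_right_mono mult_left_mono power_mono) auto
    finally have 1: "norm (E ?A1) \<le> 2 * (D * (L * (1 + R) ^ M * \<delta>)) * (\<integral>p. norm (?A1 p) \<partial>lborel)" .
    have 2: "norm (E ?A2) \<le> 2 * (D * (L * (1 + R) ^ M * \<delta>)) * (\<integral>p. norm (?A2 p) \<partial>lborel)"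
      using insert.prems by (intro insert.IH[OF _ A2]) (auto split: split_indicator)
    have "(\<lambda>p. ?A1 p + ?A2 p) = A" by (auto split: split_indicator)
    then have "E A = E ?A1 + E ?A2" using E_add[OF A1 A2] by simp
    moreover have "(\<integral>p. norm (A p) \<partial>lborel) = (\<integral>p. norm (?A1 p) + norm (?A2 p) \<partial>lborel)"
      by (intro Bochner_Integration.integral_cong) (auto split: split_indicator)
    then have "(\<integral>p. norm (A p) \<partial>lborel) = (\<integral>p. norm (?A1 p) \<partial>lborel) + (\<integral>p. norm (?A2 p) \<partial>lborel)"
      using Ai0[OF A1] Ai0[OF A2] by simp
    ultimately show ?case
      using order_trans[OF norm_triangle_ineq[of "E ?A1" "E ?A2"] add_mono[OF 1 2]]
      by (simp only: distrib_left)
  qed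
  assume A: "rapid_measurable A"
  have E_bounded: "E A = 0" if A: "rapid_measurable A" and R: "\<And>p. p \<notin> cball 0 R \<Longrightarrow> A p = 0" for A and R :: real
  proof -
    have "norm (E A) \<le> \<delta> * (2 * (D * (L * (1 + R) ^ M)) * (\<integral>p. norm (A p) \<partial>lborel))" if \<delta>: "0 < \<delta>" "\<delta> \<le> 1" for \<delta>
    proof -
      obtain F where F: "finite F" "F \<subseteq> cball 0 R" "cball (0::'p) R \<subseteq> (\<Union>c\<in>F. ball c \<delta>)"
        using seq_compact_imp_totally_bounded[OF compact_imp_seq_compact[OF compact_cball[of "0::'p" R]], rule_format, OF \<delta>(1)]
        by blast
      have "norm (E A) \<le> 2 * (D * (L * (1 + R) ^ M * \<delta>)) * (\<integral>p. norm (A p) \<partial>lborel)"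
      proof (rule E_cover[OF F(1) _ A _ \<delta>])
        show "norm c \<le> R" if "c \<in> F" for c using F(2) that by auto
        show "A p = 0" if "p \<notin> (\<Union>c\<in>F. ball c \<delta>)" for p using F(3) R that by blast
      qed
      then show ?thesis by (simp add: mult_ac)
    qed
    then have ev: "\<forall>\<^sub>F \<delta> in at_right 0. norm (E A) \<le> \<delta> * (2 * (D * (L * (1 + R) ^ M)) * (\<integral>p. norm (A p) \<partial>lborel))"
      unfolding eventually_at_right_field by (intro exI[of _ 1]) auto
    have "((\<lambda>\<delta>. \<delta> * (2 * (D * (L * (1 + R) ^ M)) * (\<integral>p. norm (A p) \<partial>lborel))) \<longlongrightarrow> 0) (at_right 0)"
      by (auto intro!: tendsto_eq_intros)
    from tendsto_le[OF _ this tendsto_const ev] have "norm (E A) \<le> 0" by simp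
    then show ?thesis by simp
  qed
  \<comment> \<open>One moment more than \<open>E_bound\<close> asks for: outside the ball of radius
    \<open>n\<close> the extra factor \<open>1 + norm p\<close> exceeds \<open>Suc n\<close>, which
    makes the tail small.\<close>
  let ?J = "\<integral>p. (1 + norm p) ^ (K + 1) * norm (A p) \<partial>lborel"
  have "norm (E A) \<le> (2 * (D * C) * ?J) * (1 / real (Suc n))" for n
  proof -
    let ?A1 = "\<lambda>p. indicator (cball 0 (real n)) p * A p" and ?A2 = "\<lambda>p. indicator (- cball 0 (real n)) p * A p"
    have A1: "rapid_measurable ?A1" and A2: "rapid_measurable ?A2"
      using A by (auto intro!: rapid_measurable_indicator)
    have "(\<lambda>p. ?A1 p + ?A2 p) = A" by (auto split: split_indicator)
    then have "E A = E ?A1 + E ?A2" using E_add[OF A1 A2] by simp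
    also have "E ?A1 = 0" by (rule E_bounded[OF A1, of "real n"]) simp
    finally have b: "norm (E A) \<le> 2 * (D * C) * (\<integral>p. (1 + norm p) ^ K * norm (?A2 p) \<partial>lborel)"
      using E_bound[OF A2] by simp
    have "(\<integral>p. (1 + norm p) ^ K * norm (?A2 p) \<partial>lborel) \<le> (\<integral>p. (1 / real (Suc n)) * ((1 + norm p) ^ (K + 1) * norm (A p)) \<partial>lborel)"
    proof (rule integral_mono[OF Ai[OF A2]])
      show "integrable lborel (\<lambda>p. (1 / real (Suc n)) * ((1 + norm p) ^ (K + 1) * norm (A p)))"
        using Ai[OF A, of "K + 1"] by (rule integrable_mult_right)
      fix p
      show "(1 + norm p) ^ K * norm (?A2 p) \<le> (1 / real (Suc n)) * ((1 + norm p) ^ (K + 1) * norm (A p))"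
      proof (cases "p \<in> cball 0 (real n)")
        case False
        then have "real (Suc n) \<le> 1 + norm p" by simp
        from mult_right_mono[OF this, of "(1 + norm p) ^ K * norm (A p)"]
        show ?thesis using False by (simp add: field_simps)
      qed simp
    qed
    also have "\<dots> = (1 / real (Suc n)) * ?J" by (rule integral_mult_right_zero)
    finally have "2 * (D * C) * (\<integral>p. (1 + norm p) ^ K * norm (?A2 p) \<partial>lborel) \<le> 2 * (D * C) * ((1 / real (Suc n)) * ?J)"
      using D(1) C(1) by (intro mult_left_mono) auto
    then show ?thesis using b by (simp add: mult_ac)
  qed
  then have ev: "\<forall>\<^sub>F n in sequentially. norm (E A) \<le> (2 * (D * C) * ?J) * (1 / real (Suc n))" by simp
  have "(\<lambda>n. (2 * (D * C) * ?J) * (1 / real (Suc n))) \<longlonglongrightarrow> (2 * (D * C) * ?J) * 0"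
    by (intro tendsto_intros lim_1_over_n[THEN LIMSEQ_Suc])
  from tendsto_le[OF sequentially_bot this tendsto_const ev] have "norm (E A) \<le> 0" by simp
  then show "T (superpose A f) = (\<integral>p. A p * T (\<lambda>y. f (p, y)) \<partial>lborel)"
    by (simp add: E_def \<theta>_def)
qed

section \<open>Reconstruction from the short-time Fourier transform\<close>

lemma one_plus_norm_pair:
  "1 + norm (z :: 'p::real_normed_vector \<times> 'a::real_normed_vector) \<le> (1 + norm (fst z)) * (1 + norm (snd z))"
proof -
  have "norm z \<le> norm (fst z) + norm (snd z)" using norm_Pair_le[of "fst z" "snd z"] by simp
  moreover have "0 \<le> norm (fst z) * norm (snd z)" by simp
  ultimately show ?thesis by (simp add: algebra_simps del: mult_nonneg_nonneg)
qed

lemma moderate_product_weight: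
  fixes h :: "'p::euclidean_space \<times> 'a::euclidean_space \<Rightarrow> complex"
  assumes "moderate h"
  shows "sgrowth (\<lambda>z. (1 + norm (snd z)) * (1 + norm (fst z))) h"
proof (rule smooth_in_mono[OF assms], erule growth_mono)
  show "1 + norm z \<le> (1 + norm (snd z)) * (1 + norm (fst z))" for z :: "'p \<times> 'a"
    using one_plus_norm_pair[of z] by (simp add: mult.commute)
qed simp

lemma moderate_real_linear:
  "bounded_linear l \<Longrightarrow> moderate (\<lambda>z. complex_of_real (l z))"
  by (intro moderate_linear bounded_linear_compose[OF bounded_linear_of_real])

lemma moderate_inner_comp:
  fixes l :: "'a::euclidean_space \<Rightarrow> 'b::euclidean_space"
  assumes "bounded_linear l" "bounded_linear m"
  shows "moderate (\<lambda>z. complex_of_real (l z \<bullet> m z))"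
proof -
  have "moderate (\<lambda>z. \<Sum>b\<in>Basis. complex_of_real (l z \<bullet> b) * complex_of_real (m z \<bullet> b))"
    by (intro sgrowth_sum sgrowth_mult weight_norm moderate_real_linear
        bounded_linear_compose[OF bounded_linear_inner_left] assms)
  also have "(\<lambda>z. \<Sum>b\<in>Basis. complex_of_real (l z \<bullet> b) * complex_of_real (m z \<bullet> b)) =
      (\<lambda>z. complex_of_real (l z \<bullet> m z))"
    by (subst (3) euclidean_inner) simp
  finally show ?thesis .
qed

text \<open>The slices are the test functions behind
  \<open>stft g T (fst p) (\<omega> - snd p)\<close>. The window decays in \<open>y - fst p\<close>;
  Peetre's inequality converts this into decay in \<open>y\<close> at the price of powers of
  \<open>1 + norm p\<close>.\<close>

lemma window_family:
  fixes g :: "'a::euclidean_space \<Rightarrow> complex"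
  assumes g: "schwartz g"
  shows "tame_family (\<lambda>(p, y). cnj (g (y - fst p)) * cis (- 2 * pi * (y \<bullet> (\<omega> - snd p))))"
proof -
  let ?L = "\<lambda>z :: ('a \<times> 'a) \<times> 'a. snd z - fst (fst z)"
  have "tame_family (\<lambda>z. (\<lambda>y. cnj (g y)) (?L z + 0))"
  proof (rule smooth_in_affine_comp[OF schwartz_cnj[OF g, unfolded schwartz_iff]])
    show "bounded_linear ?L"
      by (intro bounded_linear_sub bounded_linear_snd bounded_linear_compose[OF bounded_linear_fst] bounded_linear_fst)
    fix h :: "'a \<Rightarrow> complex" and k assume h: "rapid h"
    show "decay (\<lambda>z. 1 + norm (snd z)) (\<lambda>z. 1 + norm (fst z)) (\<lambda>z. k * h (?L z + 0))"
      unfolding decay_def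
    proof
      fix m
      obtain C where C: "0 \<le> C" "\<And>x. (1 + norm x) ^ m * norm (h x) \<le> C"
        using decayE[OF h, of m] by (auto simp: power_one)
      have "(1 + norm (snd z)) ^ m * norm (k * h (?L z + 0)) \<le> (norm k * C) * (1 + norm (fst z)) ^ m" for z
      proof -
        have "(1 + norm (snd z)) ^ m \<le> ((1 + norm (?L z)) * (1 + norm (fst (fst z)))) ^ m"
          by (intro power_mono one_plus_norm_triangle_sub) simp
        then have "(1 + norm (snd z)) ^ m * norm (k * h (?L z + 0)) \<le>
            ((1 + norm (?L z)) * (1 + norm (fst (fst z)))) ^ m * norm (k * h (?L z + 0))"
          by (rule mult_right_mono) simp
        also have "\<dots> = norm k * ((1 + norm (?L z)) ^ m * norm (h (?L z))) * (1 + norm (fst (fst z))) ^ m"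
          by (simp add: power_mult_distrib norm_mult)
        also have "\<dots> \<le> norm k * C * (1 + norm (fst z)) ^ m"
          using C norm_fst_le[of "fst (fst z)" "snd (fst z)"]
          by (intro mult_mono mult_left_mono power_mono add_left_mono) auto
        finally show ?thesis .
      qed
      then show "\<exists>C K. \<forall>z. (1 + norm (snd z)) ^ m * norm (k * h (?L z + 0)) \<le> C * (1 + norm (fst z)) ^ K" by blast
    qed
  qed simp
  moreover have "sgrowth (\<lambda>z. (1 + norm (snd z)) * (1 + norm (fst z)))
      (\<lambda>z :: ('a \<times> 'a) \<times> 'a. cis ((- 2 * pi) * (snd z \<bullet> (\<omega> - snd (fst z)))))"
  proof (intro sgrowth_cis moderate_product_weight)
    have "moderate (\<lambda>z :: ('a \<times> 'a) \<times> 'a. complex_of_real (snd z \<bullet> \<omega>) + (-1) * of_real (snd z \<bullet> snd (fst z)))"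
      by (intro sgrowth_add sgrowth_mult sgrowth_const weight_norm moderate_inner_comp moderate_real_linear
          bounded_linear_compose[OF bounded_linear_inner_left] bounded_linear_snd
          bounded_linear_compose[OF bounded_linear_snd] bounded_linear_fst)
    then show "moderate (\<lambda>z :: ('a \<times> 'a) \<times> 'a. complex_of_real (snd z \<bullet> (\<omega> - snd (fst z))))"
      by (simp add: inner_diff_right)
  qed simp
  ultimately have "tame_family (\<lambda>z. cnj (g (?L z + 0)) * cis ((- 2 * pi) * (snd z \<bullet> (\<omega> - snd (fst z)))))"
    by (intro sdecay_mult weight_norm)
  then show ?thesis by (simp add: case_prod_unfold)
qed

text \<open>The power of \<open>1 + (norm (snd p))^2\<close> encodes decay in the frequency
  \<open>snd p\<close>. By Peetre's inequality it is split between \<open>snd p - \<eta>\<close>,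
  where \<open>b\<close> absorbs it, and \<open>\<eta>\<close>, where \<open>a\<close> does. Hence
  the resulting weight depends on \<open>fst p\<close> alone, and all bounds are uniform in
  \<open>snd p\<close>.\<close>

lemma amplitude_family:
  fixes a :: "'s::euclidean_space \<times> 'a::euclidean_space \<Rightarrow> complex" and b :: "'a \<Rightarrow> complex"
  assumes a: "schwartz_family w a" and w: "weight w" and b: "schwartz b"
  shows "schwartz_family (\<lambda>p. w (fst p))
    (\<lambda>(p, \<eta>). a (fst p, \<eta>) * (complex_of_real (1 + snd p \<bullet> snd p) ^ l * b (snd p - \<eta>)))"
proof -
  let ?L = "\<lambda>z :: ('s \<times> 'a) \<times> 'a. (fst (fst z), snd z)" and ?M = "\<lambda>z :: ('s \<times> 'a) \<times> 'a. snd (fst z) - snd z"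
  have w': "weight (\<lambda>z :: ('s \<times> 'a) \<times> 'a. w (fst (fst z)))" using w by (simp add: weight_def)
  have "schwartz_family (\<lambda>p. w (fst p)) (\<lambda>z. a (?L z + 0))"
  proof (rule smooth_in_affine_comp[OF a])
    show "bounded_linear ?L"
      by (intro bounded_linear_Pair bounded_linear_compose[OF bounded_linear_fst] bounded_linear_fst bounded_linear_snd)
    fix f :: "'s \<times> 'a \<Rightarrow> complex" and k assume f: "decay (\<lambda>z. 1 + norm (snd z)) (\<lambda>z. w (fst z)) f"
    show "decay (\<lambda>z. 1 + norm (snd z)) (\<lambda>z. w (fst (fst z))) (\<lambda>x. k * f (?L x + 0))"
      unfolding decay_def
    proof
      fix m
      obtain C K where "\<And>z. (1 + norm (snd z)) ^ m * norm (f z) \<le> C * w (fst z) ^ K" using f unfolding decay_def by blast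
      then have "norm k * ((1 + norm (snd z)) ^ m * norm (f z)) \<le> norm k * (C * w (fst z) ^ K)" for z
        by (rule mult_left_mono) simp
      from this[of "?L _"]
      show "\<exists>C K. \<forall>x. (1 + norm (snd x)) ^ m * norm (k * f (?L x + 0)) \<le> C * w (fst (fst x)) ^ K"
        by (intro exI[of _ "norm k * C"] exI[of _ K]) (simp add: norm_mult mult_ac)
    qed
  qed (use w' in simp)
  moreover have "sgrowth (\<lambda>z. (1 + norm (snd z)) * w (fst (fst z)))
      (\<lambda>z. complex_of_real (1 + snd (fst z) \<bullet> snd (fst z)) ^ l * b (?M z + 0))"
  proof (rule smooth_in_mult)
    let ?P = "growth (\<lambda>z :: ('s \<times> 'a) \<times> 'a. 1 + norm (snd (fst z)))"
    let ?Q = "decay (\<lambda>z :: ('s \<times> 'a) \<times> 'a. 1 + norm (?M z)) (\<lambda>_. 1)"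
    have l1: "bounded_linear (\<lambda>z :: ('s \<times> 'a) \<times> 'a. snd (fst z))"
      by (intro bounded_linear_compose[OF bounded_linear_snd] bounded_linear_fst)
    have "smooth_in ?P (\<lambda>z. (1 + (\<Sum>b\<in>Basis. complex_of_real (snd (fst z) \<bullet> b) * complex_of_real (snd (fst z) \<bullet> b))) ^ l)"
    proof (intro sgrowth_power sgrowth_add sgrowth_mult sgrowth_sum sgrowth_const weight_norm sgrowth_linear
        bounded_linear_compose[OF bounded_linear_of_real] bounded_linear_compose[OF bounded_linear_inner_left] l1)
      fix b :: 'a assume b: "b \<in> Basis"
      have "norm (complex_of_real (snd (fst z) \<bullet> b)) \<le> 1 * (1 + norm (snd (fst z))) ^ 1" for z :: "('s \<times> 'a) \<times> 'a"
        using Basis_le_norm[OF b, of "snd (fst z)"] by simp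
      then show "?P (\<lambda>z. complex_of_real (snd (fst z) \<bullet> b))" by (rule growthI)
      then show "?P (\<lambda>z. complex_of_real (snd (fst z) \<bullet> b))" .
    qed
    moreover have "(\<lambda>z :: ('s \<times> 'a) \<times> 'a. complex_of_real (1 + snd (fst z) \<bullet> snd (fst z)) ^ l) =
        (\<lambda>z. (1 + (\<Sum>b\<in>Basis. complex_of_real (snd (fst z) \<bullet> b) * complex_of_real (snd (fst z) \<bullet> b))) ^ l)"
      by (subst euclidean_inner) simp
    ultimately show "smooth_in ?P (\<lambda>z. complex_of_real (1 + snd (fst z) \<bullet> snd (fst z)) ^ l)" by simp
    show "smooth_in ?Q (\<lambda>z. b (?M z + 0))"
    proof (rule smooth_in_affine_comp[OF b[unfolded schwartz_iff]])
      show "bounded_linear ?M" by (intro bounded_linear_sub l1 bounded_linear_snd)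
      fix f :: "'a \<Rightarrow> complex" and k assume f: "rapid f"
      show "?Q (\<lambda>z. k * f (?M z + 0))"
        unfolding decay_def
      proof
        fix m
        obtain C where C: "\<And>x. (1 + norm x) ^ m * norm (f x) \<le> C" using decayE[OF f, of m] by (auto simp: power_one)
        have "norm k * ((1 + norm x) ^ m * norm (f x)) \<le> norm k * C" for x by (intro mult_left_mono C) simp
        from this[of "?M _"] show "\<exists>C K. \<forall>z. (1 + norm (?M z)) ^ m * norm (k * f (?M z + 0)) \<le> C * 1 ^ K"
          by (intro exI[of _ "norm k * C"]) (simp add: norm_mult mult_ac)
      qed
    qed simp
    fix q \<beta> assume q: "?P q" and \<beta>: "?Q \<beta>"
    obtain C K where C: "0 \<le> C" "\<And>z. norm (q z) \<le> C * (1 + norm (snd (fst z))) ^ K" using growthE[OF q weight_norm] by metis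
    obtain D where D: "0 \<le> D" "\<And>z. (1 + norm (?M z)) ^ K * norm (\<beta> z) \<le> D"
      using decayE[OF \<beta>, of K] by (auto simp: power_one)
    have "norm (q z * \<beta> z) \<le> (C * D) * ((1 + norm (snd z)) * w (fst (fst z))) ^ K" for z
    proof -
      have "norm (q z) \<le> C * ((1 + norm (?M z)) * (1 + norm (snd z))) ^ K"
        by (rule order_trans[OF C(2)], intro mult_left_mono power_mono one_plus_norm_triangle_sub C) simp
      then have "norm (q z) * norm (\<beta> z) \<le> C * ((1 + norm (?M z)) * (1 + norm (snd z))) ^ K * norm (\<beta> z)"
        by (rule mult_right_mono) simp
      also have "\<dots> = C * (1 + norm (snd z)) ^ K * ((1 + norm (?M z)) ^ K * norm (\<beta> z))"
        by (simp only: power_mult_distrib mult_ac)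
      also have "\<dots> \<le> C * (1 + norm (snd z)) ^ K * D" using C D by (intro mult_left_mono) auto
      also have "\<dots> \<le> C * ((1 + norm (snd z)) * w (fst (fst z))) ^ K * D"
      proof (intro mult_right_mono mult_left_mono power_mono)
        show "1 + norm (snd z) \<le> (1 + norm (snd z)) * w (fst (fst z))"
          using mult_left_mono[of 1 "w (fst (fst z))" "1 + norm (snd z)"] w by (simp add: weight_def)
      qed (use C D in auto)
      finally show ?thesis by (simp add: norm_mult mult_ac)
    qed
    then show "growth (\<lambda>z. (1 + norm (snd z)) * w (fst (fst z))) (\<lambda>z. q z * \<beta> z)" by (rule growthI)
  qed (use w' in simp)
  ultimately have "schwartz_family (\<lambda>p. w (fst p))
      (\<lambda>z. a (?L z + 0) * (complex_of_real (1 + snd (fst z) \<bullet> snd (fst z)) ^ l * b (?M z + 0)))"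
    using w' by (intro sdecay_mult weight_norm)
  then show ?thesis by (simp add: case_prod_unfold)
qed

text \<open>The weight in \<open>\<eta>'\<close> is a constant under the integral and can be moved
  into the amplitude. The squared norm is taken because it is smooth; returning to
  \<open>1 + norm \<eta>'\<close> by \<open>1 + t \<le> 2 * (1 + t^2)\<close> costs
  \<open>2 ^ l\<close>.\<close>

lemma amplitude_decay:
  fixes a :: "'s::euclidean_space \<times> 'a::euclidean_space \<Rightarrow> complex"
  assumes a: "schwartz_family w a" and w: "weight w" and b: "schwartz b"
  shows "\<exists>C\<ge>0. \<exists>K. \<forall>s \<eta>' x. (1 + norm x) ^ k * ((1 + norm \<eta>') ^ l * norm (ift (\<lambda>\<eta>. a (s, \<eta>) * b (\<eta>' - \<eta>)) x)) \<le> C * w s ^ K"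
proof -
  have w': "weight (\<lambda>p :: 's \<times> 'a. w (fst p))" using w by (simp add: weight_def)
  obtain C K where C: "0 \<le> C" "\<And>s \<eta>' x. (1 + norm x) ^ k *
      norm (ift (\<lambda>\<eta>. a (s, \<eta>) * (complex_of_real (1 + \<eta>' \<bullet> \<eta>') ^ l * b (\<eta>' - \<eta>))) x) \<le> C * w s ^ K"
    using ift_family_decay[OF amplitude_family[OF a w b, of l] w', of k] by auto
  have "(1 + norm x) ^ k * ((1 + norm \<eta>') ^ l * norm (ift (\<lambda>\<eta>. a (s, \<eta>) * b (\<eta>' - \<eta>)) x)) \<le> (2 ^ l * C) * w s ^ K" for s \<eta>' x
  proof -
    let ?I = "ift (\<lambda>\<eta>. a (s, \<eta>) * b (\<eta>' - \<eta>)) x"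
    have "ift (\<lambda>\<eta>. a (s, \<eta>) * (complex_of_real (1 + \<eta>' \<bullet> \<eta>') ^ l * b (\<eta>' - \<eta>))) x =
        complex_of_real (1 + \<eta>' \<bullet> \<eta>') ^ l * ?I"
      unfolding ift_def by (subst integral_mult_right_zero[symmetric]) (simp add: mult_ac)
    then have e: "norm (ift (\<lambda>\<eta>. a (s, \<eta>) * (complex_of_real (1 + \<eta>' \<bullet> \<eta>') ^ l * b (\<eta>' - \<eta>))) x) =
        (1 + (norm \<eta>')\<^sup>2) ^ l * norm ?I"
      by (simp add: norm_mult norm_power power2_norm_eq_inner del: of_real_add)
    have "1 + norm \<eta>' \<le> 2 * (1 + (norm \<eta>')\<^sup>2)"
    proof -
      have "2 * norm \<eta>' \<le> (norm \<eta>')\<^sup>2 + 1" using zero_le_power2[of "norm \<eta>' - 1"] by (simp add: power2_diff)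
      moreover have "0 \<le> (norm \<eta>')\<^sup>2" by simp
      ultimately have "1 + norm \<eta>' \<le> 2 + 2 * (norm \<eta>')\<^sup>2" using norm_ge_zero[of \<eta>'] by linarith
      then show ?thesis by simp
    qed
    then have "(1 + norm \<eta>') ^ l \<le> (2 * (1 + (norm \<eta>')\<^sup>2)) ^ l" by (intro power_mono) auto
    then have "(1 + norm x) ^ k * ((1 + norm \<eta>') ^ l * norm ?I) \<le> (1 + norm x) ^ k * ((2 * (1 + (norm \<eta>')\<^sup>2)) ^ l * norm ?I)"
      by (intro mult_left_mono mult_right_mono) auto
    also have "\<dots> = 2 ^ l * ((1 + norm x) ^ k * ((1 + (norm \<eta>')\<^sup>2) ^ l * norm ?I))"
      by (simp only: power_mult_distrib mult_ac)
    also have "\<dots> \<le> 2 ^ l * (C * w s ^ K)"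
      using C(2)[of x s \<eta>'] unfolding e by (intro mult_left_mono) auto
    finally show ?thesis by (simp add: mult.assoc)
  qed
  then show ?thesis using C(1) by (intro exI[of _ "2 ^ l * C"] exI[of _ K]) auto
qed

text \<open>This is the short-time Fourier transform of \<open>ift a\<close> at
  \<open>(fst p, snd p)\<close> with window \<open>cnj (ift b)\<close>, expressed on the frequency
  side. There a chirp acts on \<open>a\<close> by multiplication.\<close>

definition amplitude :: "('a::euclidean_space \<Rightarrow> complex) \<Rightarrow> ('a \<Rightarrow> complex) \<Rightarrow> 'a \<times> 'a \<Rightarrow> complex" where
  "amplitude b a p = cis (- 2 * pi * (fst p \<bullet> snd p)) * ift (\<lambda>\<eta>. a \<eta> * b (snd p - \<eta>)) (fst p)"

lemma ift_measurable:
  fixes F :: "'p::euclidean_space \<times> 'a::euclidean_space \<Rightarrow> complex"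
  assumes [measurable]: "F \<in> borel_measurable borel" "x \<in> borel_measurable borel"
  shows "(\<lambda>p. ift (\<lambda>\<eta>. F (p, \<eta>)) (x p)) \<in> borel_measurable borel"
proof -
  have "F \<in> borel_measurable (borel \<Otimes>\<^sub>M borel)" by (simp add: borel_prod)
  then have [measurable]: "F \<in> borel_measurable (borel \<Otimes>\<^sub>M lborel)" by simp
  show ?thesis unfolding ift_def by measurable
qed

lemma amplitude_measurable:
  fixes a :: "'a::euclidean_space \<Rightarrow> complex"
  assumes [measurable]: "a \<in> borel_measurable borel" "b \<in> borel_measurable borel"
  shows "amplitude b a \<in> borel_measurable borel"
proof -
  have "(\<lambda>z :: ('a \<times> 'a) \<times> 'a. a (snd z) * b (snd (fst z) - snd z)) \<in> borel_measurable borel"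
    unfolding borel_prod[symmetric] by measurable
  from ift_measurable[OF this borel_measurable_continuous_onI[OF continuous_on_fst[OF continuous_on_id]]]
  have "(\<lambda>p :: 'a \<times> 'a. ift (\<lambda>\<eta>. a \<eta> * b (snd p - \<eta>)) (fst p)) \<in> borel_measurable borel" by simp
  moreover have "(\<lambda>p :: 'a \<times> 'a. cis (- 2 * pi * (fst p \<bullet> snd p))) \<in> borel_measurable borel"
    by (intro borel_measurable_continuous_onI continuous_on_cis continuous_intros)
  ultimately show ?thesis unfolding amplitude_def[abs_def] by (intro borel_measurable_times)
qed

lemma rapid_measurable_amplitude:
  fixes a :: "'a::euclidean_space \<Rightarrow> complex"
  assumes a: "schwartz a" and b: "schwartz b"
  shows "rapid_measurable (amplitude b a)"
  unfolding rapid_measurable_def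
proof (intro conjI allI)
  show m: "amplitude b a \<in> borel_measurable borel"
    by (intro amplitude_measurable schwartz_measurable a b)
  fix k
  \<comment> \<open>Decay in position and in frequency multiplies to decay in the pair. The surplus
    \<open>2 * DIM('a \<times> 'a)\<close> is spent on integrability and \<open>k\<close> powers
    remain.\<close>
  let ?k = "k + 2 * DIM('a \<times> 'a)"
  obtain C K where C: "0 \<le> C" "\<And>s \<eta>' x. (1 + norm x) ^ ?k * ((1 + norm \<eta>') ^ ?k * norm (ift (\<lambda>\<eta>. a \<eta> * b (\<eta>' - \<eta>)) x)) \<le> C * 1 ^ K"
    using amplitude_decay[OF schwartz_family_const[OF a, where 'p = real] weight_const b, of ?k ?k] by auto
  have "(1 + norm p) ^ (2 * DIM('a \<times> 'a)) * norm (complex_of_real ((1 + norm p) ^ k * norm (amplitude b a p))) \<le> C" for p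
  proof -
    have "(1 + norm p) ^ ?k * norm (amplitude b a p) \<le> ((1 + norm (fst p)) * (1 + norm (snd p))) ^ ?k * norm (amplitude b a p)"
      by (intro mult_right_mono power_mono one_plus_norm_pair) auto
    also have "\<dots> \<le> C" using C(2)[of "fst p" "snd p"] by (simp only: power_mult_distrib amplitude_def norm_mult norm_cis) (simp add: mult_ac)
    finally show ?thesis
      by (simp add: power_add abs_mult mult_ac del: DIM_prod of_real_mult of_real_power of_real_add)
  qed
  moreover have "(\<lambda>p. complex_of_real ((1 + norm p) ^ k * norm (amplitude b a p))) \<in> borel_measurable borel"
  proof (intro borel_measurable_continuous_on[of complex_of_real] borel_measurable_times)
    show "(\<lambda>p :: 'a \<times> 'a. (1 + norm p) ^ k) \<in> borel_measurable borel"
      by (intro borel_measurable_continuous_onI continuous_intros)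
    show "(\<lambda>p. norm (amplitude b a p)) \<in> borel_measurable borel"
      by (intro borel_measurable_continuous_on[OF _ m] continuous_intros)
  qed (intro continuous_intros)
  ultimately have "integrable lborel (\<lambda>p. complex_of_real ((1 + norm p) ^ k * norm (amplitude b a p)))"
    by (rule integrable_of_decay[OF _ _ order_refl, rotated])
  then show "integrable lborel (\<lambda>p. (1 + norm p) ^ k * norm (amplitude b a p))"
    by (simp only: complex_of_real_integrable_eq)
qed

text \<open>The convolution theorem: after Fubini the substitution
  \<open>\<eta>' = \<xi> + \<eta>\<close> separates the integrals of \<open>a\<close> and
  \<open>b\<close>, and the phases recombine to the points \<open>y\<close> and
  \<open>y - x\<close>.\<close>

lemma integral_amplitude:
  fixes a b :: "'a::euclidean_space \<Rightarrow> complex"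
  assumes a: "schwartz a" and b: "schwartz b"
  shows "(\<integral>\<eta>'. amplitude b a (x, \<eta>') * cis (2 * pi * (y \<bullet> \<eta>')) \<partial>lborel) = ift a y * ift b (y - x)"
proof -
  let ?h = "\<lambda>\<eta> \<eta>'. cis (- 2 * pi * (x \<bullet> (\<eta>' - \<eta>))) * cis (2 * pi * (y \<bullet> \<eta>'))"
  have [measurable]: "a \<in> borel_measurable borel" "b \<in> borel_measurable borel"
    using a b by (auto intro: schwartz_measurable)
  have ai: "integrable lborel a" and bi: "integrable lborel b" using a b by (auto intro: schwartz_integrable)
  have bi': "integrable lborel (\<lambda>\<eta>'. b (\<eta>' - \<eta>))" for \<eta>
    using lborel_translate(2)[of b "- \<eta>"] bi by simp
  have int: "integrable (lborel \<Otimes>\<^sub>M lborel) (\<lambda>(\<eta>, \<eta>'). a \<eta> * b (\<eta>' - \<eta>) * ?h \<eta> \<eta>')"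
  proof (rule lborel_pair.Fubini_integrable)
    show "(\<lambda>(\<eta>, \<eta>'). a \<eta> * b (\<eta>' - \<eta>) * ?h \<eta> \<eta>') \<in> borel_measurable (lborel \<Otimes>\<^sub>M lborel)" by measurable
    have "(\<integral>\<eta>'. norm (case (\<eta>, \<eta>') of (\<eta>, \<eta>') \<Rightarrow> a \<eta> * b (\<eta>' - \<eta>) * ?h \<eta> \<eta>') \<partial>lborel) = norm (a \<eta>) * (\<integral>\<xi>. norm (b \<xi>) \<partial>lborel)" for \<eta>
      using lborel_translate(1)[of "\<lambda>\<xi>. norm (b \<xi>)" "- \<eta>"] by (simp add: norm_mult)
    then show "integrable lborel (\<lambda>\<eta>. \<integral>\<eta>'. norm (case (\<eta>, \<eta>') of (\<eta>, \<eta>') \<Rightarrow> a \<eta> * b (\<eta>' - \<eta>) * ?h \<eta> \<eta>') \<partial>lborel)"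
      using ai by simp
    show "AE \<eta> in lborel. integrable lborel (\<lambda>\<eta>'. case (\<eta>, \<eta>') of (\<eta>, \<eta>') \<Rightarrow> a \<eta> * b (\<eta>' - \<eta>) * ?h \<eta> \<eta>')"
      by (intro AE_I2) (auto simp: mult.assoc[symmetric] intro!: integrable_mult_cis integrable_mult_right bi')
  qed
  have "amplitude b a (x, \<eta>') * cis (2 * pi * (y \<bullet> \<eta>')) = (\<integral>\<eta>. a \<eta> * b (\<eta>' - \<eta>) * ?h \<eta> \<eta>' \<partial>lborel)" for \<eta>'
  proof -
    have "a \<eta> * b (\<eta>' - \<eta>) * ?h \<eta> \<eta>' =
        (cis (- 2 * pi * (x \<bullet> \<eta>')) * cis (2 * pi * (y \<bullet> \<eta>'))) * (a \<eta> * b (\<eta>' - \<eta>) * cis (2 * pi * (x \<bullet> \<eta>)))" for \<eta>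
    proof -
      have "cis (- 2 * pi * (x \<bullet> (\<eta>' - \<eta>))) = cis (- 2 * pi * (x \<bullet> \<eta>')) * cis (2 * pi * (x \<bullet> \<eta>))"
        by (simp add: cis_mult inner_diff_right algebra_simps)
      then show ?thesis by (simp only: mult_ac)
    qed
    then show ?thesis by (simp only: integral_mult_right_zero) (simp add: amplitude_def ift_def)
  qed
  then have "(\<integral>\<eta>'. amplitude b a (x, \<eta>') * cis (2 * pi * (y \<bullet> \<eta>')) \<partial>lborel) =
      (\<integral>\<eta>'. \<integral>\<eta>. a \<eta> * b (\<eta>' - \<eta>) * ?h \<eta> \<eta>' \<partial>lborel \<partial>lborel)" by simp
  also have "\<dots> = (\<integral>\<eta>. \<integral>\<eta>'. a \<eta> * b (\<eta>' - \<eta>) * ?h \<eta> \<eta>' \<partial>lborel \<partial>lborel)"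
    by (rule lborel_pair.Fubini_integral[OF int])
  also have "\<dots> = (\<integral>\<eta>. (a \<eta> * cis (2 * pi * (y \<bullet> \<eta>))) * ift b (y - x) \<partial>lborel)"
  proof (rule Bochner_Integration.integral_cong[OF refl])
    fix \<eta>
    have "(\<integral>\<eta>'. a \<eta> * b (\<eta>' - \<eta>) * ?h \<eta> \<eta>' \<partial>lborel) = (\<integral>\<xi>. a \<eta> * b (\<xi> + \<eta> - \<eta>) * ?h \<eta> (\<xi> + \<eta>) \<partial>lborel)"
      by (rule lborel_translate(1)[symmetric]) measurable
    also have "\<dots> = (\<integral>\<xi>. (a \<eta> * cis (2 * pi * (y \<bullet> \<eta>))) * (b \<xi> * cis (2 * pi * ((y - x) \<bullet> \<xi>))) \<partial>lborel)"
    proof (rule Bochner_Integration.integral_cong[OF refl])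
      fix \<xi>
      have "?h \<eta> (\<xi> + \<eta>) = cis (2 * pi * (y \<bullet> \<eta>)) * cis (2 * pi * ((y - x) \<bullet> \<xi>))"
        by (simp add: cis_mult inner_diff_left inner_add_right algebra_simps)
      then show "a \<eta> * b (\<xi> + \<eta> - \<eta>) * ?h \<eta> (\<xi> + \<eta>) = (a \<eta> * cis (2 * pi * (y \<bullet> \<eta>))) * (b \<xi> * cis (2 * pi * ((y - x) \<bullet> \<xi>)))"
        by (simp only: add_diff_cancel_right' mult_ac)
    qed
    also have "\<dots> = (a \<eta> * cis (2 * pi * (y \<bullet> \<eta>))) * ift b (y - x)"
      unfolding ift_def by (rule integral_mult_right_zero)
    finally show "(\<integral>\<eta>'. a \<eta> * b (\<eta>' - \<eta>) * ?h \<eta> \<eta>' \<partial>lborel) = (a \<eta> * cis (2 * pi * (y \<bullet> \<eta>))) * ift b (y - x)" .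
  qed
  also have "\<dots> = ift a y * ift b (y - x)" unfolding ift_def[of a] by (rule integral_mult_left_zero)
  finally show ?thesis .
qed

lemma schwartz_reflect:
  assumes "schwartz f"
  shows "schwartz (\<lambda>x. f (- x))"
  unfolding schwartz_iff
proof (rule smooth_in_affine_comp[where L = uminus and c = 0, simplified])
  show "smooth_in rapid f" using assms by (simp add: schwartz_iff)
  show "bounded_linear (uminus :: 'a \<Rightarrow> 'a)" by (rule bounded_linear_minus[OF bounded_linear_ident])
  fix f :: "'a \<Rightarrow> complex" and k assume f: "rapid f"
  show "rapid (\<lambda>x. k * f (- x))"
    unfolding decay_def
  proof
    fix m
    obtain C where C: "\<And>x. (1 + norm x) ^ m * norm (f x) \<le> C" using decayE[OF f, of m] by (auto simp: power_one)
    have "norm k * ((1 + norm x) ^ m * norm (f x)) \<le> norm k * C" for x by (intro mult_left_mono C) simp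
    from this[of "- _"] show "\<exists>C K. \<forall>x. (1 + norm x) ^ m * norm (k * f (- x)) \<le> C * 1 ^ K"
      by (intro exI[of _ "norm k * C"]) (simp add: norm_mult mult_ac)
  qed
qed simp

text \<open>The choice of \<open>b\<close> is the Fourier transform of \<open>g\<close>, for which
  \<open>ift b\<close> is formally \<open>g\<close>. By Fubini the pairing equals the squared L^2
  norm of \<open>b\<close>; if that were 0, the continuous function \<open>b\<close> would vanish,
  and so would \<open>g\<close> by injectivity.\<close>

lemma dual_window:
  fixes g :: "'a::euclidean_space \<Rightarrow> complex"
  assumes g: "schwartz g" and nz: "g \<noteq> (\<lambda>_. 0)"
  obtains b where "schwartz b" "(\<integral>y. ift b y * cnj (g y) \<partial>lborel) \<noteq> 0"
proof
  define b where "b \<xi> = ift g (- \<xi>)" for \<xi>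
  show b: "schwartz b" unfolding b_def[abs_def] by (intro schwartz_reflect schwartz_ift g)
  have [measurable]: "g \<in> borel_measurable borel" "b \<in> borel_measurable borel"
    using g b by (auto intro: schwartz_measurable)
  have bi: "integrable lborel b" and gi: "integrable lborel (\<lambda>y. cnj (g y))"
    using b g by (auto intro: schwartz_integrable schwartz_cnj)
  have "(\<lambda>z :: 'a \<times> 'a. cis (2 * pi * (fst z \<bullet> snd z))) \<in> borel_measurable borel"
    by (intro borel_measurable_continuous_onI continuous_on_cis continuous_intros)
  from integrable_tensor_bounded[OF gi bi this, of 1]
  have int: "integrable (lborel \<Otimes>\<^sub>M lborel) (\<lambda>(y, \<xi>). cnj (g y) * b \<xi> * cis (2 * pi * (y \<bullet> \<xi>)))" by simp
  have cnjb: "cnj (b \<xi>) = (\<integral>y. cnj (g y) * cis (2 * pi * (y \<bullet> \<xi>)) \<partial>lborel)" for \<xi>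
    unfolding b_def ift_def by (subst Bochner_Integration.integral_cnj[symmetric]) (simp add: cis_cnj inner_commute)
  have "(\<integral>y. ift b y * cnj (g y) \<partial>lborel) = (\<integral>y. \<integral>\<xi>. cnj (g y) * b \<xi> * cis (2 * pi * (y \<bullet> \<xi>)) \<partial>lborel \<partial>lborel)"
    unfolding ift_def by (subst integral_mult_left_zero[symmetric]) (simp add: mult_ac)
  also have "\<dots> = (\<integral>\<xi>. \<integral>y. cnj (g y) * b \<xi> * cis (2 * pi * (y \<bullet> \<xi>)) \<partial>lborel \<partial>lborel)"
    using lborel_pair.Fubini_integral[OF int] by simp
  also have "\<dots> = (\<integral>\<xi>. b \<xi> * cnj (b \<xi>) \<partial>lborel)"
    unfolding cnjb by (subst integral_mult_right_zero[symmetric]) (simp add: mult_ac)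
  also have "\<dots> = (\<integral>\<xi>. complex_of_real ((norm (b \<xi>))\<^sup>2) \<partial>lborel)"
    by (simp only: complex_norm_square)
  also have "\<dots> = complex_of_real (\<integral>\<xi>. (norm (b \<xi>))\<^sup>2 \<partial>lborel)" by (rule integral_complex_of_real)
  finally have e: "(\<integral>y. ift b y * cnj (g y) \<partial>lborel) = complex_of_real (\<integral>\<xi>. (norm (b \<xi>))\<^sup>2 \<partial>lborel)" .
  show "(\<integral>y. ift b y * cnj (g y) \<partial>lborel) \<noteq> 0"
  proof
    assume "(\<integral>y. ift b y * cnj (g y) \<partial>lborel) = 0"
    then have z: "(\<integral>\<xi>. (norm (b \<xi>))\<^sup>2 \<partial>lborel) = 0" using e by simp
    have "integrable lborel (\<lambda>\<xi>. b \<xi> * cnj (b \<xi>))"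
      by (intro schwartz_integrable schwartz_mult[OF b] schwartz_moderate schwartz_cnj b)
    then have i: "integrable lborel (\<lambda>\<xi>. (norm (b \<xi>))\<^sup>2)"
      unfolding complex_norm_square[symmetric] complex_of_real_integrable_eq .
    have "AE \<xi> in lborel. (norm (b \<xi>))\<^sup>2 = 0"
      using integral_nonneg_eq_0_iff_AE[OF i] z by simp
    then have ae: "AE \<xi> in lborel. b \<xi> = 0" by simp
    have "b \<xi> = 0" for \<xi>
    proof (rule ccontr)
      assume "b \<xi> \<noteq> 0"
      have "open {\<xi>. b \<xi> \<noteq> 0}" by (intro open_Collect_neq schwartz_continuous b continuous_on_const)
      then obtain e where e: "e > 0" "ball \<xi> e \<subseteq> {\<xi>. b \<xi> \<noteq> 0}" using \<open>b \<xi> \<noteq> 0\<close> by (force simp: open_contains_ball)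
      have "emeasure lborel {\<xi>. b \<xi> \<noteq> 0} = 0"
        using AE_iff_measurable[of "{\<xi>. b \<xi> \<noteq> 0}" lborel "\<lambda>\<xi>. b \<xi> = 0"] ae \<open>open {\<xi>. b \<xi> \<noteq> 0}\<close> by simp
      then have "emeasure lborel (ball \<xi> e) = 0"
        using emeasure_mono[OF e(2), of lborel] \<open>open {\<xi>. b \<xi> \<noteq> 0}\<close> by simp
      then show False using content_ball_pos[OF e(1), of \<xi>] by (simp add: measure_def)
    qed
    then have "ift g x = 0" for x using b_def[of "- x"] by simp
    then have "g = (\<lambda>_. 0)" using ift_injective[OF g] by auto
    then show False using nz by simp
  qed
qed

text \<open>Superposing the windowed characters with weights \<open>amplitude b a\<close> first
  produces \<open>ift a y * ift b (y - x)\<close> by the integral over frequency. The integral over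
  \<open>x\<close> then leaves only the pairing of \<open>ift b\<close> with \<open>g\<close>. The
  character at \<open>\<omega>\<close> shifts all frequencies, so the transform of \<open>T\<close>
  is evaluated at \<open>\<omega> - snd p\<close>.\<close>

theorem stft_reconstruction:
  fixes T :: "'a::euclidean_space distr"
  assumes T: "tempered T" and g: "schwartz g" and a: "schwartz a" and b: "schwartz b"
  shows "(\<integral>y. ift b y * cnj (g y) \<partial>lborel) * T (\<lambda>y. ift a y * cis (- 2 * pi * (y \<bullet> \<omega>))) =
      (\<integral>p. amplitude b a p * stft g T (fst p) (\<omega> - snd p) \<partial>lborel)"
    and "integrable lborel (\<lambda>p. amplitude b a p * stft g T (fst p) (\<omega> - snd p))"
proof -
  let ?f = "\<lambda>(p :: 'a \<times> 'a, y). cnj (g (y - fst p)) * cis (- 2 * pi * (y \<bullet> (\<omega> - snd p)))"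
  let ?c = "\<integral>y. ift b y * cnj (g y) \<partial>lborel"
  have f: "tame_family ?f" by (rule window_family[OF g])
  have A: "rapid_measurable (amplitude b a)" by (rule rapid_measurable_amplitude[OF a b])
  have st: "stft g T (fst p) (\<omega> - snd p) = T (\<lambda>y. ?f (p, y))" for p by (simp add: stft_def)
  have [measurable]: "(\<lambda>y. cnj (g y)) \<in> borel_measurable borel" "ift b \<in> borel_measurable borel"
    using g b by (auto intro!: schwartz_measurable schwartz_ift schwartz_cnj)
  have "superpose (amplitude b a) ?f y = ?c * (ift a y * cis (- 2 * pi * (y \<bullet> \<omega>)))" for y
  proof -
    have i: "integrable (lborel \<Otimes>\<^sub>M lborel) (\<lambda>(x, \<eta>'). amplitude b a (x, \<eta>') * ?f ((x, \<eta>'), y))"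
      using family_integrable[OF A f, of y] by (simp add: lborel_prod case_prod_unfold)
    have "superpose (amplitude b a) ?f y = (\<integral>p. amplitude b a p * ?f (p, y) \<partial>(lborel \<Otimes>\<^sub>M lborel))"
      by (simp add: superpose_def lborel_prod)
    also have "\<dots> = (\<integral>x. \<integral>\<eta>'. amplitude b a (x, \<eta>') * ?f ((x, \<eta>'), y) \<partial>lborel \<partial>lborel)"
      using lborel_pair.integral_fst'[OF i] by (simp add: case_prod_unfold)
    also have "\<dots> = (\<integral>x. (ift a y * cis (- 2 * pi * (y \<bullet> \<omega>))) * (ift b (y - x) * cnj (g (y - x))) \<partial>lborel)"
    proof (rule Bochner_Integration.integral_cong[OF refl])
      fix x
      have "amplitude b a (x, \<eta>') * ?f ((x, \<eta>'), y) =
          (cnj (g (y - x)) * cis (- 2 * pi * (y \<bullet> \<omega>))) * (amplitude b a (x, \<eta>') * cis (2 * pi * (y \<bullet> \<eta>')))" for \<eta>'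
      proof -
        have "cis (- 2 * pi * (y \<bullet> (\<omega> - \<eta>'))) = cis (- 2 * pi * (y \<bullet> \<omega>)) * cis (2 * pi * (y \<bullet> \<eta>'))"
          by (simp add: cis_mult inner_diff_right algebra_simps)
        then show ?thesis by (simp only: prod.case fst_conv snd_conv mult_ac)
      qed
      then show "(\<integral>\<eta>'. amplitude b a (x, \<eta>') * ?f ((x, \<eta>'), y) \<partial>lborel) =
          (ift a y * cis (- 2 * pi * (y \<bullet> \<omega>))) * (ift b (y - x) * cnj (g (y - x)))"
        by (simp only: integral_mult_right_zero integral_amplitude[OF a b]) (simp only: mult_ac)
    qed
    also have "\<dots> = (ift a y * cis (- 2 * pi * (y \<bullet> \<omega>))) * (\<integral>x. ift b (y - x) * cnj (g (y - x)) \<partial>lborel)"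
      by (rule integral_mult_right_zero)
    also have "(\<integral>x. ift b (y - x) * cnj (g (y - x)) \<partial>lborel) = ?c"
      by (rule lborel_reflect(1)) measurable
    finally show ?thesis by (simp only: mult_ac)
  qed
  then have "T (\<lambda>y. ?c * (ift a y * cis (- 2 * pi * (y \<bullet> \<omega>)))) = T (superpose (amplitude b a) ?f)"
    by presburger
  also have "\<dots> = (\<integral>p. amplitude b a p * T (\<lambda>y. ?f (p, y)) \<partial>lborel)"
    by (rule tempered_superpose_eq[OF T f A])
  also have "T (\<lambda>y. ?c * (ift a y * cis (- 2 * pi * (y \<bullet> \<omega>)))) = ?c * T (\<lambda>y. ift a y * cis (- 2 * pi * (y \<bullet> \<omega>)))"
  proof (rule tempered_scale[OF T])
    have "moderate (\<lambda>y. cis ((- 2 * pi) * (y \<bullet> \<omega>)))" by (rule moderate_character)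
    then show "schwartz (\<lambda>y. ift a y * cis (- 2 * pi * (y \<bullet> \<omega>)))" by (intro schwartz_mult schwartz_ift a)
  qed
  finally show "?c * T (\<lambda>y. ift a y * cis (- 2 * pi * (y \<bullet> \<omega>))) =
      (\<integral>p. amplitude b a p * stft g T (fst p) (\<omega> - snd p) \<partial>lborel)"
    by (simp only: st)
  obtain C K where "\<And>p. norm (T (\<lambda>y. ?f (p, y))) \<le> C * (1 + norm p) ^ K"
    using bounded_tempered_family[OF T f] by blast
  then show "integrable lborel (\<lambda>p. amplitude b a p * stft g T (fst p) (\<omega> - snd p))"
    unfolding st
    by (intro rapid_measurable_mult[OF A] borel_measurable_continuous_onI continuous_tempered_family[OF T f])
qed

section \<open>Amplitude norms\<close>

text \<open>The L^1 norm in position of \<open>amplitude b a\<close> at the frequency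
  \<open>\<eta>'\<close>; the unimodular prefactor of the amplitude drops out.\<close>

definition amp_norm :: "('a::euclidean_space \<Rightarrow> complex) \<Rightarrow> ('a \<Rightarrow> complex) \<Rightarrow> 'a \<Rightarrow> ennreal" where
  "amp_norm b a \<eta>' = (\<integral>\<^sup>+x. ennreal (norm (ift (\<lambda>\<eta>. a \<eta> * b (\<eta>' - \<eta>)) x)) \<partial>lborel)"

lemma ift_borel_measurable [measurable]:
  assumes [measurable]: "f \<in> borel_measurable borel"
  shows "ift f \<in> borel_measurable borel"
  unfolding ift_def[abs_def] by measurable

text \<open>Hoelder's inequality in position, with L^1 for the amplitude and the uniform bound
  \<open>u\<close> for the short-time transform. What remains is a convolution in frequency.\<close>

lemma stft_estimate:
  fixes T :: "'a::euclidean_space distr"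
  assumes T: "tempered T" and g: "schwartz g" and a: "schwartz a" and b: "schwartz b"
    and [measurable]: "u \<in> borel_measurable borel" and u: "\<And>x \<omega>. ennreal (norm (stft g T x \<omega>)) \<le> u \<omega>"
  shows "ennreal (norm (\<integral>y. ift b y * cnj (g y) \<partial>lborel) * norm (T (\<lambda>y. ift a y * cis (- 2 * pi * (y \<bullet> \<omega>))))) \<le>
      (\<integral>\<^sup>+\<eta>'. amp_norm b a \<eta>' * u (\<omega> - \<eta>') \<partial>lborel)"
proof -
  have "amplitude b a \<in> borel_measurable borel"
    by (intro amplitude_measurable schwartz_measurable a b)
  then have [measurable]: "amplitude b a \<in> borel_measurable (borel \<Otimes>\<^sub>M borel)" by (simp add: borel_prod)
  have [measurable]: "a \<in> borel_measurable borel" "b \<in> borel_measurable borel"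
    using a b by (auto intro: schwartz_measurable)
  have "ennreal (norm (\<integral>y. ift b y * cnj (g y) \<partial>lborel) * norm (T (\<lambda>y. ift a y * cis (- 2 * pi * (y \<bullet> \<omega>))))) =
      ennreal (norm (\<integral>p. amplitude b a p * stft g T (fst p) (\<omega> - snd p) \<partial>lborel))"
    by (simp only: stft_reconstruction(1)[OF T g a b, symmetric] norm_mult)
  also have "\<dots> \<le> (\<integral>\<^sup>+p. ennreal (norm (amplitude b a p * stft g T (fst p) (\<omega> - snd p))) \<partial>lborel)"
    by (rule integral_norm_bound_ennreal[OF stft_reconstruction(2)[OF T g a b]])
  also have "\<dots> \<le> (\<integral>\<^sup>+p. ennreal (norm (amplitude b a p)) * u (\<omega> - snd p) \<partial>lborel)"
    by (intro nn_integral_mono) (auto simp: norm_mult ennreal_mult intro!: mult_left_mono u)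
  also have "\<dots> = (\<integral>\<^sup>+p. ennreal (norm (amplitude b a p)) * u (\<omega> - snd p) \<partial>(lborel \<Otimes>\<^sub>M lborel))"
    by (simp add: lborel_prod)
  also have "\<dots> = (\<integral>\<^sup>+\<eta>'. \<integral>\<^sup>+x. ennreal (norm (amplitude b a (x, \<eta>'))) * u (\<omega> - \<eta>') \<partial>lborel \<partial>lborel)"
    by (subst lborel_pair.nn_integral_snd[symmetric]) (auto simp: case_prod_unfold)
  also have "\<dots> = (\<integral>\<^sup>+\<eta>'. amp_norm b a \<eta>' * u (\<omega> - \<eta>') \<partial>lborel)"
    by (intro nn_integral_cong, subst nn_integral_multc) (auto simp: amp_norm_def amplitude_def norm_mult)
  finally show ?thesis .
qed

lemma amp_norm_scale:
  assumes [measurable]: "a \<in> borel_measurable borel" "b \<in> borel_measurable borel"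
  shows "amp_norm b (\<lambda>\<eta>. c * a \<eta>) \<eta>' = ennreal (norm c) * amp_norm b a \<eta>'"
proof -
  have "ift (\<lambda>\<eta>. c * a \<eta> * b (\<eta>' - \<eta>)) x = c * ift (\<lambda>\<eta>. a \<eta> * b (\<eta>' - \<eta>)) x" for x
    unfolding ift_def mult.assoc by (rule integral_mult_right_zero)
  then show ?thesis unfolding amp_norm_def by (simp add: norm_mult ennreal_mult nn_integral_cmult)
qed

lemma integrable_mult_window:
  assumes a: "schwartz a" and b: "schwartz b"
  shows "integrable lborel (\<lambda>\<eta>. a \<eta> * b (\<eta>' - \<eta>))"
proof -
  have [measurable]: "b \<in> borel_measurable borel" using b by (rule schwartz_measurable)
  obtain C where "\<And>x. (1 + norm x) ^ 0 * norm (b x) \<le> C" using schwartz_bound[OF b] by blast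
  then show ?thesis
    by (intro integrable_mult_bounded[where B = C] schwartz_integrable a) auto
qed

lemma amp_norm_add:
  assumes a: "schwartz a" and a': "schwartz a'" and b: "schwartz b"
  shows "amp_norm b (\<lambda>\<eta>. a \<eta> + a' \<eta>) \<eta>' \<le> amp_norm b a \<eta>' + amp_norm b a' \<eta>'"
proof -
  have [measurable]: "a \<in> borel_measurable borel" "a' \<in> borel_measurable borel" "b \<in> borel_measurable borel"
    using a a' b by (auto intro: schwartz_measurable)
  have "ift (\<lambda>\<eta>. (a \<eta> + a' \<eta>) * b (\<eta>' - \<eta>)) x = ift (\<lambda>\<eta>. a \<eta> * b (\<eta>' - \<eta>)) x + ift (\<lambda>\<eta>. a' \<eta> * b (\<eta>' - \<eta>)) x" for x
  proof -
    have "integrable lborel (\<lambda>\<eta>. a \<eta> * b (\<eta>' - \<eta>) * cis (2 * pi * (x \<bullet> \<eta>)))"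
      "integrable lborel (\<lambda>\<eta>. a' \<eta> * b (\<eta>' - \<eta>) * cis (2 * pi * (x \<bullet> \<eta>)))"
      by (intro integrable_mult_cis integrable_mult_window a a' b; simp)+
    then show ?thesis unfolding ift_def by (subst Bochner_Integration.integral_add[symmetric]) (simp_all add: algebra_simps)
  qed
  then have "amp_norm b (\<lambda>\<eta>. a \<eta> + a' \<eta>) \<eta>' \<le>
      (\<integral>\<^sup>+x. ennreal (norm (ift (\<lambda>\<eta>. a \<eta> * b (\<eta>' - \<eta>)) x)) + ennreal (norm (ift (\<lambda>\<eta>. a' \<eta> * b (\<eta>' - \<eta>)) x)) \<partial>lborel)"
    unfolding amp_norm_def
    by (intro nn_integral_mono) (auto simp: ennreal_plus[symmetric] norm_triangle_ineq simp del: ennreal_plus)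
  also have "\<dots> = amp_norm b a \<eta>' + amp_norm b a' \<eta>'"
    unfolding amp_norm_def by (intro nn_integral_add) auto
  finally show ?thesis .
qed

text \<open>A linear phase in frequency translates the transform in position, and Lebesgue measure
  is translation invariant.\<close>

lemma amp_norm_modulate:
  assumes [measurable]: "a \<in> borel_measurable borel" "b \<in> borel_measurable borel"
  shows "amp_norm b (\<lambda>\<eta>. cis (c * (\<eta> \<bullet> v)) * a \<eta>) \<eta>' = amp_norm b a \<eta>'"
proof -
  have "ift (\<lambda>\<eta>. cis (c * (\<eta> \<bullet> v)) * a \<eta> * b (\<eta>' - \<eta>)) x = ift (\<lambda>\<eta>. a \<eta> * b (\<eta>' - \<eta>)) (x + (c / (2 * pi)) *\<^sub>R v)" for x
    unfolding ift_def
  proof (rule Bochner_Integration.integral_cong[OF refl])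
    fix \<eta>
    have "cis (2 * pi * ((x + (c / (2 * pi)) *\<^sub>R v) \<bullet> \<eta>)) = cis (c * (\<eta> \<bullet> v)) * cis (2 * pi * (x \<bullet> \<eta>))"
      by (simp add: cis_mult inner_add_left inner_commute algebra_simps)
    then show "cis (c * (\<eta> \<bullet> v)) * a \<eta> * b (\<eta>' - \<eta>) * cis (2 * pi * (x \<bullet> \<eta>)) =
        a \<eta> * b (\<eta>' - \<eta>) * cis (2 * pi * ((x + (c / (2 * pi)) *\<^sub>R v) \<bullet> \<eta>))"
      by (simp only: mult_ac)
  qed
  then show ?thesis unfolding amp_norm_def
    using nn_integral_lborel_translate[of "\<lambda>x. ennreal (norm (ift (\<lambda>\<eta>. a \<eta> * b (\<eta>' - \<eta>)) x))"] by simp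
qed

section \<open>Quadratic phases\<close>

definition qf :: "'a::euclidean_space \<times> 'a \<Rightarrow> real" where
  "qf \<eta> = fst \<eta> \<bullet> snd \<eta>"

lemma qf_diff: "qf (\<eta> - \<omega>) = qf \<omega> + (qf \<eta> - \<eta> \<bullet> prod.swap \<omega>)"
  by (simp add: qf_def inner_prod_def inner_diff_left inner_diff_right inner_commute)

lemma qf_measurable [measurable]: "qf \<in> borel_measurable borel"
  unfolding qf_def[abs_def] by (intro borel_measurable_continuous_onI continuous_intros)

text \<open>
  Translating the quadratic phase changes it by a linear phase and a constant, neither of which is
  seen by the amplitude norm. This makes all estimates uniform in the frequency \<open>\<omega>\<close>.
\<close>

lemma amp_norm_chirp:
  assumes [measurable]: "a \<in> borel_measurable borel" "b \<in> borel_measurable borel"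
  shows "amp_norm b (\<lambda>\<eta>. cis (pi * s * qf (\<eta> - \<omega>)) * a \<eta>) \<eta>' = amp_norm b (\<lambda>\<eta>. cis (pi * s * qf \<eta>) * a \<eta>) \<eta>'"
proof -
  have "cis (pi * s * qf (\<eta> - \<omega>)) * a \<eta> =
      cis (pi * s * qf \<omega>) * (cis ((- pi * s) * (\<eta> \<bullet> prod.swap \<omega>)) * (cis (pi * s * qf \<eta>) * a \<eta>))" for \<eta>
  proof -
    have "cis (pi * s * qf (\<eta> - \<omega>)) =
        cis (pi * s * qf \<omega>) * cis ((- pi * s) * (\<eta> \<bullet> prod.swap \<omega>)) * cis (pi * s * qf \<eta>)"
      unfolding cis_mult by (simp add: qf_diff algebra_simps)
    then show ?thesis by (simp only: mult.assoc)
  qed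
  then have "amp_norm b (\<lambda>\<eta>. cis (pi * s * qf (\<eta> - \<omega>)) * a \<eta>) \<eta>' =
      amp_norm b (\<lambda>\<eta>. cis (pi * s * qf \<omega>) * (cis ((- pi * s) * (\<eta> \<bullet> prod.swap \<omega>)) * (cis (pi * s * qf \<eta>) * a \<eta>))) \<eta>'"
    by (simp only:)
  also have "\<dots> = amp_norm b (\<lambda>\<eta>. cis (pi * s * qf \<eta>) * a \<eta>) \<eta>'"
    by (subst amp_norm_scale, simp, simp, subst amp_norm_modulate) simp_all
  finally show ?thesis .
qed

section \<open>The function sinc as an average of characters\<close>

abbreviation U :: "real measure" where "U \<equiv> uniform_measure lborel {-1..1}"

lemma prob_space_U: "prob_space U"
  by (rule prob_space_uniform_measure) simp_all

lemma AE_U: "AE s in U. \<bar>s\<bar> \<le> 1"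
  by (rule AE_uniform_measureI) auto

lemma integral_U: 
  fixes f :: "real \<Rightarrow> complex"
  assumes [measurable]: "f \<in> borel_measurable borel"
  shows "(\<integral>s. f s \<partial>U) = (\<integral>s. indicator {-1..1} s *\<^sub>R f s \<partial>lborel) / 2"
proof -
  have "U = density lborel (\<lambda>s. ennreal (indicator {-1..1} s / 2))"
    unfolding uniform_measure_def
    by (intro arg_cong[where f = "density lborel"] ext)
      (auto simp: indicator_def divide_ennreal[symmetric])
  then have "(\<integral>s. f s \<partial>U) = (\<integral>s. (indicator {-1..1} s / 2) *\<^sub>R f s \<partial>lborel)"
    by (simp add: integral_density)
  also have "\<dots> = (\<integral>s. (1 / 2) *\<^sub>R (indicator {-1..1} s *\<^sub>R f s) \<partial>lborel)" by simp
  finally show ?thesis by (simp only: integral_scaleR_right) (simp add: scaleR_conv_of_real)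
qed

lemma nsinc_average: "complex_of_real (nsinc t) = (\<integral>s. cis (pi * s * t) \<partial>U)"
proof (cases "t = 0")
  case True
  interpret prob_space U by (rule prob_space_U)
  have "(\<integral>s. cis (pi * s * t) \<partial>U) = (\<integral>s. 1 \<partial>U)" unfolding True mult_zero_right cis_zero ..
  also have "\<dots> = 1" unfolding lebesgue_integral_const prob_space by simp
  finally show ?thesis using True by (simp add: nsinc_def)
next
  case False
  define F where "F s = (1 / (\<i> * of_real (pi * t))) * cis ((pi * t) * s)" for s
  have "(\<integral>s. indicator {-1..1} s *\<^sub>R cis ((pi * t) * s) \<partial>lborel) = F 1 - F (-1)"
  proof (rule integral_FTC_atLeastAtMost)
    fix s
    let ?k = "\<i> * complex_of_real (pi * t)"
    have 1: "(F has_vector_derivative (1 / ?k) * (?k * cis ((pi * t) * s))) (at s)"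
      unfolding F_def[abs_def] by (rule has_vector_derivative_mult_right[OF has_vector_derivative_cis])
    have "?k \<noteq> 0" using False by simp
    then have "(1 / ?k) * (?k * cis ((pi * t) * s)) = cis ((pi * t) * s)"
      by (simp only: mult.assoc[symmetric] nonzero_eq_divide_eq times_divide_eq_left mult_1_left divide_self_if if_False)
    with 1 show "(F has_vector_derivative cis ((pi * t) * s)) (at s within {-1..1})"
      by (simp only: has_vector_derivative_at_within)
  qed (auto intro!: continuous_intros continuous_on_cis)
  then have "(\<integral>s. cis (pi * s * t) \<partial>U) = (F 1 - F (-1)) / 2"
    by (subst integral_U) (simp_all add: mult_ac)
  also have "F 1 - F (-1) = (1 / (\<i> * of_real (pi * t))) * (cis (pi * t) - cis (- (pi * t)))"
    by (simp add: F_def algebra_simps)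
  also have "cis (pi * t) - cis (- (pi * t)) = 2 * \<i> * of_real (sin (pi * t))"
    by (simp add: complex_eq_iff)
  finally show ?thesis using False by (simp add: nsinc_def)
qed

text \<open>The derivatives of \<open>nsinc\<close>, obtained by differentiating its integral
  representation. The removable singularity at 0 disappears, and
  \<open>\<bar>s\<bar> \<le> 1\<close> bounds the derivative of order \<open>k\<close> by
  \<open>pi ^ k\<close>.\<close>

definition sinc_deriv :: "nat \<Rightarrow> real \<Rightarrow> complex" where
  "sinc_deriv k t = (\<integral>s. (\<i> * of_real (pi * s)) ^ k * cis (pi * s * t) \<partial>U)"

lemma integrable_U:
  fixes f :: "real \<Rightarrow> complex"
  assumes "f \<in> borel_measurable borel" "\<And>s. \<bar>s\<bar> \<le> 1 \<Longrightarrow> norm (f s) \<le> B"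
  shows "integrable U f" "norm (\<integral>s. f s \<partial>U) \<le> B"
proof -
  interpret prob_space U by (rule prob_space_U)
  have ae: "AE s in U. norm (f s) \<le> B" using AE_U assms(2) by (auto elim: eventually_mono)
  show i: "integrable U f" using assms(1) by (intro integrable_const_bound[OF ae]) simp
  have "norm (\<integral>s. f s \<partial>U) \<le> (\<integral>s. norm (f s) \<partial>U)" by (rule integral_norm_bound)
  also have "\<dots> \<le> (\<integral>s. B \<partial>U)" using ae i by (intro integral_mono_AE) auto
  finally show "norm (\<integral>s. f s \<partial>U) \<le> B" using prob_space by simp
qed

lemma sinc_deriv_integrand:
  "(\<lambda>s. (\<i> * complex_of_real (pi * s)) ^ k * cis (pi * s * t)) \<in> borel_measurable borel"
  "\<bar>s\<bar> \<le> 1 \<Longrightarrow> norm ((\<i> * complex_of_real (pi * s)) ^ k * cis (pi * s * t)) \<le> pi ^ k"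
proof -
  show "(\<lambda>s. (\<i> * complex_of_real (pi * s)) ^ k * cis (pi * s * t)) \<in> borel_measurable borel"
    by (intro borel_measurable_continuous_onI continuous_intros continuous_on_cis)
  show "norm ((\<i> * complex_of_real (pi * s)) ^ k * cis (pi * s * t)) \<le> pi ^ k" if "\<bar>s\<bar> \<le> 1"
    using that by (auto simp: norm_mult norm_power abs_mult intro!: power_mono mult_left_le)
qed

lemma sinc_deriv_bound: "norm (sinc_deriv k t) \<le> pi ^ k"
  unfolding sinc_deriv_def by (rule integrable_U(2)[OF sinc_deriv_integrand])

lemma sinc_deriv_has_derivative: "(sinc_deriv k has_vector_derivative sinc_deriv (k + 1) t) (at t)"
  unfolding has_vector_derivative_def
proof (rule has_derivative_quadratic)
  fix h :: real
  let ?e = "\<lambda>s. (\<i> * complex_of_real (pi * s)) ^ k * cis (pi * s * t)"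
  have i: "integrable U (\<lambda>s. (\<i> * complex_of_real (pi * s)) ^ k * cis (pi * s * t))" for k t
    by (rule integrable_U(1)[OF sinc_deriv_integrand])
  have "sinc_deriv k (t + h) - sinc_deriv k t - h *\<^sub>R sinc_deriv (k + 1) t =
      (\<integral>s. (\<i> * complex_of_real (pi * s)) ^ k * cis (pi * s * (t + h)) - ?e s
        - h *\<^sub>R ((\<i> * complex_of_real (pi * s)) ^ (k + 1) * cis (pi * s * t)) \<partial>U)"
    unfolding sinc_deriv_def using i by (simp del: power_Suc of_real_mult)
  also have "\<dots> = (\<integral>s. ?e s * (cis (pi * s * h) - 1 - \<i> * of_real (pi * s * h)) \<partial>U)"
  proof (rule Bochner_Integration.integral_cong[OF refl])
    fix s
    have "cis (pi * s * (t + h)) = cis (pi * s * t) * cis (pi * s * h)" by (simp add: cis_mult algebra_simps)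
    then show "(\<i> * complex_of_real (pi * s)) ^ k * cis (pi * s * (t + h)) - ?e s
        - h *\<^sub>R ((\<i> * complex_of_real (pi * s)) ^ (k + 1) * cis (pi * s * t)) =
        ?e s * (cis (pi * s * h) - 1 - \<i> * of_real (pi * s * h))"
      by (simp add: scaleR_conv_of_real algebra_simps)
  qed
  also have "norm \<dots> \<le> pi ^ k * (pi * h)\<^sup>2"
  proof (rule integrable_U(2))
    show "(\<lambda>s. ?e s * (cis (pi * s * h) - 1 - \<i> * of_real (pi * s * h))) \<in> borel_measurable borel"
      by (intro borel_measurable_continuous_onI continuous_intros continuous_on_cis)
    fix s :: real assume s: "\<bar>s\<bar> \<le> 1"
    have "norm (cis (pi * s * h) - 1 - \<i> * of_real (pi * s * h)) \<le> (pi * s * h)\<^sup>2" by (rule cis_taylor)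
    also have "\<dots> = s\<^sup>2 * (pi * h)\<^sup>2" by (simp add: power_mult_distrib)
    also have "\<dots> \<le> 1 * (pi * h)\<^sup>2" using s by (intro mult_right_mono) (auto simp: abs_square_le_1)
    finally show "norm (?e s * (cis (pi * s * h) - 1 - \<i> * of_real (pi * s * h))) \<le> pi ^ k * (pi * h)\<^sup>2"
      unfolding norm_mult[of "?e s"] by (intro mult_mono sinc_deriv_integrand s) auto
  qed
  finally show "norm (sinc_deriv k (t + h) - sinc_deriv k t - h *\<^sub>R sinc_deriv (k + 1) t) \<le> (pi ^ k * pi\<^sup>2) * (norm h)\<^sup>2"
    by (simp add: power_mult_distrib mult.assoc)
qed (intro bounded_linear_scaleR_left)

lemma moderate_nsinc:
  assumes "moderate (\<lambda>x. complex_of_real (\<tau> x))"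
  shows "moderate (\<lambda>x. complex_of_real (nsinc (\<tau> x)))"
proof -
  let ?G = "{\<lambda>t. c * sinc_deriv k t |c k. True}"
  have "moderate (\<lambda>x. sinc_deriv 0 (\<tau> x))"
  proof (rule sgrowth_real_comp[OF weight_norm assms, where G = ?G])
    have "sinc_deriv 0 = (\<lambda>t. 1 * sinc_deriv 0 t)" by simp
    then show "sinc_deriv 0 \<in> ?G" by blast
    fix \<phi> assume "\<phi> \<in> ?G"
    then obtain c k where \<phi>: "\<phi> = (\<lambda>t. c * sinc_deriv k t)" by auto
    have "(\<phi> has_vector_derivative (c * sinc_deriv (k + 1) t + 0 * sinc_deriv 0 t)) (at t)" for t
      using has_vector_derivative_mult_right[OF sinc_deriv_has_derivative[of k t], of c] by (simp add: \<phi>)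
    then show "\<exists>\<phi>1\<in>?G. \<exists>\<phi>2\<in>?G. \<forall>t. (\<phi> has_vector_derivative (\<phi>1 t + \<phi>2 t)) (at t)"
      by (intro bexI[of _ "\<lambda>t. c * sinc_deriv (k + 1) t"] bexI[of _ "\<lambda>t. 0 * sinc_deriv 0 t"]) blast+
    show "\<exists>B. \<forall>t. norm (\<phi> t) \<le> B"
      unfolding \<phi> by (intro exI[of _ "norm c * pi ^ k"] allI) (auto simp: norm_mult intro!: mult_left_mono sinc_deriv_bound)
  qed
  then show ?thesis by (simp add: sinc_deriv_def nsinc_average)
qed

text \<open>Minkowski's integral inequality for the L^1 norm in position: by Fubini the transform of
  the averaged amplitude is the average of the transforms.\<close>

lemma amp_norm_average:
  fixes G :: "'a::euclidean_space \<Rightarrow> complex"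
  assumes G: "schwartz G" and b: "schwartz b" and [measurable]: "\<tau> \<in> borel_measurable borel"
  shows "amp_norm b (\<lambda>\<eta>. complex_of_real (nsinc (\<tau> \<eta>)) * G \<eta>) \<eta>' \<le>
      (\<integral>\<^sup>+s. amp_norm b (\<lambda>\<eta>. cis (pi * s * \<tau> \<eta>) * G \<eta>) \<eta>' \<partial>U)"
proof -
  interpret U: prob_space U by (rule prob_space_U)
  interpret P: pair_sigma_finite U "lborel :: 'a measure" ..
  have [measurable]: "G \<in> borel_measurable borel" "b \<in> borel_measurable borel"
    using G b by (auto intro: schwartz_measurable)
  define H where "H \<eta> = G \<eta> * b (\<eta>' - \<eta>)" for \<eta>
  have [measurable]: "H \<in> borel_measurable borel" unfolding H_def[abs_def] by measurable
  have Hi: "integrable lborel H" unfolding H_def[abs_def] by (rule integrable_mult_window[OF G b])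
  define J where "J s x = ift (\<lambda>\<eta>. cis (pi * s * \<tau> \<eta>) * H \<eta>) x" for s x
  have "(\<lambda>z :: (real \<times> 'a) \<times> 'a. cis (pi * fst (fst z) * \<tau> (snd z)) * H (snd z)) \<in> borel_measurable borel"
    unfolding borel_prod[symmetric] by measurable
  from ift_measurable[OF this borel_measurable_continuous_onI[OF continuous_on_snd[OF continuous_on_id]]]
  have "(\<lambda>(s, x). J s x) \<in> borel_measurable (borel \<Otimes>\<^sub>M borel)"
    unfolding J_def case_prod_unfold borel_prod by simp
  then have Jm [measurable]: "(\<lambda>(s, x). J s x) \<in> borel_measurable (U \<Otimes>\<^sub>M lborel)"
    by (subst measurable_cong_sets[OF sets_pair_measure_cong refl]) auto
  have eq: "ift (\<lambda>\<eta>. complex_of_real (nsinc (\<tau> \<eta>)) * G \<eta> * b (\<eta>' - \<eta>)) x = (\<integral>s. J s x \<partial>U)" for x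
  proof -
    let ?F = "\<lambda>s \<eta>. cis (pi * s * \<tau> \<eta>) * H \<eta> * cis (2 * pi * (x \<bullet> \<eta>))"
    have int: "integrable (U \<Otimes>\<^sub>M lborel) (\<lambda>(s, \<eta>). ?F s \<eta>)"
    proof (rule P.Fubini_integrable)
      show "(\<lambda>(s, \<eta>). ?F s \<eta>) \<in> borel_measurable (U \<Otimes>\<^sub>M lborel)" by measurable
      show "integrable U (\<lambda>s. \<integral>\<eta>. norm (case (s, \<eta>) of (s, \<eta>) \<Rightarrow> ?F s \<eta>) \<partial>lborel)"
        by (simp add: norm_mult)
      show "AE s in U. integrable lborel (\<lambda>\<eta>. case (s, \<eta>) of (s, \<eta>) \<Rightarrow> ?F s \<eta>)"
      proof (intro AE_I2)
        fix s
        have "integrable lborel (\<lambda>\<eta>. H \<eta> * cis (pi * s * \<tau> \<eta>) * cis (2 * pi * (x \<bullet> \<eta>)))"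
          by (intro integrable_mult_cis Hi) auto
        then show "integrable lborel (\<lambda>\<eta>. case (s, \<eta>) of (s, \<eta>) \<Rightarrow> ?F s \<eta>)" by (simp add: mult_ac)
      qed
    qed
    have "ift (\<lambda>\<eta>. complex_of_real (nsinc (\<tau> \<eta>)) * G \<eta> * b (\<eta>' - \<eta>)) x = (\<integral>\<eta>. \<integral>s. ?F s \<eta> \<partial>U \<partial>lborel)"
      unfolding ift_def nsinc_average
    proof (rule Bochner_Integration.integral_cong[OF refl])
      fix \<eta>
      have "(\<integral>s. ?F s \<eta> \<partial>U) = (\<integral>s. cis (pi * s * \<tau> \<eta>) * (H \<eta> * cis (2 * pi * (x \<bullet> \<eta>))) \<partial>U)" by (simp only: mult.assoc)
      also have "\<dots> = (\<integral>s. cis (pi * s * \<tau> \<eta>) \<partial>U) * (H \<eta> * cis (2 * pi * (x \<bullet> \<eta>)))" by (rule integral_mult_left_zero)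
      finally show "(\<integral>s. cis (pi * s * \<tau> \<eta>) \<partial>U) * G \<eta> * b (\<eta>' - \<eta>) * cis (2 * pi * (x \<bullet> \<eta>)) = (\<integral>s. ?F s \<eta> \<partial>U)"
        by (simp only: H_def mult.assoc)
    qed
    also have "\<dots> = (\<integral>s. \<integral>\<eta>. ?F s \<eta> \<partial>lborel \<partial>U)" by (rule P.Fubini_integral[OF int])
    finally show ?thesis by (simp add: J_def ift_def)
  qed
  have Jx [measurable]: "(\<lambda>s. J s x) \<in> borel_measurable U" for x
    using measurable_compose[OF measurable_Pair2', OF _ Jm, of x] by simp
  have "norm (J s x) \<le> (\<integral>\<eta>. norm (H \<eta>) \<partial>lborel)" for s x
    unfolding J_def by (rule order_trans[OF norm_ift_le]) (simp add: norm_mult)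
  then have Ji: "integrable U (\<lambda>s. J s x)" for x
    by (intro U.integrable_const_bound[where B = "\<integral>\<eta>. norm (H \<eta>) \<partial>lborel"]) auto
  have "amp_norm b (\<lambda>\<eta>. complex_of_real (nsinc (\<tau> \<eta>)) * G \<eta>) \<eta>' \<le> (\<integral>\<^sup>+x. \<integral>\<^sup>+s. ennreal (norm (J s x)) \<partial>U \<partial>lborel)"
    unfolding amp_norm_def eq by (intro nn_integral_mono integral_norm_bound_ennreal Ji)
  also have "\<dots> = (\<integral>\<^sup>+s. \<integral>\<^sup>+x. ennreal (norm (J s x)) \<partial>lborel \<partial>U)"
    by (rule P.Fubini') measurable
  also have "\<dots> = (\<integral>\<^sup>+s. amp_norm b (\<lambda>\<eta>. cis (pi * s * \<tau> \<eta>) * G \<eta>) \<eta>' \<partial>U)"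
    by (simp add: amp_norm_def J_def H_def mult.assoc)
  finally show ?thesis .
qed

section \<open>Multipliers compatible with the amplitude norm\<close>

lemma moderate_qf: "moderate (\<lambda>\<eta>. complex_of_real (qf \<eta>))"
  unfolding qf_def by (intro moderate_inner_comp bounded_linear_fst bounded_linear_snd)

lemma moderate_qf_diff: "moderate (\<lambda>\<eta>. complex_of_real (qf (\<eta> - \<omega>)))"
proof -
  have "moderate (\<lambda>\<eta>. complex_of_real (qf \<omega>) + (complex_of_real (qf \<eta>) + (-1) * of_real (\<eta> \<bullet> prod.swap \<omega>)))"
    by (intro sgrowth_add sgrowth_mult sgrowth_const weight_norm moderate_qf moderate_inner)
  then show ?thesis by (simp add: qf_diff algebra_simps)
qed

lemma moderate_comp_linear:
  fixes f :: "'b::euclidean_space \<Rightarrow> complex" and L :: "'a::euclidean_space \<Rightarrow> 'b"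
  assumes f: "moderate f" and L: "bounded_linear L"
  shows "moderate (\<lambda>x. f (L x))"
proof -
  obtain B where B: "0 < B" "\<And>x. norm (L x) \<le> norm x * B" using bounded_linear.pos_bounded[OF L] by metis
  have "moderate (\<lambda>x. f (L x + 0))"
  proof (rule smooth_in_affine_comp[OF f L])
    fix f :: "'b \<Rightarrow> complex" and k assume gr: "growth (\<lambda>x. 1 + norm x) f"
    obtain C K where C: "0 \<le> C" "\<And>x. norm (f x) \<le> C * (1 + norm x) ^ K"
      using growthE[OF gr weight_norm] by blast
    have "norm (k * f (L x + 0)) \<le> (norm k * C * (1 + B) ^ K) * (1 + norm x) ^ K" for x
    proof -
      have "1 + norm (L x) \<le> (1 + B) * (1 + norm x)" using B(1) B(2)[of x] norm_ge_zero[of x]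
        by (simp add: algebra_simps del: norm_ge_zero)
      then have "C * (1 + norm (L x)) ^ K \<le> C * ((1 + B) * (1 + norm x)) ^ K"
        by (intro mult_left_mono power_mono C) auto
      then have "norm (f (L x)) \<le> C * ((1 + B) * (1 + norm x)) ^ K" using C(2)[of "L x"] by linarith
      then have "norm k * norm (f (L x)) \<le> norm k * (C * ((1 + B) * (1 + norm x)) ^ K)" by (rule mult_left_mono) simp
      then show ?thesis by (simp only: norm_mult power_mult_distrib add_0_right mult_ac)
    qed
    then show "growth (\<lambda>x. 1 + norm x) (\<lambda>x. k * f (L x + 0))" by (rule growthI)
  qed simp
  then show ?thesis by simp
qed

text \<open>
  \<open>multiplier b \<theta> k F\<close>: multiplying \<open>\<theta>\<close> by \<open>F \<omega>\<close> costs a factor \<open>(1 + |\<omega>|)^k\<close> in the amplitude norm.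
  The additional factors, a chirp of bounded rate and an arbitrary moderate function of \<open>\<eta>\<close>, make
  this property stable under multiplication by \<open>\<eta> \<mapsto> cis (\<pi> r (\<eta> - \<omega>)\<^sub>1 \<cdot> (\<eta> - \<omega>)\<^sub>2)\<close> and by polynomials.
\<close>

definition multiplier ::
    "('a::euclidean_space \<times> 'a \<Rightarrow> complex) \<Rightarrow> ('a \<times> 'a \<Rightarrow> complex) \<Rightarrow> nat \<Rightarrow> ('a \<times> 'a \<Rightarrow> 'a \<times> 'a \<Rightarrow> complex) \<Rightarrow> bool" where
  "multiplier b \<theta> k F \<longleftrightarrow> (\<forall>\<omega>. moderate (F \<omega>)) \<and> (\<forall>h R. moderate h \<longrightarrow>
     (\<exists>C\<ge>0. \<forall>\<omega> \<eta>' s. \<bar>s\<bar> \<le> R \<longrightarrow> amp_norm b (\<lambda>\<eta>. cis (pi * s * qf \<eta>) * (F \<omega> \<eta> * (h \<eta> * \<theta> \<eta>))) \<eta>' \<le>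
        ennreal (C * (1 + norm \<omega>) ^ k * (1 / (1 + norm \<eta>') ^ (2 * DIM('a \<times> 'a))))))"

context
  fixes b \<theta> :: "'a::euclidean_space \<times> 'a \<Rightarrow> complex"
  assumes b: "schwartz b" and \<theta>: "schwartz \<theta>"
begin

lemma multiplier_integrand:
  assumes "moderate F" "moderate h"
  shows "schwartz (\<lambda>\<eta>. cis (pi * s * qf \<eta>) * (F \<eta> * (h \<eta> * \<theta> \<eta>)))"
  by (intro schwartz_mult' assms \<theta> sgrowth_cis weight_norm moderate_qf)

text \<open>The rate \<open>s\<close> of the chirp is treated as the parameter of a Schwartz family,
  so the bounds are polynomial in \<open>1 + \<bar>s\<bar>\<close> and uniform for
  \<open>\<bar>s\<bar> \<le> R\<close>. Decay of order \<open>2 * DIM\<close> is taken in both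
  variables: in \<open>x\<close> it is integrated to \<open>I\<close>, in \<open>\<eta>'\<close> it
  is kept.\<close>

lemma multiplier_one: "multiplier b \<theta> 0 (\<lambda>_ _. 1)"
  unfolding multiplier_def
proof (intro conjI allI impI sgrowth_const weight_norm)
  fix h :: "'a \<times> 'a \<Rightarrow> complex" and R :: real assume h: "moderate h"
  let ?k = "2 * DIM('a \<times> 'a)"
  let ?a = "\<lambda>z :: real \<times> ('a \<times> 'a). \<theta> (snd z) * (cis (pi * (fst z * qf (snd z))) * h (snd z))"
  have "schwartz_family (\<lambda>s::real. 1 + norm s) (\<lambda>z. \<theta> (snd z))"
    by (rule smooth_in_mono[OF schwartz_family_const[OF \<theta>]]) (rule decay_weight_1)
  moreover have "moderate (\<lambda>z :: real \<times> ('a \<times> 'a). complex_of_real (fst z) * of_real (fst (snd z) \<bullet> snd (snd z)))"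
    by (intro sgrowth_mult weight_norm moderate_inner_comp moderate_real_linear bounded_linear_fst
        bounded_linear_compose[OF bounded_linear_fst] bounded_linear_compose[OF bounded_linear_snd] bounded_linear_snd)
  then have "moderate (\<lambda>z :: real \<times> ('a \<times> 'a). complex_of_real (fst z * qf (snd z)))" by (simp add: qf_def)
  then have "moderate (\<lambda>z :: real \<times> ('a \<times> 'a). cis (pi * (fst z * qf (snd z))) * h (snd z))"
    by (intro sgrowth_mult weight_norm sgrowth_cis moderate_comp_linear[OF h] bounded_linear_snd)
  then have "sgrowth (\<lambda>z. (1 + norm (snd z)) * (1 + norm (fst z)))
      (\<lambda>z :: real \<times> ('a \<times> 'a). cis (pi * (fst z * qf (snd z))) * h (snd z))"
    by (rule moderate_product_weight)
  ultimately have a: "schwartz_family (\<lambda>s::real. 1 + norm s) ?a"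
    by (intro sdecay_mult weight_norm)
  obtain C K where C: "0 \<le> C" "\<And>s \<eta>' x. (1 + norm x) ^ ?k * ((1 + norm \<eta>') ^ ?k *
      norm (ift (\<lambda>\<eta>. ?a (s, \<eta>) * b (\<eta>' - \<eta>)) x)) \<le> C * (1 + norm s) ^ K"
    using amplitude_decay[OF a weight_norm b, of ?k ?k] by blast
  define I where "I = integral\<^sup>L lborel (\<lambda>x::'a \<times> 'a. 1 / (1 + norm x) ^ ?k)"
  have I0: "0 \<le> I" unfolding I_def by (intro integral_nonneg_AE) auto
  let ?D = "C * (1 + \<bar>R\<bar>) ^ K"
  show "\<exists>C\<ge>0. \<forall>(\<omega> :: 'a \<times> 'a) \<eta>' s. \<bar>s\<bar> \<le> R \<longrightarrow> amp_norm b (\<lambda>\<eta>. cis (pi * s * qf \<eta>) * (1 * (h \<eta> * \<theta> \<eta>))) \<eta>' \<le>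
        ennreal (C * (1 + norm \<omega>) ^ 0 * (1 / (1 + norm \<eta>') ^ ?k))"
  proof (intro exI[of _ "?D * I"] conjI allI impI)
    show "0 \<le> ?D * I" using C(1) I0 by simp
    fix \<omega> \<eta>' :: "'a \<times> 'a" and s :: real assume s: "\<bar>s\<bar> \<le> R"
    have e: "cis (pi * s * qf \<eta>) * (1 * (h \<eta> * \<theta> \<eta>)) = ?a (s, \<eta>)" for \<eta> by (simp add: mult_ac)
    let ?E = "?D * (1 / (1 + norm \<eta>') ^ ?k)"
    have "norm (ift (\<lambda>\<eta>. ?a (s, \<eta>) * b (\<eta>' - \<eta>)) x) \<le> ?E * (1 / (1 + norm x) ^ ?k)" for x
    proof -
      have "C * (1 + norm s) ^ K \<le> ?D" using s C(1) by (intro mult_left_mono power_mono) auto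
      then have "(1 + norm \<eta>') ^ ?k * ((1 + norm x) ^ ?k * norm (ift (\<lambda>\<eta>. ?a (s, \<eta>) * b (\<eta>' - \<eta>)) x)) \<le> ?D"
        using order_trans[OF C(2)[of x \<eta>' s]] by (simp only: mult.left_commute[of "(1 + norm \<eta>') ^ ?k"])
      from decay_pointwise[OF decay_pointwise[OF this]] show ?thesis .
    qed
    then have "amp_norm b (\<lambda>\<eta>. ?a (s, \<eta>)) \<eta>' \<le> (\<integral>\<^sup>+x. ennreal (?E * (1 / (1 + norm (x :: 'a \<times> 'a)) ^ ?k)) \<partial>lborel)"
      unfolding amp_norm_def by (intro nn_integral_mono ennreal_leI)
    also have "\<dots> = ennreal (integral\<^sup>L lborel (\<lambda>x::'a \<times> 'a. ?E * (1 / (1 + norm x) ^ ?k)))"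
      using C(1) by (intro nn_integral_eq_integral integrable_mult_right integrable_decay) auto
    also have "integral\<^sup>L lborel (\<lambda>x::'a \<times> 'a. ?E * (1 / (1 + norm x) ^ ?k)) = ?E * I"
      unfolding I_def by (rule integral_mult_right_zero)
    finally show "amp_norm b (\<lambda>\<eta>. cis (pi * s * qf \<eta>) * (1 * (h \<eta> * \<theta> \<eta>))) \<eta>' \<le>
        ennreal (?D * I * (1 + norm \<omega>) ^ 0 * (1 / (1 + norm \<eta>') ^ ?k))"
      unfolding e by (simp add: mult_ac)
  qed
qed

lemma multiplier_moderate: "multiplier b \<theta> k F \<Longrightarrow> moderate (F \<omega>)"
  unfolding multiplier_def by blast

lemma multiplierE:
  assumes "multiplier b \<theta> k F" "moderate h"
  obtains C where "0 \<le> C" "\<And>\<omega> \<eta>' s. \<bar>s\<bar> \<le> R \<Longrightarrow> amp_norm b (\<lambda>\<eta>. cis (pi * s * qf \<eta>) * (F \<omega> \<eta> * (h \<eta> * \<theta> \<eta>))) \<eta>' \<le>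
        ennreal (C * (1 + norm \<omega>) ^ k * (1 / (1 + norm \<eta>') ^ (2 * DIM('a \<times> 'a))))"
  using assms unfolding multiplier_def by blast

lemma multiplierI:
  assumes "\<And>\<omega>. moderate (F \<omega>)"
    and "\<And>h R. moderate h \<Longrightarrow> \<exists>C\<ge>0. \<forall>\<omega> \<eta>' s. \<bar>s\<bar> \<le> R \<longrightarrow>
      amp_norm b (\<lambda>\<eta>. cis (pi * s * qf \<eta>) * (F \<omega> \<eta> * (h \<eta> * \<theta> \<eta>))) \<eta>' \<le>
        ennreal (C * (1 + norm \<omega>) ^ k * (1 / (1 + norm \<eta>') ^ (2 * DIM('a \<times> 'a))))"
  shows "multiplier b \<theta> k F"
  unfolding multiplier_def using assms by blast

text \<open>The factor \<open>m\<close> is absorbed by the arbitrary moderate function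
  \<open>h\<close> in the definition of a multiplier.\<close>

lemma multiplier_mult_moderate:
  assumes F: "multiplier b \<theta> k F" and m: "moderate m"
  shows "multiplier b \<theta> k (\<lambda>\<omega> \<eta>. m \<eta> * F \<omega> \<eta>)"
proof (rule multiplierI)
  show "moderate (\<lambda>\<eta>. m \<eta> * F \<omega> \<eta>)" for \<omega> by (intro sgrowth_mult weight_norm m multiplier_moderate[OF F])
  fix h R assume h: "moderate (h :: 'a \<times> 'a \<Rightarrow> complex)"
  obtain C where "0 \<le> C" "\<And>\<omega> \<eta>' s. \<bar>s\<bar> \<le> R \<Longrightarrow> amp_norm b (\<lambda>\<eta>. cis (pi * s * qf \<eta>) * (F \<omega> \<eta> * ((m \<eta> * h \<eta>) * \<theta> \<eta>))) \<eta>' \<le>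
        ennreal (C * (1 + norm \<omega>) ^ k * (1 / (1 + norm \<eta>') ^ (2 * DIM('a \<times> 'a))))"
    using multiplierE[OF F sgrowth_mult[OF weight_norm m h]] by blast
  moreover have "m \<eta> * F \<omega> \<eta> * (h \<eta> * \<theta> \<eta>) = F \<omega> \<eta> * ((m \<eta> * h \<eta>) * \<theta> \<eta>)" for \<omega> \<eta> by (simp only: mult_ac)
  ultimately show "\<exists>C\<ge>0. \<forall>\<omega> \<eta>' s. \<bar>s\<bar> \<le> R \<longrightarrow> amp_norm b (\<lambda>\<eta>. cis (pi * s * qf \<eta>) * (m \<eta> * F \<omega> \<eta> * (h \<eta> * \<theta> \<eta>))) \<eta>' \<le>
        ennreal (C * (1 + norm \<omega>) ^ k * (1 / (1 + norm \<eta>') ^ (2 * DIM('a \<times> 'a))))"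
    by (intro exI[of _ C] conjI allI impI) (simp_all only:)
qed

lemma multiplier_mult_frequency:
  assumes F: "multiplier b \<theta> k F" and c: "\<And>\<omega>. norm (c \<omega>) \<le> (1 + norm \<omega>) ^ j"
  shows "multiplier b \<theta> (k + j) (\<lambda>\<omega> \<eta>. c \<omega> * F \<omega> \<eta>)"
proof (rule multiplierI)
  show "moderate (\<lambda>\<eta>. c \<omega> * F \<omega> \<eta>)" for \<omega>
    by (intro sgrowth_mult sgrowth_const weight_norm multiplier_moderate[OF F])
  fix h R assume h: "moderate (h :: 'a \<times> 'a \<Rightarrow> complex)"
  obtain C where C: "0 \<le> C" "\<And>\<omega> \<eta>' s. \<bar>s\<bar> \<le> R \<Longrightarrow> amp_norm b (\<lambda>\<eta>. cis (pi * s * qf \<eta>) * (F \<omega> \<eta> * (h \<eta> * \<theta> \<eta>))) \<eta>' \<le>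
        ennreal (C * (1 + norm \<omega>) ^ k * (1 / (1 + norm \<eta>') ^ (2 * DIM('a \<times> 'a))))"
    using multiplierE[OF F h] by blast
  have [measurable]: "b \<in> borel_measurable borel" using b by (rule schwartz_measurable)
  show "\<exists>C\<ge>0. \<forall>\<omega> \<eta>' s. \<bar>s\<bar> \<le> R \<longrightarrow> amp_norm b (\<lambda>\<eta>. cis (pi * s * qf \<eta>) * (c \<omega> * F \<omega> \<eta> * (h \<eta> * \<theta> \<eta>))) \<eta>' \<le>
        ennreal (C * (1 + norm \<omega>) ^ (k + j) * (1 / (1 + norm \<eta>') ^ (2 * DIM('a \<times> 'a))))"
  proof (intro exI[of _ C] conjI allI impI C(1))
    fix \<omega> \<eta>' :: "'a \<times> 'a" and s :: real assume s: "\<bar>s\<bar> \<le> R"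
    let ?X = "C * (1 + norm \<omega>) ^ k * (1 / (1 + norm \<eta>') ^ (2 * DIM('a \<times> 'a)))"
    have "cis (pi * s * qf \<eta>) * (c \<omega> * F \<omega> \<eta> * (h \<eta> * \<theta> \<eta>)) = c \<omega> * (cis (pi * s * qf \<eta>) * (F \<omega> \<eta> * (h \<eta> * \<theta> \<eta>)))" for \<eta>
      by (simp only: mult_ac)
    then have "amp_norm b (\<lambda>\<eta>. cis (pi * s * qf \<eta>) * (c \<omega> * F \<omega> \<eta> * (h \<eta> * \<theta> \<eta>))) \<eta>' =
        ennreal (norm (c \<omega>)) * amp_norm b (\<lambda>\<eta>. cis (pi * s * qf \<eta>) * (F \<omega> \<eta> * (h \<eta> * \<theta> \<eta>))) \<eta>'"
      using amp_norm_scale[OF schwartz_measurable[OF multiplier_integrand[OF multiplier_moderate[OF F] h]]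
        schwartz_measurable[OF b]] by (simp only:)
    also have "\<dots> \<le> ennreal ((1 + norm \<omega>) ^ j) * ennreal ?X"
      by (intro mult_mono C s ennreal_leI c) auto
    also have "\<dots> = ennreal ((1 + norm \<omega>) ^ j * ?X)" using C(1) by (intro ennreal_mult[symmetric]) auto
    finally show "amp_norm b (\<lambda>\<eta>. cis (pi * s * qf \<eta>) * (c \<omega> * F \<omega> \<eta> * (h \<eta> * \<theta> \<eta>))) \<eta>' \<le>
        ennreal (C * (1 + norm \<omega>) ^ (k + j) * (1 / (1 + norm \<eta>') ^ (2 * DIM('a \<times> 'a))))"
      by (simp add: power_add mult_ac del: DIM_prod)
  qed
qed

lemma multiplier_mono: "multiplier b \<theta> k F \<Longrightarrow> k \<le> k' \<Longrightarrow> multiplier b \<theta> k' F"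
  using multiplier_mult_frequency[of k F "\<lambda>_. 1" "k' - k"] by (simp add: one_le_power)

lemma multiplier_add:
  assumes F: "multiplier b \<theta> k F" and G: "multiplier b \<theta> k G"
  shows "multiplier b \<theta> k (\<lambda>\<omega> \<eta>. F \<omega> \<eta> + G \<omega> \<eta>)"
proof (rule multiplierI)
  show "moderate (\<lambda>\<eta>. F \<omega> \<eta> + G \<omega> \<eta>)" for \<omega>
    by (intro sgrowth_add weight_norm multiplier_moderate[OF F] multiplier_moderate[OF G])
  fix h R assume h: "moderate (h :: 'a \<times> 'a \<Rightarrow> complex)"
  obtain C where C: "0 \<le> C" "\<And>\<omega> \<eta>' s. \<bar>s\<bar> \<le> R \<Longrightarrow> amp_norm b (\<lambda>\<eta>. cis (pi * s * qf \<eta>) * (F \<omega> \<eta> * (h \<eta> * \<theta> \<eta>))) \<eta>' \<le>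
        ennreal (C * (1 + norm \<omega>) ^ k * (1 / (1 + norm \<eta>') ^ (2 * DIM('a \<times> 'a))))"
    using multiplierE[OF F h] by blast
  obtain D where D: "0 \<le> D" "\<And>\<omega> \<eta>' s. \<bar>s\<bar> \<le> R \<Longrightarrow> amp_norm b (\<lambda>\<eta>. cis (pi * s * qf \<eta>) * (G \<omega> \<eta> * (h \<eta> * \<theta> \<eta>))) \<eta>' \<le>
        ennreal (D * (1 + norm \<omega>) ^ k * (1 / (1 + norm \<eta>') ^ (2 * DIM('a \<times> 'a))))"
    using multiplierE[OF G h] by blast
  show "\<exists>C\<ge>0. \<forall>\<omega> \<eta>' s. \<bar>s\<bar> \<le> R \<longrightarrow> amp_norm b (\<lambda>\<eta>. cis (pi * s * qf \<eta>) * ((F \<omega> \<eta> + G \<omega> \<eta>) * (h \<eta> * \<theta> \<eta>))) \<eta>' \<le>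
        ennreal (C * (1 + norm \<omega>) ^ k * (1 / (1 + norm \<eta>') ^ (2 * DIM('a \<times> 'a))))"
  proof (intro exI[of _ "C + D"] conjI allI impI)
    fix \<omega> \<eta>' :: "'a \<times> 'a" and s :: real assume s: "\<bar>s\<bar> \<le> R"
    let ?X = "\<lambda>C. C * (1 + norm \<omega>) ^ k * (1 / (1 + norm \<eta>') ^ (2 * DIM('a \<times> 'a)))"
    have "amp_norm b (\<lambda>\<eta>. cis (pi * s * qf \<eta>) * ((F \<omega> \<eta> + G \<omega> \<eta>) * (h \<eta> * \<theta> \<eta>))) \<eta>' \<le>
        amp_norm b (\<lambda>\<eta>. cis (pi * s * qf \<eta>) * (F \<omega> \<eta> * (h \<eta> * \<theta> \<eta>))) \<eta>' +
        amp_norm b (\<lambda>\<eta>. cis (pi * s * qf \<eta>) * (G \<omega> \<eta> * (h \<eta> * \<theta> \<eta>))) \<eta>'"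
      unfolding distrib_right distrib_left
      by (intro amp_norm_add multiplier_integrand multiplier_moderate[OF F] multiplier_moderate[OF G] h b)
    also have "\<dots> \<le> ennreal (?X C) + ennreal (?X D)" by (intro add_mono C D s)
    also have "\<dots> = ennreal (?X C + ?X D)" using C(1) D(1) by (intro ennreal_plus[symmetric]) auto
    also have "?X C + ?X D = ?X (C + D)" by (simp only: distrib_right)
    finally show "amp_norm b (\<lambda>\<eta>. cis (pi * s * qf \<eta>) * ((F \<omega> \<eta> + G \<omega> \<eta>) * (h \<eta> * \<theta> \<eta>))) \<eta>' \<le> ennreal (?X (C + D))" .
  qed (use C D in simp)
qed

text \<open>By \<open>amp_norm_chirp\<close> the translated chirp may be replaced by one centred at
  the origin, whose rate \<open>r\<close> adds to \<open>s\<close>. The definition is therefore used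
  with \<open>R + 1\<close>, and the constant serves all \<open>\<bar>r\<bar> \<le> 1\<close> at
  once, as averaging over \<open>r\<close> demands.\<close>

lemma multiplier_chirp_bound:
  assumes F: "multiplier b \<theta> k F" and h: "moderate h"
  obtains C where "0 \<le> C" "\<And>\<omega> \<eta>' s r. \<bar>s\<bar> \<le> R \<Longrightarrow> \<bar>r\<bar> \<le> 1 \<Longrightarrow>
     amp_norm b (\<lambda>\<eta>. cis (pi * r * qf (\<eta> - \<omega>)) * (cis (pi * s * qf \<eta>) * (F \<omega> \<eta> * (h \<eta> * \<theta> \<eta>)))) \<eta>' \<le>
        ennreal (C * (1 + norm \<omega>) ^ k * (1 / (1 + norm \<eta>') ^ (2 * DIM('a \<times> 'a))))"
proof -
  obtain C where C: "0 \<le> C" "\<And>\<omega> \<eta>' s. \<bar>s\<bar> \<le> R + 1 \<Longrightarrow> amp_norm b (\<lambda>\<eta>. cis (pi * s * qf \<eta>) * (F \<omega> \<eta> * (h \<eta> * \<theta> \<eta>))) \<eta>' \<le>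
        ennreal (C * (1 + norm \<omega>) ^ k * (1 / (1 + norm \<eta>') ^ (2 * DIM('a \<times> 'a))))"
    using multiplierE[OF F h] by blast
  show ?thesis
  proof (rule that[OF C(1)])
    fix \<omega> \<eta>' :: "'a \<times> 'a" and s r :: real assume s: "\<bar>s\<bar> \<le> R" and r: "\<bar>r\<bar> \<le> 1"
    have "cis (pi * r * qf \<eta>) * (cis (pi * s * qf \<eta>) * (F \<omega> \<eta> * (h \<eta> * \<theta> \<eta>))) =
        cis (pi * (r + s) * qf \<eta>) * (F \<omega> \<eta> * (h \<eta> * \<theta> \<eta>))" for \<eta>
      by (simp only: mult.assoc[symmetric] cis_mult) (simp only: distrib_left distrib_right)
    then have "amp_norm b (\<lambda>\<eta>. cis (pi * r * qf (\<eta> - \<omega>)) * (cis (pi * s * qf \<eta>) * (F \<omega> \<eta> * (h \<eta> * \<theta> \<eta>)))) \<eta>' =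
        amp_norm b (\<lambda>\<eta>. cis (pi * (r + s) * qf \<eta>) * (F \<omega> \<eta> * (h \<eta> * \<theta> \<eta>))) \<eta>'"
      using amp_norm_chirp[OF schwartz_measurable[OF multiplier_integrand[OF multiplier_moderate[OF F] h]]
        schwartz_measurable[OF b]] by (simp only:)
    also have "\<dots> \<le> ennreal (C * (1 + norm \<omega>) ^ k * (1 / (1 + norm \<eta>') ^ (2 * DIM('a \<times> 'a))))"
      using s r by (intro C) linarith
    finally show "amp_norm b (\<lambda>\<eta>. cis (pi * r * qf (\<eta> - \<omega>)) * (cis (pi * s * qf \<eta>) * (F \<omega> \<eta> * (h \<eta> * \<theta> \<eta>)))) \<eta>' \<le> \<dots>" .
  qed
qed

lemma multiplier_chirp:
  assumes F: "multiplier b \<theta> k F" and r: "\<bar>r\<bar> \<le> 1"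
  shows "multiplier b \<theta> k (\<lambda>\<omega> \<eta>. cis (pi * r * qf (\<eta> - \<omega>)) * F \<omega> \<eta>)"
proof (rule multiplierI)
  show "moderate (\<lambda>\<eta>. cis (pi * r * qf (\<eta> - \<omega>)) * F \<omega> \<eta>)" for \<omega>
    by (intro sgrowth_mult sgrowth_cis weight_norm moderate_qf_diff multiplier_moderate[OF F])
  fix h R assume h: "moderate (h :: 'a \<times> 'a \<Rightarrow> complex)"
  obtain C where "0 \<le> C" "\<And>\<omega> \<eta>' s r. \<bar>s\<bar> \<le> R \<Longrightarrow> \<bar>r\<bar> \<le> 1 \<Longrightarrow>
     amp_norm b (\<lambda>\<eta>. cis (pi * r * qf (\<eta> - \<omega>)) * (cis (pi * s * qf \<eta>) * (F \<omega> \<eta> * (h \<eta> * \<theta> \<eta>)))) \<eta>' \<le>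
        ennreal (C * (1 + norm \<omega>) ^ k * (1 / (1 + norm \<eta>') ^ (2 * DIM('a \<times> 'a))))"
    using multiplier_chirp_bound[OF F h] by blast
  moreover have "cis (pi * s * qf \<eta>) * (cis (pi * r * qf (\<eta> - \<omega>)) * F \<omega> \<eta> * (h \<eta> * \<theta> \<eta>)) =
      cis (pi * r * qf (\<eta> - \<omega>)) * (cis (pi * s * qf \<eta>) * (F \<omega> \<eta> * (h \<eta> * \<theta> \<eta>)))" for s \<omega> \<eta> by (simp only: mult_ac)
  ultimately show "\<exists>C\<ge>0. \<forall>\<omega> \<eta>' s. \<bar>s\<bar> \<le> R \<longrightarrow>
      amp_norm b (\<lambda>\<eta>. cis (pi * s * qf \<eta>) * (cis (pi * r * qf (\<eta> - \<omega>)) * F \<omega> \<eta> * (h \<eta> * \<theta> \<eta>))) \<eta>' \<le>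
        ennreal (C * (1 + norm \<omega>) ^ k * (1 / (1 + norm \<eta>') ^ (2 * DIM('a \<times> 'a))))"
    using r by (intro exI[of _ C] conjI allI impI) (simp_all only:)
qed

lemma multiplier_nsinc:
  assumes F: "multiplier b \<theta> k F"
  shows "multiplier b \<theta> k (\<lambda>\<omega> \<eta>. complex_of_real (nsinc (qf (\<eta> - \<omega>))) * F \<omega> \<eta>)"
proof (rule multiplierI)
  show "moderate (\<lambda>\<eta>. complex_of_real (nsinc (qf (\<eta> - \<omega>))) * F \<omega> \<eta>)" for \<omega>
    by (intro sgrowth_mult moderate_nsinc weight_norm moderate_qf_diff multiplier_moderate[OF F])
  fix h R assume h: "moderate (h :: 'a \<times> 'a \<Rightarrow> complex)"
  let ?G = "\<lambda>\<omega> s \<eta>. cis (pi * s * qf \<eta>) * (F \<omega> \<eta> * (h \<eta> * \<theta> \<eta>))"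
  obtain C where C: "0 \<le> C" "\<And>\<omega> \<eta>' s r. \<bar>s\<bar> \<le> R \<Longrightarrow> \<bar>r\<bar> \<le> 1 \<Longrightarrow>
     amp_norm b (\<lambda>\<eta>. cis (pi * r * qf (\<eta> - \<omega>)) * ?G \<omega> s \<eta>) \<eta>' \<le>
        ennreal (C * (1 + norm \<omega>) ^ k * (1 / (1 + norm \<eta>') ^ (2 * DIM('a \<times> 'a))))"
    using multiplier_chirp_bound[OF F h, of R] by blast
  show "\<exists>C\<ge>0. \<forall>\<omega> \<eta>' s. \<bar>s\<bar> \<le> R \<longrightarrow>
      amp_norm b (\<lambda>\<eta>. cis (pi * s * qf \<eta>) * (complex_of_real (nsinc (qf (\<eta> - \<omega>))) * F \<omega> \<eta> * (h \<eta> * \<theta> \<eta>))) \<eta>' \<le>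
        ennreal (C * (1 + norm \<omega>) ^ k * (1 / (1 + norm \<eta>') ^ (2 * DIM('a \<times> 'a))))"
  proof (intro exI[of _ C] conjI allI impI C(1))
    fix \<omega> \<eta>' :: "'a \<times> 'a" and s :: real assume s: "\<bar>s\<bar> \<le> R"
    let ?X = "ennreal (C * (1 + norm \<omega>) ^ k * (1 / (1 + norm \<eta>') ^ (2 * DIM('a \<times> 'a))))"
    interpret U: prob_space U by (rule prob_space_U)
    have "cis (pi * s * qf \<eta>) * (complex_of_real (nsinc (qf (\<eta> - \<omega>))) * F \<omega> \<eta> * (h \<eta> * \<theta> \<eta>)) =
        complex_of_real (nsinc (qf (\<eta> - \<omega>))) * ?G \<omega> s \<eta>" for \<eta> by (simp only: mult_ac)
    then have "amp_norm b (\<lambda>\<eta>. cis (pi * s * qf \<eta>) * (complex_of_real (nsinc (qf (\<eta> - \<omega>))) * F \<omega> \<eta> * (h \<eta> * \<theta> \<eta>))) \<eta>' =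
        amp_norm b (\<lambda>\<eta>. complex_of_real (nsinc (qf (\<eta> - \<omega>))) * ?G \<omega> s \<eta>) \<eta>'" by (simp only:)
    also have "\<dots> \<le> (\<integral>\<^sup>+r. amp_norm b (\<lambda>\<eta>. cis (pi * r * qf (\<eta> - \<omega>)) * ?G \<omega> s \<eta>) \<eta>' \<partial>U)"
      by (rule amp_norm_average[OF multiplier_integrand[OF multiplier_moderate[OF F] h] b]) measurable
    also have "\<dots> \<le> (\<integral>\<^sup>+r. ?X \<partial>U)"
    proof (rule nn_integral_mono_AE)
      show "AE r in U. amp_norm b (\<lambda>\<eta>. cis (pi * r * qf (\<eta> - \<omega>)) * ?G \<omega> s \<eta>) \<eta>' \<le> ?X"
        using AE_U by eventually_elim (rule C(2)[OF s])
    qed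
    also have "\<dots> = ?X" by (simp only: nn_integral_const U.emeasure_space_1 mult_1_right)
    finally show "amp_norm b (\<lambda>\<eta>. cis (pi * s * qf \<eta>) * (complex_of_real (nsinc (qf (\<eta> - \<omega>))) * F \<omega> \<eta> * (h \<eta> * \<theta> \<eta>))) \<eta>' \<le> ?X" .
  qed
qed

lemma multiplier_sum:
  assumes "finite S" "\<And>i. i \<in> S \<Longrightarrow> multiplier b \<theta> k (F i)" "S \<noteq> {}"
  shows "multiplier b \<theta> k (\<lambda>\<omega> \<eta>. \<Sum>i\<in>S. F i \<omega> \<eta>)"
  using assms(1,3,2) by (induction S rule: finite_ne_induct) (auto intro: multiplier_add)

lemma multiplier_scale:
  assumes "multiplier b \<theta> k F" shows "multiplier b \<theta> k (\<lambda>\<omega> \<eta>. c * F \<omega> \<eta>)"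
  by (rule multiplier_mult_moderate[OF assms sgrowth_const[OF weight_norm]])

lemma multiplier_sin:
  assumes F: "multiplier b \<theta> k F"
  shows "multiplier b \<theta> k (\<lambda>\<omega> \<eta>. complex_of_real (sin (pi * qf (\<eta> - \<omega>)) / pi) * F \<omega> \<eta>)"
proof -
  let ?c = "1 / (2 * \<i> * of_real pi)"
  have "multiplier b \<theta> k (\<lambda>\<omega> \<eta>. ?c * (cis (pi * 1 * qf (\<eta> - \<omega>)) * F \<omega> \<eta>) + (- ?c) * (cis (pi * (-1) * qf (\<eta> - \<omega>)) * F \<omega> \<eta>))"
    by (intro multiplier_add multiplier_scale multiplier_chirp F) auto
  moreover have "?c * (cis (pi * 1 * t) * z) + (- ?c) * (cis (pi * (-1) * t) * z) = complex_of_real (sin (pi * t) / pi) * z" for t z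
  proof -
    have "?c * (cis (pi * 1 * t) * z) + (- ?c) * (cis (pi * (-1) * t) * z) = ?c * (cis (pi * t) - cis (- (pi * t))) * z"
    proof -
      have "c * (x * z) + (- c) * (y * z) = c * (x - y) * z" for c x y :: complex by (simp add: algebra_simps)
      moreover have "pi * 1 * t = pi * t" "pi * (-1) * t = - (pi * t)" by simp_all
      ultimately show ?thesis by (simp only:)
    qed
    also have "cis (pi * t) - cis (- (pi * t)) = 2 * \<i> * of_real (sin (pi * t))" by (simp add: complex_eq_iff)
    finally show ?thesis by simp
  qed
  ultimately show ?thesis by (simp only:)
qed

lemma abs_qf_le: "\<bar>qf \<omega>\<bar> \<le> (1 + norm \<omega>)\<^sup>2"
proof -
  have "\<bar>qf \<omega>\<bar> \<le> norm (fst \<omega>) * norm (snd \<omega>)" unfolding qf_def by (rule Cauchy_Schwarz_ineq2)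
  also have "\<dots> \<le> norm \<omega> * norm \<omega>"
    using norm_fst_le[of "fst \<omega>" "snd \<omega>"] norm_snd_le[of "snd \<omega>" "fst \<omega>"] by (intro mult_mono) auto
  also have "\<dots> \<le> (1 + norm \<omega>)\<^sup>2" unfolding power2_eq_square by (intro mult_mono) auto
  finally show ?thesis .
qed

lemma multiplier_qf:
  "multiplier b \<theta> k F \<Longrightarrow> multiplier b \<theta> (k + 2) (\<lambda>\<omega> \<eta>. complex_of_real (qf \<omega>) * F \<omega> \<eta>)"
  by (erule multiplier_mult_frequency) (simp only: norm_of_real abs_qf_le)

text \<open>By \<open>qf_diff\<close> the remainder is
  \<open>qf \<eta> - \<eta> \<bullet> prod.swap \<omega>\<close>. Expanding the inner product in
  coordinates separates the variables: each term is a moderate function of \<open>\<eta>\<close>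
  times a coefficient bounded by \<open>1 + norm \<omega>\<close>.\<close>

lemma multiplier_remainder:
  assumes F: "multiplier b \<theta> k F"
  shows "multiplier b \<theta> (k + 1) (\<lambda>\<omega> \<eta>. complex_of_real (qf (\<eta> - \<omega>) - qf \<omega>) * F \<omega> \<eta>)"
proof -
  have "multiplier b \<theta> (k + 1) (\<lambda>\<omega> \<eta>. complex_of_real (qf \<eta>) * F \<omega> \<eta> +
      (\<Sum>c\<in>Basis. complex_of_real (\<eta> \<bullet> c) * (complex_of_real (- (prod.swap \<omega> \<bullet> c)) * F \<omega> \<eta>)))"
  proof (intro multiplier_add multiplier_sum multiplier_mult_moderate[OF multiplier_mono[OF F]]
      multiplier_mult_moderate multiplier_mult_frequency[OF F] moderate_qf moderate_inner)
    fix c \<omega> :: "'a \<times> 'a" assume "c \<in> Basis"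
    have "\<bar>prod.swap \<omega> \<bullet> c\<bar> \<le> norm (prod.swap \<omega>)" using \<open>c \<in> Basis\<close> by (rule Basis_le_norm)
    also have "norm (prod.swap \<omega>) = norm \<omega>" by (cases \<omega>) (simp add: norm_Pair add.commute)
    finally show "norm (complex_of_real (- (prod.swap \<omega> \<bullet> c))) \<le> (1 + norm \<omega>) ^ 1" by simp
  qed auto
  moreover have "complex_of_real (qf \<eta>) * z + (\<Sum>c\<in>Basis. complex_of_real (\<eta> \<bullet> c) * (complex_of_real (- (prod.swap \<omega> \<bullet> c)) * z)) =
      complex_of_real (qf (\<eta> - \<omega>) - qf \<omega>) * z" for \<omega> \<eta> :: "'a \<times> 'a" and z
  proof -
    have "(\<Sum>c\<in>Basis. complex_of_real (\<eta> \<bullet> c) * (complex_of_real (- (prod.swap \<omega> \<bullet> c)) * z)) = - (complex_of_real (\<eta> \<bullet> prod.swap \<omega>) * z)"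
      by (subst (2) euclidean_inner) (simp add: sum_distrib_right sum_negf mult.assoc)
    then show ?thesis by (simp add: qf_diff algebra_simps)
  qed
  ultimately show ?thesis by (simp only:)
qed

text \<open>
  Write \<open>t = (\<eta> - \<omega>)\<^sub>1 \<cdot> (\<eta> - \<omega>)\<^sub>2\<close>, \<open>L = \<omega>\<^sub>1 \<cdot> \<omega>\<^sub>2\<close> and \<open>\<rho> = t - L\<close>, which is only linear in \<open>\<omega>\<close>. Since
  \<open>t sinc t = sin (\<pi> t) / \<pi>\<close>, one has \<open>L\<^sup>2 sinc t = (L - \<rho>) sin (\<pi> t) / \<pi> + \<rho>\<^sup>2 sinc t\<close>. The right hand
  side is of order 2 in \<open>\<omega>\<close> while \<open>L\<^sup>2\<close> is of order 4: this is the gain of two powers for each factor.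
\<close>

lemma multiplier_qf_nsinc:
  assumes F: "multiplier b \<theta> k F"
  shows "multiplier b \<theta> (k + 2) (\<lambda>\<omega> \<eta>. complex_of_real ((qf \<omega>)\<^sup>2 * nsinc (qf (\<eta> - \<omega>))) * F \<omega> \<eta>)"
proof -
  let ?s = "\<lambda>\<omega> \<eta>. complex_of_real (sin (pi * qf (\<eta> - \<omega>)) / pi) * F \<omega> \<eta>"
  let ?\<rho> = "\<lambda>\<omega> \<eta>. complex_of_real (qf (\<eta> - \<omega>) - qf \<omega>)"
  have "multiplier b \<theta> (k + 2) (\<lambda>\<omega> \<eta>. complex_of_real (qf \<omega>) * ?s \<omega> \<eta> + (-1) * (?\<rho> \<omega> \<eta> * ?s \<omega> \<eta>) +
      ?\<rho> \<omega> \<eta> * (?\<rho> \<omega> \<eta> * (complex_of_real (nsinc (qf (\<eta> - \<omega>))) * F \<omega> \<eta>)))"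
  proof (intro multiplier_add)
    show "multiplier b \<theta> (k + 2) (\<lambda>\<omega> \<eta>. complex_of_real (qf \<omega>) * ?s \<omega> \<eta>)"
      by (intro multiplier_qf multiplier_sin F)
    show "multiplier b \<theta> (k + 2) (\<lambda>\<omega> \<eta>. (-1) * (?\<rho> \<omega> \<eta> * ?s \<omega> \<eta>))"
      by (rule multiplier_scale[OF multiplier_mono[OF multiplier_remainder[OF multiplier_sin[OF F]]]]) simp
    show "multiplier b \<theta> (k + 2) (\<lambda>\<omega> \<eta>. ?\<rho> \<omega> \<eta> * (?\<rho> \<omega> \<eta> * (complex_of_real (nsinc (qf (\<eta> - \<omega>))) * F \<omega> \<eta>)))"
      using multiplier_remainder[OF multiplier_remainder[OF multiplier_nsinc[OF F]]] by (simp add: numeral_2_eq_2)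
  qed
  moreover have "complex_of_real L * (complex_of_real (sin (pi * t) / pi) * z) +
      (-1) * (complex_of_real (t - L) * (complex_of_real (sin (pi * t) / pi) * z)) +
      complex_of_real (t - L) * (complex_of_real (t - L) * (complex_of_real (nsinc t) * z)) =
      complex_of_real (L\<^sup>2 * nsinc t) * z" for L t :: real and z :: complex
  proof -
    have "sin (pi * t) / pi = t * nsinc t" by (simp add: nsinc_def)
    then show ?thesis by (simp add: power2_eq_square algebra_simps)
  qed
  ultimately show ?thesis by (simp only:)
qed

lemma multiplier_nsinc_power: "multiplier b \<theta> 0 (\<lambda>\<omega> \<eta>. complex_of_real (nsinc (qf (\<eta> - \<omega>)) ^ n))"
proof (induction n)
  case (Suc n)
  from multiplier_nsinc[OF Suc] show ?case by simp
qed (simp add: multiplier_one)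

lemma multiplier_qf_nsinc_power:
  "multiplier b \<theta> (2 * n) (\<lambda>\<omega> \<eta>. complex_of_real (qf \<omega> ^ (2 * n) * nsinc (qf (\<eta> - \<omega>)) ^ n))"
proof (induction n)
  case (Suc n)
  from multiplier_qf_nsinc[OF Suc] show ?case by (simp add: power2_eq_square mult_ac)
qed (simp add: multiplier_one)

lemma multiplier_bound:
  assumes F: "multiplier b \<theta> k F"
  obtains C where "0 \<le> C" "\<And>\<omega> \<eta>'. amp_norm b (\<lambda>\<eta>. F \<omega> \<eta> * \<theta> \<eta>) \<eta>' \<le>
        ennreal (C * (1 + norm \<omega>) ^ k * (1 / (1 + norm \<eta>') ^ (2 * DIM('a \<times> 'a))))"
proof -
  obtain C where "0 \<le> C" "\<And>\<omega> \<eta>' s. \<bar>s\<bar> \<le> 0 \<Longrightarrow> amp_norm b (\<lambda>\<eta>. cis (pi * s * qf \<eta>) * (F \<omega> \<eta> * (1 * \<theta> \<eta>))) \<eta>' \<le>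
        ennreal (C * (1 + norm \<omega>) ^ k * (1 / (1 + norm \<eta>') ^ (2 * DIM('a \<times> 'a))))"
    using multiplierE[OF F sgrowth_const[OF weight_norm]] by blast
  from this(1) this(2)[of 0] show ?thesis by (intro that[of C]) simp_all
qed

end

section \<open>Convolution with an integrable kernel on Lebesgue spaces\<close>

text \<open>For positive \<open>v\<close> this is convexity on the open half line. At the boundary
  point \<open>v = 0\<close> the tangent has the value \<open>(1 - r) * m powr r\<close>, which is
  not positive.\<close>

lemma powr_above_tangent:
  fixes m v r :: real
  assumes "1 \<le> r" "0 < m" "0 \<le> v"
  shows "m powr r + r * m powr (r - 1) * (v - m) \<le> v powr r"
proof (cases "v = 0")
  case True
  have "m powr (r - 1) * m = m powr r" using assms powr_mult_base[of m "r - 1"] by (simp add: mult.commute)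
  then have "m powr r + r * m powr (r - 1) * (v - m) = (1 - r) * m powr r" using True by (simp add: algebra_simps)
  also have "\<dots> \<le> 0" using assms by (intro mult_nonpos_nonneg) auto
  finally show ?thesis using True by simp
next
  case False
  have "v powr r - m powr r \<ge> (r * m powr (r - 1)) * (v - m)"
  proof (rule convex_on_imp_above_tangent[OF powr_convex[OF assms(1)]])
    show "((\<lambda>x. x powr r) has_real_derivative r * m powr (r - 1)) (at m within {0<..})"
      using assms by (auto intro!: derivative_eq_intros)
  qed (use assms False in \<open>auto simp: interior_open\<close>)
  then show ?thesis by simp
qed

text \<open>Jensen's inequality for the measure \<open>\<kappa>(x) dx\<close>, obtained by integrating the tangent line at the mean.\<close>

lemma powr_integral_le:
  fixes v \<kappa> :: "'a \<Rightarrow> real"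
  assumes r: "1 \<le> r" and \<kappa>: "integrable M \<kappa>" "\<And>x. 0 \<le> \<kappa> x" "0 < (\<integral>x. \<kappa> x \<partial>M)"
    and v: "\<And>x. 0 \<le> v x" "v \<in> borel_measurable M" and i: "integrable M (\<lambda>x. \<kappa> x * v x powr r)"
  shows "integrable M (\<lambda>x. \<kappa> x * v x)"
    and "(\<integral>x. \<kappa> x * v x \<partial>M) powr r \<le> (\<integral>x. \<kappa> x \<partial>M) powr (r - 1) * (\<integral>x. \<kappa> x * v x powr r \<partial>M)"
proof -
  let ?K = "\<integral>x. \<kappa> x \<partial>M"
  have [measurable]: "\<kappa> \<in> borel_measurable M" "v \<in> borel_measurable M" using \<kappa> v by auto
  show i1: "integrable M (\<lambda>x. \<kappa> x * v x)"
  proof (rule Bochner_Integration.integrable_bound[where f = "\<lambda>x. \<kappa> x + \<kappa> x * v x powr r"])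
    show "integrable M (\<lambda>x. \<kappa> x + \<kappa> x * v x powr r)" using \<kappa> i by simp
    have "\<kappa> x * v x \<le> \<kappa> x + \<kappa> x * v x powr r" for x
    proof -
      have "v x \<le> 1 + v x powr r"
      proof (cases "v x \<le> 1")
        case True
        then show ?thesis by (simp add: add_increasing2)
      next
        case False
        then have "1 * (v x - 1) \<le> r * (v x - 1)" using r by (intro mult_right_mono) auto
        then show ?thesis using powr_above_tangent[OF r, of 1 "v x"] v(1)[of x] by simp
      qed
      from mult_left_mono[OF this \<kappa>(2)] show ?thesis by (simp add: distrib_left)
    qed
    then show "AE x in M. norm (\<kappa> x * v x) \<le> norm (\<kappa> x + \<kappa> x * v x powr r)"
      using \<kappa>(2) v(1) by (intro AE_I2) simp
  qed simp
  define m where "m = (\<integral>x. \<kappa> x * v x \<partial>M) / ?K"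
  have m0: "0 \<le> m" unfolding m_def using \<kappa> v by (auto intro!: divide_nonneg_nonneg integral_nonneg_AE)
  have mK: "(\<integral>x. \<kappa> x * v x \<partial>M) = ?K * m" using \<kappa>(3) by (simp add: m_def)
  have "?K * m powr r \<le> (\<integral>x. \<kappa> x * v x powr r \<partial>M)"
  proof (cases "m = 0")
    case True
    then show ?thesis using \<kappa> by (auto intro!: integral_nonneg_AE)
  next
    case False
    let ?s = "r * m powr (r - 1)"
    have "?K * m powr r = (\<integral>x. m powr r * \<kappa> x + ?s * (\<kappa> x * v x - m * \<kappa> x) \<partial>M)"
      using \<kappa> i1 by (simp add: mK mult.commute)
    also have "\<dots> \<le> (\<integral>x. \<kappa> x * v x powr r \<partial>M)"
    proof (rule integral_mono[OF _ i])
      show "integrable M (\<lambda>x. m powr r * \<kappa> x + ?s * (\<kappa> x * v x - m * \<kappa> x))" using \<kappa> i1 by simp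
      fix x
      from mult_left_mono[OF powr_above_tangent[OF r, of m "v x"] \<kappa>(2)[of x]] v(1)[of x] m0 False
      show "m powr r * \<kappa> x + ?s * (\<kappa> x * v x - m * \<kappa> x) \<le> \<kappa> x * v x powr r" by (simp add: algebra_simps)
    qed
    finally show ?thesis .
  qed
  \<comment> \<open>The measure has mass \<open>?K\<close> rather than 1 and the integral of
    \<open>v\<close> is \<open>?K * m\<close>. The factor \<open>?K powr (r - 1)\<close> completes
    \<open>?K * m powr r\<close> to its power of order \<open>r\<close>.\<close>
  then have "?K powr (r - 1) * (?K * m powr r) \<le> ?K powr (r - 1) * (\<integral>x. \<kappa> x * v x powr r \<partial>M)"
    by (rule mult_left_mono) simp
  moreover have "?K powr (r - 1) * (?K * m powr r) = (?K * m) powr r"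
    using \<kappa>(3) m0 powr_mult_base[of ?K "r - 1"] by (simp add: powr_mult mult_ac)
  ultimately show "(\<integral>x. \<kappa> x * v x \<partial>M) powr r \<le> ?K powr (r - 1) * (\<integral>x. \<kappa> x * v x powr r \<partial>M)"
    unfolding mK by simp
qed

section \<open>From Jensen's inequality to Young's inequality\<close>

lemma epowr_measurable [measurable]:
  assumes [measurable]: "f \<in> borel_measurable M"
  shows "(\<lambda>x. epowr (f x) r) \<in> borel_measurable M"
  unfolding epowr_def by measurable

lemma epowr_mono: "x \<le> y \<Longrightarrow> 0 \<le> r \<Longrightarrow> epowr x r \<le> epowr y r"
  unfolding epowr_def by (auto simp: top_unique less_top enn2real_mono intro!: ennreal_leI powr_mono2)

lemma epowr_less_top: "epowr x r < \<top> \<longleftrightarrow> x < \<top>"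
  by (auto simp: epowr_def less_top)

lemma epowr_ennreal: "0 \<le> a \<Longrightarrow> epowr (ennreal a) r = ennreal (a powr r)"
  by (simp add: epowr_def)

text \<open>If the integral on the right is infinite, its positive prefactor makes the bound
  trivial. Otherwise \<open>v\<close> is finite almost everywhere, since \<open>\<kappa>\<close>
  vanishes nowhere, and the real-valued inequality applies.\<close>

lemma epowr_nn_integral_le:
  fixes v :: "'a \<Rightarrow> ennreal" and \<kappa> :: "'a \<Rightarrow> real"
  assumes r: "1 \<le> r" and \<kappa>: "integrable M \<kappa>" "\<And>x. 0 < \<kappa> x" "0 < (\<integral>x. \<kappa> x \<partial>M)"
    and [measurable]: "v \<in> borel_measurable M"
  shows "epowr (\<integral>\<^sup>+x. ennreal (\<kappa> x) * v x \<partial>M) r \<le>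
      ennreal ((\<integral>x. \<kappa> x \<partial>M) powr (r - 1)) * (\<integral>\<^sup>+x. ennreal (\<kappa> x) * epowr (v x) r \<partial>M)"
proof (cases "(\<integral>\<^sup>+x. ennreal (\<kappa> x) * epowr (v x) r \<partial>M) = \<infinity>")
  case True
  then show ?thesis using \<kappa>(3) by (simp add: ennreal_mult_top)
next
  case False
  have [measurable]: "\<kappa> \<in> borel_measurable M" using \<kappa>(1) by simp
  have "AE x in M. ennreal (\<kappa> x) * epowr (v x) r \<noteq> \<infinity>"
    using False by (intro nn_integral_PInf_AE) auto
  then have fin: "AE x in M. v x = ennreal (enn2real (v x))"
  proof (rule eventually_mono)
    fix x assume "ennreal (\<kappa> x) * epowr (v x) r \<noteq> \<infinity>"
    then have "v x < \<infinity>" using \<kappa>(2)[of x]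
      by (cases "v x = \<infinity>") (auto simp: epowr_def ennreal_mult_eq_top_iff less_top)
    then show "v x = ennreal (enn2real (v x))" by (simp add: less_top)
  qed
  define w where "w x = enn2real (v x)" for x
  have [measurable]: "w \<in> borel_measurable M" unfolding w_def[abs_def] by measurable
  have e1: "(\<integral>\<^sup>+x. ennreal (\<kappa> x) * epowr (v x) r \<partial>M) = (\<integral>\<^sup>+x. ennreal (\<kappa> x * w x powr r) \<partial>M)"
  proof (rule nn_integral_cong_AE)
    show "AE x in M. ennreal (\<kappa> x) * epowr (v x) r = ennreal (\<kappa> x * w x powr r)"
      using fin
    proof eventually_elim
      case (elim x)
      then have "epowr (v x) r = ennreal (w x powr r)" unfolding w_def by (metis enn2real_nonneg epowr_ennreal)
      then show ?case using \<kappa>(2)[of x] by (simp add: ennreal_mult)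
    qed
  qed
  have e2: "(\<integral>\<^sup>+x. ennreal (\<kappa> x) * v x \<partial>M) = (\<integral>\<^sup>+x. ennreal (\<kappa> x * w x) \<partial>M)"
  proof (rule nn_integral_cong_AE)
    show "AE x in M. ennreal (\<kappa> x) * v x = ennreal (\<kappa> x * w x)"
      using fin
    proof eventually_elim
      case (elim x)
      then have "v x = ennreal (w x)" by (simp add: w_def)
      then show ?case using \<kappa>(2)[of x] by (simp add: ennreal_mult less_imp_le w_def)
    qed
  qed
  have \<kappa>0: "0 \<le> \<kappa> x" for x using \<kappa>(2)[of x] by simp
  have w0: "0 \<le> w x" for x by (simp add: w_def)
  have i: "integrable M (\<lambda>x. \<kappa> x * w x powr r)"
    using False \<kappa>0 unfolding e1 by (intro integrableI_bounded) (auto simp: less_top)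
  note J = powr_integral_le[OF r \<kappa>(1) \<kappa>0 \<kappa>(3) w0 _ i]
  have "epowr (\<integral>\<^sup>+x. ennreal (\<kappa> x * w x) \<partial>M) r = ennreal ((\<integral>x. \<kappa> x * w x \<partial>M) powr r)"
    using J(1) \<kappa>0 w0 by (subst nn_integral_eq_integral) (auto intro!: epowr_ennreal integral_nonneg_AE)
  also have "\<dots> \<le> ennreal ((\<integral>x. \<kappa> x \<partial>M) powr (r - 1) * (\<integral>x. \<kappa> x * w x powr r \<partial>M))"
    by (intro ennreal_leI J(2)) simp
  also have "\<dots> = ennreal ((\<integral>x. \<kappa> x \<partial>M) powr (r - 1)) * (\<integral>\<^sup>+x. ennreal (\<kappa> x * w x powr r) \<partial>M)"
    using i \<kappa>0 by (subst nn_integral_eq_integral) (auto intro!: ennreal_mult integral_nonneg_AE)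
  finally show ?thesis unfolding e1 e2 .
qed

text \<open>Young's inequality as far as finiteness is concerned. For finite \<open>q\<close>,
  Jensen's inequality at each \<open>\<omega>\<close> is followed by Tonelli and translation
  invariance. For \<open>q = \<infinity>\<close>, the reflection
  \<open>\<eta> \<mapsto> \<omega> - \<eta>\<close> preserves null sets, so the essential bound of
  \<open>u\<close> holds under the integral.\<close>

lemma Lp_enorm_convolution_finite:
  fixes u :: "'a::euclidean_space \<Rightarrow> ennreal" and \<kappa> :: "'a \<Rightarrow> real"
  assumes q: "1 \<le> q" and \<kappa>: "integrable lborel \<kappa>" "\<And>x. 0 < \<kappa> x" "0 < (\<integral>x. \<kappa> x \<partial>lborel)"
    and u [measurable]: "u \<in> borel_measurable borel" and fin: "Lp_enorm q lborel u < \<infinity>"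
  shows "Lp_enorm q lborel (\<lambda>\<omega>. \<integral>\<^sup>+\<eta>. ennreal (\<kappa> \<eta>) * u (\<omega> - \<eta>) \<partial>lborel) < \<infinity>"
proof -
  have \<kappa>m [measurable]: "\<kappa> \<in> borel_measurable borel" using \<kappa>(1) by simp
  have \<kappa>0: "0 \<le> \<kappa> x" for x using \<kappa>(2)[of x] by simp
  let ?I = "\<lambda>\<omega>. \<integral>\<^sup>+\<eta>. ennreal (\<kappa> \<eta>) * u (\<omega> - \<eta>) \<partial>lborel"
  have Im: "?I \<in> borel_measurable lborel" by measurable
  have \<kappa>I: "(\<integral>\<^sup>+\<eta>. ennreal (\<kappa> \<eta>) \<partial>lborel) = ennreal (\<integral>\<eta>. \<kappa> \<eta> \<partial>lborel)"
    using \<kappa>(1) \<kappa>0 by (intro nn_integral_eq_integral) auto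
  show ?thesis
  proof (cases "q = \<infinity>")
    case True
    let ?e = "esssup lborel u"
    have e: "?e < \<infinity>" using fin True by (simp add: Lp_enorm_def)
    have ae: "AE \<eta> in lborel. u \<eta> \<le> ?e" by (rule esssup_AE)
    have "?I \<omega> \<le> ennreal (\<integral>\<eta>. \<kappa> \<eta> \<partial>lborel) * ?e" for \<omega>
    proof -
      have "AE \<eta> in distr lborel borel (\<lambda>x. \<omega> - x). u \<eta> \<le> ?e" using ae by (subst lborel_distr_reflect)
      then have "AE \<eta> in lborel. u (\<omega> - \<eta>) \<le> ?e" by (subst (asm) AE_distr_iff) auto
      then have "?I \<omega> \<le> (\<integral>\<^sup>+\<eta>. ennreal (\<kappa> \<eta>) * ?e \<partial>lborel)"
        by (intro nn_integral_mono_AE) (auto elim!: eventually_mono intro!: mult_left_mono)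
      also have "\<dots> = ennreal (\<integral>\<eta>. \<kappa> \<eta> \<partial>lborel) * ?e"
        by (subst nn_integral_multc) (auto simp: \<kappa>I)
      finally show ?thesis .
    qed
    then have "esssup lborel ?I \<le> ennreal (\<integral>\<eta>. \<kappa> \<eta> \<partial>lborel) * ?e"
      using Im by (intro esssup_I) auto
    also have "\<dots> < \<infinity>" using e by (simp add: ennreal_mult_less_top)
    finally show ?thesis using True by (simp add: Lp_enorm_def)
  next
    case False
    define r where "r = enn2real q"
    have r: "1 \<le> r"
    proof -
      have "enn2real 1 \<le> enn2real q" using q False by (intro enn2real_mono) (auto simp: less_top)
      then show ?thesis by (simp add: r_def)
    qed
    have fin': "(\<integral>\<^sup>+x. epowr (u x) r \<partial>lborel) < \<infinity>"
      using fin False by (simp add: Lp_enorm_def r_def epowr_less_top)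
    have "(\<integral>\<^sup>+\<omega>. epowr (?I \<omega>) r \<partial>lborel) \<le>
        (\<integral>\<^sup>+\<omega>. ennreal ((\<integral>x. \<kappa> x \<partial>lborel) powr (r - 1)) * (\<integral>\<^sup>+\<eta>. ennreal (\<kappa> \<eta>) * epowr (u (\<omega> - \<eta>)) r \<partial>lborel) \<partial>lborel)"
      by (intro nn_integral_mono epowr_nn_integral_le r \<kappa>) measurable
    also have "\<dots> = ennreal ((\<integral>x. \<kappa> x \<partial>lborel) powr (r - 1)) *
        (\<integral>\<^sup>+\<omega>. \<integral>\<^sup>+\<eta>. ennreal (\<kappa> \<eta>) * epowr (u (\<omega> - \<eta>)) r \<partial>lborel \<partial>lborel)"
      by (rule nn_integral_cmult) measurable
    also have "(\<integral>\<^sup>+\<omega>. \<integral>\<^sup>+\<eta>. ennreal (\<kappa> \<eta>) * epowr (u (\<omega> - \<eta>)) r \<partial>lborel \<partial>lborel) =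
        (\<integral>\<^sup>+\<eta>. \<integral>\<^sup>+\<omega>. ennreal (\<kappa> \<eta>) * epowr (u (\<omega> - \<eta>)) r \<partial>lborel \<partial>lborel)"
      by (rule lborel_pair.Fubini') measurable
    also have "\<dots> = (\<integral>\<^sup>+\<eta>. ennreal (\<kappa> \<eta>) * (\<integral>\<^sup>+x. epowr (u x) r \<partial>lborel) \<partial>lborel)"
    proof (rule nn_integral_cong)
      fix \<eta>
      have "(\<integral>\<^sup>+\<omega>. epowr (u (\<omega> - \<eta>)) r \<partial>lborel) = (\<integral>\<^sup>+x. epowr (u x) r \<partial>lborel)"
        using nn_integral_lborel_translate[of "\<lambda>x. epowr (u x) r" "- \<eta>"] by simp
      then show "(\<integral>\<^sup>+\<omega>. ennreal (\<kappa> \<eta>) * epowr (u (\<omega> - \<eta>)) r \<partial>lborel) = ennreal (\<kappa> \<eta>) * (\<integral>\<^sup>+x. epowr (u x) r \<partial>lborel)"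
        by (subst nn_integral_cmult) auto
    qed
    also have "\<dots> = ennreal (\<integral>x. \<kappa> x \<partial>lborel) * (\<integral>\<^sup>+x. epowr (u x) r \<partial>lborel)"
      by (subst nn_integral_multc) (auto simp: \<kappa>I)
    also have "ennreal ((\<integral>x. \<kappa> x \<partial>lborel) powr (r - 1)) * (ennreal (\<integral>x. \<kappa> x \<partial>lborel) * (\<integral>\<^sup>+x. epowr (u x) r \<partial>lborel)) < \<infinity>"
      using fin' by (simp add: ennreal_mult_less_top)
    finally show ?thesis using False by (simp add: Lp_enorm_def r_def epowr_less_top)
  qed
qed

lemma Lp_enorm_scale_finite:
  fixes u :: "'a \<Rightarrow> ennreal"
  assumes q: "1 \<le> q" and [measurable]: "u \<in> borel_measurable M" and fin: "Lp_enorm q M u < \<infinity>" and C: "0 \<le> C"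
  shows "Lp_enorm q M (\<lambda>x. ennreal C * u x) < \<infinity>"
proof (cases "q = \<infinity>")
  case True
  have "esssup M (\<lambda>x. ennreal C * u x) \<le> ennreal C * esssup M u"
    using esssup_AE[of u M] by (intro esssup_I) (auto elim!: eventually_mono intro!: mult_left_mono)
  also have "\<dots> < \<infinity>" using fin True by (simp add: Lp_enorm_def ennreal_mult_less_top)
  finally show ?thesis using True by (simp add: Lp_enorm_def)
next
  case False
  define r where "r = enn2real q"
  have "epowr (ennreal C * x) r \<le> ennreal (C powr r) * epowr x r" for x
  proof (cases x)
    case (real a)
    then show ?thesis using C by (simp add: ennreal_mult[symmetric] epowr_ennreal powr_mult)
  next
    case top
    show ?thesis
    proof (cases "C = 0")
      case True
      then show ?thesis by (simp add: epowr_def)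
    next
      case False
      then show ?thesis using C top by (simp add: epowr_def ennreal_mult_top)
    qed
  qed
  then have "(\<integral>\<^sup>+x. epowr (ennreal C * u x) r \<partial>M) \<le> (\<integral>\<^sup>+x. ennreal (C powr r) * epowr (u x) r \<partial>M)"
    by (intro nn_integral_mono)
  also have "\<dots> = ennreal (C powr r) * (\<integral>\<^sup>+x. epowr (u x) r \<partial>M)" by (rule nn_integral_cmult) measurable
  also have "\<dots> < \<infinity>" using fin False by (simp add: Lp_enorm_def r_def epowr_less_top ennreal_mult_less_top)
  finally show ?thesis using False by (simp add: Lp_enorm_def r_def epowr_less_top)
qed

lemma Lp_enorm_restrict_mono:
  fixes u v :: "'a \<Rightarrow> ennreal"
  assumes S: "S \<in> sets M" and v: "v \<in> borel_measurable M" and le: "\<And>x. x \<in> S \<Longrightarrow> v x \<le> u x"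
    and fin: "Lp_enorm q M u < \<infinity>"
  shows "Lp_enorm q (restrict_space M S) v < \<infinity>"
proof -
  have S': "S \<inter> space M \<in> sets M" using S by auto
  show ?thesis
  proof (cases "q = \<infinity>")
    case True
    have "AE x in restrict_space M S. v x \<le> esssup M u"
      unfolding AE_restrict_space_iff[OF S'] using esssup_AE[of u M]
      by eventually_elim (use le in \<open>auto intro: order_trans\<close>)
    then have "esssup (restrict_space M S) v \<le> esssup M u"
      using v by (intro esssup_I measurable_restrict_space1)
    also have "\<dots> < \<infinity>" using fin True by (simp add: Lp_enorm_def)
    finally show ?thesis using True by (simp add: Lp_enorm_def)
  next
    case False
    have "(\<integral>\<^sup>+x. epowr (v x) (enn2real q) \<partial>restrict_space M S) = (\<integral>\<^sup>+x. epowr (v x) (enn2real q) * indicator S x \<partial>M)"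
      by (rule nn_integral_restrict_space[OF S'])
    also have "\<dots> \<le> (\<integral>\<^sup>+x. epowr (u x) (enn2real q) \<partial>M)"
      by (intro nn_integral_mono) (auto simp: indicator_def intro!: epowr_mono le)
    also have "\<dots> < \<infinity>" using fin False by (simp add: Lp_enorm_def epowr_less_top)
    finally show ?thesis using False by (simp add: Lp_enorm_def epowr_less_top)
  qed
qed

section \<open>Localized Fourier transform of the Born--Jordan distribution\<close>

text \<open>The form \<open>symp \<zeta> z\<close> is the inner product of \<open>\<zeta>\<close>
  with \<open>(- snd z, fst z)\<close>, so this substitution turns a symplectic transform into an
  ordinary one. It is a swap composed with a reflection, and both preserve Lebesgue measure.\<close>

lemma integral_rotate:
  fixes G :: "'a::euclidean_space \<times> 'a \<Rightarrow> complex"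
  assumes [measurable]: "G \<in> borel_measurable borel"
  shows "(\<integral>z. G (- snd z, fst z) \<partial>lborel) = (\<integral>z. G z \<partial>lborel)"
proof -
  let ?L = "lborel \<Otimes>\<^sub>M lborel :: ('a \<times> 'a) measure"
  have Gm [measurable]: "G \<in> borel_measurable ?L" by (simp add: lborel_prod)
  have u: "distr lborel lborel uminus = (lborel :: 'a measure)"
    using lborel_distr_reflect[of "0 :: 'a"] by (simp cong: distr_cong)
  have i: "distr lborel lborel (\<lambda>x. x) = (lborel :: 'a measure)"
    using distr_id[of "lborel :: 'a measure"] by (simp add: id_def)
  have "distr lborel lborel uminus \<Otimes>\<^sub>M distr lborel lborel (\<lambda>x. x) = distr ?L ?L (\<lambda>(x, y). (- x, y))"
    by (intro pair_measure_distr) (simp_all add: i lborel.sigma_finite_measure_axioms)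
  then have n: "distr ?L ?L (\<lambda>(x, y). (- x, y)) = ?L" by (simp only: u i)
  have "(\<integral>z. G (- snd z, fst z) \<partial>lborel) = (\<integral>z. G (- snd z, fst z) \<partial>?L)" by (simp only: lborel_prod)
  also have "\<dots> = (\<integral>z. G (- fst z, snd z) \<partial>(distr ?L ?L (\<lambda>(x, y). (y, x))))"
    by (subst integral_distr) (auto simp: case_prod_unfold)
  also have "\<dots> = (\<integral>z. G (- fst z, snd z) \<partial>?L)" by (simp only: lborel_pair.distr_pair_swap[symmetric])
  also have "\<dots> = (\<integral>z. G z \<partial>(distr ?L ?L (\<lambda>(x, y). (- x, y))))"
    by (subst integral_distr) (auto simp: case_prod_unfold)
  also have "\<dots> = (\<integral>z. G z \<partial>?L)" by (simp only: n)
  also have "\<dots> = (\<integral>z. G z \<partial>lborel)" by (simp only: lborel_prod)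
  finally show ?thesis .
qed

lemma nsinc_minus: "nsinc (- t) = nsinc t"
  by (simp add: nsinc_def)

lemma continuous_nsinc: "continuous_on A nsinc"
proof -
  have "moderate (\<lambda>t::real. complex_of_real (nsinc t))"
    by (intro moderate_nsinc moderate_real_linear bounded_linear_ident)
  from continuous_on_Re[OF smooth_in_continuous[OF this]] show ?thesis by simp
qed

lemma continuous_qf: "continuous_on A qf"
  unfolding qf_def[abs_def] by (intro continuous_intros)

text \<open>In the variable \<open>\<xi> = (- snd z, fst z)\<close> the kernel is
  \<open>nsinc (qf \<xi>) ^ n\<close>, as sinc is even. The character at \<open>\<omega>\<close>
  shifts the transform of \<open>\<phi>\<close>; the substitution
  \<open>\<eta> = \<xi> + \<omega>\<close> hands this shift over to the kernel. The Schwartz factor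
  is thereby independent of \<open>\<omega>\<close>.\<close>

lemma localized_fourier_born_jordan:
  fixes f :: "'a::euclidean_space distr"
  assumes \<phi>: "schwartz \<phi>"
  shows "localized_fourier \<phi> (born_jordan n f) \<omega> =
    wigner f (\<lambda>x. ift (\<lambda>\<eta>. complex_of_real (nsinc (qf (\<eta> - \<omega>)) ^ n) * ift \<phi> (- \<eta>)) x * cis (- 2 * pi * (x \<bullet> \<omega>)))"
proof -
  have [measurable]: "\<phi> \<in> borel_measurable borel" "ift \<phi> \<in> borel_measurable borel"
    using schwartz_measurable[OF \<phi>] schwartz_measurable[OF schwartz_ift[OF \<phi>]] by auto
  have nm: "nsinc \<in> borel_measurable borel" by (intro borel_measurable_continuous_onI continuous_nsinc)
  have "distr_symp_fourier (distr_of_fun (bj_kernel n)) (\<lambda>y. \<phi> (x + y) * cis (- 2 * pi * ((x + y) \<bullet> \<omega>))) =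
      ift (\<lambda>\<eta>. complex_of_real (nsinc (qf (\<eta> - \<omega>)) ^ n) * ift \<phi> (- \<eta>)) x * cis (- 2 * pi * (x \<bullet> \<omega>))" for x
  proof -
    define G where "G \<xi> = complex_of_real (nsinc (qf \<xi>) ^ n) * (cis (2 * pi * (x \<bullet> \<xi>)) * ift \<phi> (- (\<xi> + \<omega>)))" for \<xi>
    have "continuous_on UNIV (\<lambda>\<xi>::'a \<times> 'a. nsinc (qf \<xi>))"
      by (rule continuous_on_compose2[OF continuous_nsinc[of UNIV] continuous_qf]) simp
    moreover have "continuous_on UNIV (\<lambda>\<xi>. ift \<phi> (- (\<xi> + \<omega>)))"
      by (rule continuous_on_compose2[OF schwartz_continuous[OF schwartz_ift[OF \<phi>], of UNIV]])
        (auto intro!: continuous_intros)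
    ultimately have cG: "continuous_on UNIV G"
      unfolding G_def[abs_def] by (intro continuous_intros continuous_on_cis)
    have Gm: "G \<in> borel_measurable borel" by (rule borel_measurable_continuous_onI[OF cG])
    have inner: "(\<integral>\<zeta>. cis (- 2 * pi * symp \<zeta> z) * (\<phi> (x + \<zeta>) * cis (- 2 * pi * ((x + \<zeta>) \<bullet> \<omega>))) \<partial>lborel) =
        cis (2 * pi * (x \<bullet> (- snd z, fst z))) * ift \<phi> (- ((- snd z, fst z) + \<omega>))" for z
    proof -
      let ?h = "\<lambda>\<zeta>. cis (2 * pi * (x \<bullet> (- snd z, fst z))) * (\<phi> \<zeta> * cis (2 * pi * ((- ((- snd z, fst z) + \<omega>)) \<bullet> \<zeta>)))"
      have "cis (- 2 * pi * symp \<zeta> z) * (\<phi> (x + \<zeta>) * cis (- 2 * pi * ((x + \<zeta>) \<bullet> \<omega>))) = ?h (\<zeta> + x)" for \<zeta>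
      proof -
        have "cis (- 2 * pi * symp \<zeta> z) * cis (- 2 * pi * ((x + \<zeta>) \<bullet> \<omega>)) =
            cis (2 * pi * (x \<bullet> (- snd z, fst z))) * cis (2 * pi * ((- ((- snd z, fst z) + \<omega>)) \<bullet> (\<zeta> + x)))"
          unfolding cis_mult by (rule arg_cong[where f = cis])
            (simp add: symp_def inner_prod_def inner_add_left inner_add_right inner_diff_left inner_diff_right
              inner_commute algebra_simps)
        then show ?thesis by (simp only: add.commute[of x] mult_ac)
      qed
      then have "(\<integral>\<zeta>. cis (- 2 * pi * symp \<zeta> z) * (\<phi> (x + \<zeta>) * cis (- 2 * pi * ((x + \<zeta>) \<bullet> \<omega>))) \<partial>lborel) =
          (\<integral>\<zeta>. ?h (\<zeta> + x) \<partial>lborel)" by (simp only:)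
      also have "\<dots> = (\<integral>\<zeta>. ?h \<zeta> \<partial>lborel)" by (rule lborel_translate(1)) measurable
      also have "\<dots> = cis (2 * pi * (x \<bullet> (- snd z, fst z))) * ift \<phi> (- ((- snd z, fst z) + \<omega>))"
        unfolding ift_def by (rule integral_mult_right_zero)
      finally show ?thesis .
    qed
    have bj: "bj_kernel n z = complex_of_real (nsinc (qf (- snd z, fst z)) ^ n)" for z :: "'a \<times> 'a"
      by (simp add: bj_kernel_def qf_def nsinc_minus inner_commute case_prod_unfold)
    have "distr_symp_fourier (distr_of_fun (bj_kernel n)) (\<lambda>y. \<phi> (x + y) * cis (- 2 * pi * ((x + y) \<bullet> \<omega>))) =
        (\<integral>z. G (- snd z, fst z) \<partial>lborel)"
      by (simp only: distr_symp_fourier_def distr_of_fun_def inner bj G_def)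
    also have "\<dots> = (\<integral>\<xi>. G \<xi> \<partial>lborel)" by (rule integral_rotate[OF Gm])
    also have "\<dots> = (\<integral>\<eta>. G (\<eta> + - \<omega>) \<partial>lborel)" by (rule lborel_translate(1)[OF Gm, symmetric])
    also have "\<dots> = (\<integral>\<eta>. (complex_of_real (nsinc (qf (\<eta> - \<omega>)) ^ n) * ift \<phi> (- \<eta>) * cis (2 * pi * (x \<bullet> \<eta>))) * cis (- 2 * pi * (x \<bullet> \<omega>)) \<partial>lborel)"
    proof (rule Bochner_Integration.integral_cong[OF refl])
      fix \<eta>
      have "cis (2 * pi * (x \<bullet> (\<eta> + - \<omega>))) = cis (2 * pi * (x \<bullet> \<eta>)) * cis (- 2 * pi * (x \<bullet> \<omega>))"
        by (simp add: cis_mult inner_diff_right algebra_simps)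
      moreover have "\<eta> + - \<omega> + \<omega> = \<eta>" "\<eta> + - \<omega> = \<eta> - \<omega>" by simp_all
      ultimately show "G (\<eta> + - \<omega>) = (complex_of_real (nsinc (qf (\<eta> - \<omega>)) ^ n) * ift \<phi> (- \<eta>) * cis (2 * pi * (x \<bullet> \<eta>))) * cis (- 2 * pi * (x \<bullet> \<omega>))"
        unfolding G_def by (simp only: mult_ac)
    qed
    also have "\<dots> = ift (\<lambda>\<eta>. complex_of_real (nsinc (qf (\<eta> - \<omega>)) ^ n) * ift \<phi> (- \<eta>)) x * cis (- 2 * pi * (x \<bullet> \<omega>))"
      unfolding ift_def[of "\<lambda>\<eta>. complex_of_real (nsinc (qf (\<eta> - \<omega>)) ^ n) * ift \<phi> (- \<eta>)"] by (rule integral_mult_left_zero)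
    finally show ?thesis .
  qed
  then show ?thesis by (simp only: localized_fourier_def born_jordan_def distr_conv_def)
qed

section \<open>The supremum of the short-time Fourier transform\<close>

lemma continuous_stft:
  fixes T :: "'a::euclidean_space distr"
  assumes T: "tempered T" and g: "schwartz g"
  shows "continuous_on UNIV (\<lambda>(x, \<omega>). stft g T x \<omega>)"
proof -
  have "continuous_on UNIV (\<lambda>p. T (\<lambda>y. (\<lambda>(p, y). cnj (g (y - fst p)) * cis (- 2 * pi * (y \<bullet> (0 - snd p)))) (p, y)))"
    by (rule continuous_tempered_family[OF T window_family[OF g]])
  then have "continuous_on UNIV (\<lambda>p. T (\<lambda>y. cnj (g (y - fst p)) * cis (- 2 * pi * (y \<bullet> (- snd p)))))" by simp
  from continuous_on_compose2[OF this, of UNIV "\<lambda>(x, \<omega>). (x, - \<omega>)"]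
  have "continuous_on UNIV (\<lambda>p. T (\<lambda>y. cnj (g (y - fst p)) * cis (- 2 * pi * (y \<bullet> (snd p)))))"
    by (simp add: case_prod_unfold continuous_intros)
  then show ?thesis by (simp add: stft_def case_prod_unfold)
qed

text \<open>The set where a continuous function exceeds its essential supremum is open and of
  measure 0, hence empty.\<close>

lemma le_esssup_continuous:
  fixes h :: "'a::euclidean_space \<Rightarrow> real"
  assumes h: "continuous_on UNIV h"
  shows "ennreal (h x) \<le> esssup lborel (\<lambda>x. ennreal (h x))"
proof (rule ccontr)
  let ?e = "esssup lborel (\<lambda>x. ennreal (h x))"
  let ?S = "{x. ?e < ennreal (h x)}"
  assume "\<not> ennreal (h x) \<le> ?e"
  then have "x \<in> ?S" by simp
  moreover have S: "open ?S"
    by (intro open_Collect_less continuous_on_const continuous_on_ennreal h)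
  ultimately obtain r where r: "r > 0" "ball x r \<subseteq> ?S" by (force simp: open_contains_ball)
  have "emeasure lborel ?S = 0"
    using esssup_zero_measure[of lborel "\<lambda>x. ennreal (h x)"] by simp
  then have "emeasure lborel (ball x r) = 0"
    using emeasure_mono[OF r(2), of lborel] S by simp
  then show False using content_ball_pos[OF r(1), of x] by (simp add: measure_def)
qed

text \<open>By continuity in position the essential supremum is a supremum over a countable dense
  set, and a countable supremum of functions continuous in \<open>\<omega>\<close> is
  measurable.\<close>

lemma esssup_stft_measurable:
  fixes T :: "'a::euclidean_space distr"
  assumes T: "tempered T" and g: "schwartz g"
  shows "(\<lambda>\<omega>. esssup lborel (\<lambda>x. ennreal (norm (stft g T x \<omega>)))) \<in> borel_measurable borel"
proof -
  obtain D :: "'a set" where D: "countable D" "\<And>X. open X \<Longrightarrow> X \<noteq> {} \<Longrightarrow> \<exists>d\<in>D. d \<in> X"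
    using countable_dense_exists by metis
  note c = continuous_stft[OF T g]
  have c1: "continuous_on UNIV (\<lambda>x. norm (stft g T x \<omega>))" for \<omega>
  proof -
    have "continuous_on UNIV (\<lambda>x::'a. (x, \<omega>))" by (intro continuous_intros)
    from continuous_on_compose2[OF c this] show ?thesis by (intro continuous_on_norm) simp
  qed
  have c2: "continuous_on UNIV (\<lambda>\<omega>. norm (stft g T x \<omega>))" for x
  proof -
    have "continuous_on UNIV (\<lambda>\<omega>::'a. (x, \<omega>))" by (intro continuous_intros)
    from continuous_on_compose2[OF c this] show ?thesis by (intro continuous_on_norm) simp
  qed
  have "esssup lborel (\<lambda>x. ennreal (norm (stft g T x \<omega>))) = (SUP x\<in>D. ennreal (norm (stft g T x \<omega>)))" (is "?e = ?s") for \<omega>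
  proof (rule antisym)
    have "ennreal (norm (stft g T x \<omega>)) \<le> ?s" for x
    proof (rule ccontr)
      let ?S = "{x. ?s < ennreal (norm (stft g T x \<omega>))}"
      assume "\<not> ennreal (norm (stft g T x \<omega>)) \<le> ?s"
      then have "x \<in> ?S" by simp
      moreover have "open ?S" by (intro open_Collect_less continuous_on_const continuous_on_ennreal c1)
      ultimately obtain d where "d \<in> D" "d \<in> ?S" using D(2)[of ?S] by blast
      then show False by (auto simp: not_le[symmetric] intro: SUP_upper)
    qed
    then show "?e \<le> ?s"
      using c1[of \<omega>] by (intro esssup_I) (auto intro!: borel_measurable_continuous_onI continuous_on_ennreal)
    show "?s \<le> ?e" by (intro SUP_least le_esssup_continuous c1)
  qed
  then show ?thesis
    by (simp only:) (intro borel_measurable_SUP D(1) borel_measurable_continuous_onI continuous_on_ennreal c2)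
qed

section \<open>Microlocal regularity\<close>

text \<open>This serves the measurability in \<open>\<omega>\<close> of the localized Fourier
  transform. By the reconstruction formula that transform is an integral of this kind, and
  \<open>\<omega>\<close> enters it through continuous functions only.\<close>

lemma amplitude_parameter_measurable:
  fixes F :: "'p::euclidean_space \<Rightarrow> 'a::euclidean_space \<Rightarrow> complex"
  assumes F: "continuous_on UNIV (\<lambda>z. F (fst z) (snd z))" and b: "continuous_on UNIV b"
    and V: "continuous_on UNIV (\<lambda>(x, \<omega>). V x \<omega>)" and l: "continuous_on UNIV l"
  shows "(\<lambda>\<omega>. \<integral>p. amplitude b (F \<omega>) p * (V (fst p) (l \<omega> - snd p) :: complex) \<partial>lborel) \<in> borel_measurable borel"
proof -
  have "(\<lambda>z :: ('p \<times> 'a \<times> 'a) \<times> 'a. F (fst (fst z)) (snd z) * b (snd (snd (fst z)) - snd z)) \<in> borel_measurable borel"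
    by (intro borel_measurable_continuous_onI continuous_intros continuous_on_compose2[OF b]
        continuous_on_compose2[OF F, of _ "\<lambda>z. (fst (fst z), snd z)", simplified]) auto
  moreover have "(\<lambda>p :: 'p \<times> 'a \<times> 'a. fst (snd p)) \<in> borel_measurable borel"
    by (intro borel_measurable_continuous_onI continuous_intros)
  ultimately have "(\<lambda>p :: 'p \<times> 'a \<times> 'a. ift (\<lambda>\<eta>. (\<lambda>z. F (fst (fst z)) (snd z) * b (snd (snd (fst z)) - snd z)) (p, \<eta>)) (fst (snd p))) \<in> borel_measurable borel"
    by (rule ift_measurable)
  moreover have "(\<lambda>p :: 'p \<times> 'a \<times> 'a. cis (- 2 * pi * (fst (snd p) \<bullet> snd (snd p)))) \<in> borel_measurable borel"
    by (intro borel_measurable_continuous_onI continuous_intros continuous_on_cis)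
  ultimately have "(\<lambda>p. amplitude b (F (fst p)) (snd p)) \<in> borel_measurable borel"
    unfolding amplitude_def by (auto intro: borel_measurable_times)
  moreover have "continuous_on UNIV (\<lambda>p :: 'p \<times> 'a \<times> 'a. (fst (snd p), l (fst p) - snd (snd p)))"
    by (intro continuous_intros continuous_on_compose2[OF l]) auto
  from continuous_on_compose2[OF V this]
  have "(\<lambda>p. V (fst (snd p)) (l (fst p) - snd (snd p))) \<in> borel_measurable borel"
    by (intro borel_measurable_continuous_onI) simp
  ultimately have "(\<lambda>p. amplitude b (F (fst p)) (snd p) * V (fst (snd p)) (l (fst p) - snd (snd p))) \<in> borel_measurable borel"
    by (rule borel_measurable_times)
  then have "(\<lambda>p. amplitude b (F (fst p)) (snd p) * V (fst (snd p)) (l (fst p) - snd (snd p))) \<in> borel_measurable (borel \<Otimes>\<^sub>M borel)"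
    by (subst borel_prod)
  then have "(\<lambda>(\<omega>, p). amplitude b (F \<omega>) p * V (fst p) (l \<omega> - snd p)) \<in> borel_measurable (borel \<Otimes>\<^sub>M lborel)"
    unfolding case_prod_unfold by (subst measurable_cong_sets[OF sets_pair_measure_cong[OF refl sets_lborel] refl])
  then show ?thesis by (rule lborel.borel_measurable_lebesgue_integral)
qed

lemma amp_norm_measurable [measurable]:
  fixes a :: "'a::euclidean_space \<Rightarrow> complex"
  assumes [measurable]: "a \<in> borel_measurable borel" "b \<in> borel_measurable borel"
  shows "amp_norm b a \<in> borel_measurable borel"
proof -
  have "(\<lambda>z :: ('a \<times> 'a) \<times> 'a. a (snd z) * b (fst (fst z) - snd z)) \<in> borel_measurable borel"
    unfolding borel_prod[symmetric] by measurable
  from ift_measurable[OF this borel_measurable_continuous_onI[OF continuous_on_snd[OF continuous_on_id]]]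
  have "(\<lambda>p :: 'a \<times> 'a. ift (\<lambda>\<eta>. a \<eta> * b (fst p - \<eta>)) (snd p)) \<in> borel_measurable (borel \<Otimes>\<^sub>M borel)"
    unfolding borel_prod by simp
  then have [measurable]: "(\<lambda>p :: 'a \<times> 'a. ift (\<lambda>\<eta>. a \<eta> * b (fst p - \<eta>)) (snd p)) \<in> borel_measurable (borel \<Otimes>\<^sub>M lborel)"
    by (subst measurable_cong_sets[OF sets_pair_measure_cong[OF refl sets_lborel] refl])
  have "(\<lambda>(\<eta>', x). ennreal (norm (ift (\<lambda>\<eta>. a \<eta> * b (\<eta>' - \<eta>)) x))) \<in> borel_measurable (borel \<Otimes>\<^sub>M lborel)"
    unfolding case_prod_unfold by measurable
  from lborel.borel_measurable_nn_integral[OF this] show ?thesis by (simp add: amp_norm_def[abs_def])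
qed

text \<open>Both \<open>qf\<close> and the squared norm are homogeneous of degree 2, so a lower
  bound for their ratio cuts out a cone. Half of the ratio at \<open>\<zeta>\<close> as threshold
  makes the inequality strict at \<open>\<zeta>\<close>.\<close>

lemma open_conic_nbhd_qf:
  fixes \<zeta> :: "'a::euclidean_space \<times> 'a"
  assumes "qf \<zeta> \<noteq> 0"
  obtains \<delta> where "0 < \<delta>" "open_conic_nbhd \<zeta> {\<omega>. \<omega> \<noteq> 0 \<and> \<delta> * (norm \<omega>)\<^sup>2 < \<bar>qf \<omega>\<bar>}"
proof -
  have \<zeta>: "\<zeta> \<noteq> 0" using assms by (auto simp: qf_def)
  define \<delta> where "\<delta> = \<bar>qf \<zeta>\<bar> / (2 * (norm \<zeta>)\<^sup>2)"
  have \<delta>: "0 < \<delta>" using assms \<zeta> by (simp add: \<delta>_def)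
  let ?S = "{\<omega>. \<omega> \<noteq> 0 \<and> \<delta> * (norm \<omega>)\<^sup>2 < \<bar>qf \<omega>\<bar>}"
  have "open ({\<omega>. \<omega> \<noteq> 0} \<inter> {\<omega>. \<delta> * (norm \<omega>)\<^sup>2 < \<bar>qf \<omega>\<bar>})"
    by (intro open_Int open_Collect_less open_Collect_neq continuous_intros continuous_qf)
  then have "open ?S" by (simp add: Collect_conj_eq)
  moreover have "\<zeta> \<in> ?S" using \<zeta> assms by (simp add: \<delta>_def)
  moreover have "t *\<^sub>R \<omega> \<in> ?S" if "\<omega> \<in> ?S" "0 < t" for \<omega> t
  proof -
    have "qf (t *\<^sub>R \<omega>) = t\<^sup>2 * qf \<omega>" by (simp add: qf_def power2_eq_square)
    moreover have "t\<^sup>2 * (\<delta> * (norm \<omega>)\<^sup>2) < t\<^sup>2 * \<bar>qf \<omega>\<bar>" using that by (intro mult_strict_left_mono) auto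
    ultimately show ?thesis using that by (simp add: power_mult_distrib abs_mult mult_ac)
  qed
  moreover have "0 \<notin> ?S" by simp
  ultimately have "open_conic_nbhd \<zeta> ?S" unfolding open_conic_nbhd_def by blast
  then show ?thesis using \<delta> by (rule that[rotated])
qed

text \<open>
  Near the origin the order zero estimate \<open>A \<le> C X\<close> is used, elsewhere the one gained from \<open>L\<close>,
  which is elliptic in the cone.
\<close>

lemma cone_weight_bound:
  fixes A C D \<delta> L t x :: real
  assumes "0 \<le> A" "0 \<le> C" "0 \<le> D" "0 \<le> x" "0 < \<delta>" "0 \<le> t" and L: "\<delta> * t\<^sup>2 \<le> \<bar>L\<bar>"
    and 1: "A \<le> C * x" and 2: "L ^ (2 * n) * A \<le> D * (1 + t) ^ (2 * n) * x"
  shows "A * (1 + t\<^sup>2) ^ n \<le> (2 ^ n * C + 2 ^ n * (4 ^ n * D / \<delta> ^ (2 * n))) * x"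
proof (cases "t \<le> 1")
  case True
  then have "(1 + t\<^sup>2) ^ n \<le> 2 ^ n" using \<open>0 \<le> t\<close> by (intro power_mono) (auto simp: power_le_one)
  then have "A * (1 + t\<^sup>2) ^ n \<le> (C * x) * 2 ^ n" using assms by (intro mult_mono) auto
  also have "\<dots> \<le> (2 ^ n * C + 2 ^ n * (4 ^ n * D / \<delta> ^ (2 * n))) * x"
    using assms by (simp add: algebra_simps)
  finally show ?thesis .
next
  case False
  then have t: "1 < t" by simp
  have p: "0 < \<delta> ^ (2 * n) * t ^ (2 * n)" using t assms by simp
  have "(\<delta> * t\<^sup>2) ^ (2 * n) \<le> \<bar>L\<bar> ^ (2 * n)" using L assms by (intro power_mono) auto
  then have "(\<delta> * t\<^sup>2) ^ (2 * n) * A \<le> L ^ (2 * n) * A"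
    using \<open>0 \<le> A\<close> by (intro mult_right_mono) (simp_all add: power_even_abs)
  also have "\<dots> \<le> D * (1 + t) ^ (2 * n) * x" by (rule 2)
  \<comment> \<open>For \<open>t > 1\<close> one has \<open>1 + t \<le> 2 * t\<close>, whose
    \<open>2 * n\<close> powers are the source of \<open>4 ^ n\<close>. The factor
    \<open>2 ^ n\<close> comes from \<open>1 + t^2 \<le> 2 * t^2\<close> at the end.\<close>
  also have "\<dots> \<le> D * (2 * t) ^ (2 * n) * x"
    using t assms by (intro mult_right_mono mult_left_mono power_mono) auto
  finally have 4: "(\<delta> * t\<^sup>2) ^ (2 * n) * A \<le> D * (2 * t) ^ (2 * n) * x" .
  have "(\<delta> ^ (2 * n) * t ^ (2 * n)) * (t ^ (2 * n) * A) \<le> (\<delta> ^ (2 * n) * t ^ (2 * n)) * ((4 ^ n * D / \<delta> ^ (2 * n)) * x)"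
  proof -
    have "(2 * t) ^ (2 * n) = 4 ^ n * t ^ (2 * n)" by (simp only: power_mult_distrib power_mult) simp
    moreover have "(\<delta> * t\<^sup>2) ^ (2 * n) = (\<delta> ^ (2 * n) * t ^ (2 * n)) * t ^ (2 * n)"
      by (simp add: power_mult_distrib power_mult[symmetric] power_add[symmetric])
    moreover have "\<delta> ^ (2 * n) * (4 ^ n * D / \<delta> ^ (2 * n)) = 4 ^ n * D" using \<open>0 < \<delta>\<close> by simp
    then have "(\<delta> ^ (2 * n) * t ^ (2 * n)) * ((4 ^ n * D / \<delta> ^ (2 * n)) * x) = D * (4 ^ n * t ^ (2 * n)) * x"
      by (simp only: mult_ac) (metis mult.assoc mult.commute)
    ultimately show ?thesis using 4 by (simp only: mult.assoc)
  qed
  then have 3: "t ^ (2 * n) * A \<le> (4 ^ n * D / \<delta> ^ (2 * n)) * x" using p by (simp only: mult_le_cancel_left_pos)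
  have "(1 + t\<^sup>2) ^ n \<le> (2 * t\<^sup>2) ^ n" using t by (intro power_mono) (auto simp: one_le_power)
  then have "A * (1 + t\<^sup>2) ^ n \<le> A * (2 * t\<^sup>2) ^ n" using \<open>0 \<le> A\<close> by (rule mult_left_mono)
  also have "\<dots> = 2 ^ n * (t ^ (2 * n) * A)" by (simp only: power_mult_distrib power_mult) (simp only: mult_ac)
  also have "\<dots> \<le> 2 ^ n * ((4 ^ n * D / \<delta> ^ (2 * n)) * x)" using 3 by (rule mult_left_mono) simp
  also have "\<dots> \<le> (2 ^ n * C + 2 ^ n * (4 ^ n * D / \<delta> ^ (2 * n))) * x"
    using assms by (simp add: algebra_simps)
  finally show ?thesis .
qed

lemma jbracket_powr: "jbracket \<omega> powr (2 * real n) = (1 + (norm \<omega>)\<^sup>2) ^ n"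
proof -
  have "0 < 1 + (norm \<omega>)\<^sup>2" by (intro add_pos_nonneg) auto
  then have "jbracket \<omega> powr real (2 * n) = jbracket \<omega> ^ (2 * n)"
    by (intro powr_realpow) (simp add: jbracket_def)
  also have "\<dots> = (1 + (norm \<omega>)\<^sup>2) ^ n" using \<open>0 < 1 + (norm \<omega>)\<^sup>2\<close> by (simp add: jbracket_def power_mult)
  finally show ?thesis by simp
qed

theorem theorem1p3:
  fixes n :: nat and q :: ennreal
    and f :: "(real ^ 'd) distr"
    and z :: "(real ^ 'd) \<times> (real ^ 'd)"
    and \<zeta>\<^sub>1 \<zeta>\<^sub>2 :: "real ^ 'd"
  assumes "n \<ge> 1" and "1 \<le> q"
    and "tempered f"
    and "wigner f \<in> modulation_space \<infinity> q"
    and "\<zeta>\<^sub>1 \<bullet> \<zeta>\<^sub>2 \<noteq> 0"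
  shows "(z, (\<zeta>\<^sub>1, \<zeta>\<^sub>2)) \<notin> WF_FL q (2 * real n) (born_jordan n f)"
proof -
  let ?W = "wigner f"
  obtain g where W: "tempered ?W" and g: "schwartz g" "g \<noteq> (\<lambda>_. 0)" and fin: "modulation_norm g \<infinity> q ?W < \<infinity>"
    using assms(4) by (auto simp: modulation_space_def)
  obtain \<phi> where \<phi>: "test_fun \<phi>" "\<phi> z \<noteq> 0" using exists_test_fun by blast
  have \<phi>s: "schwartz \<phi>" using \<phi>(1) by (rule test_fun_schwartz)
  \<comment> \<open>The reflected inverse transform is the Fourier transform of
    \<open>\<phi>\<close>, the Schwartz factor common to all amplitudes.\<close>
  define \<theta> where "\<theta> \<eta> = ift \<phi> (- \<eta>)" for \<eta>
  have \<theta>: "schwartz \<theta>" unfolding \<theta>_def[abs_def] by (intro schwartz_reflect schwartz_ift \<phi>s)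
  obtain b where b: "schwartz b" and c: "(\<integral>y. ift b y * cnj (g y) \<partial>lborel) \<noteq> 0" by (rule dual_window[OF g])
  define c where "c = (\<integral>y. ift b y * cnj (g y) \<partial>lborel)"
  have c0: "0 < norm c" using c by (simp add: c_def)
  define u where "u \<omega> = esssup lborel (\<lambda>x. ennreal (norm (stft g ?W x \<omega>)))" for \<omega>
  have um [measurable]: "u \<in> borel_measurable borel" unfolding u_def[abs_def] by (rule esssup_stft_measurable[OF W g(1)])
  have ule: "ennreal (norm (stft g ?W x \<omega>)) \<le> u \<omega>" for x \<omega>
  proof -
    have "continuous_on UNIV (\<lambda>x. (x, \<omega>))" by (intro continuous_intros)
    from continuous_on_compose2[OF continuous_stft[OF W g(1)] this]
    have "continuous_on UNIV (\<lambda>x. norm (stft g ?W x \<omega>))" by (intro continuous_on_norm) simp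
    then show ?thesis unfolding u_def by (rule le_esssup_continuous)
  qed
  have ufin: "Lp_enorm q lborel u < \<infinity>"
  proof -
    have "(\<lambda>\<omega>. Lp_enorm \<infinity> lborel (\<lambda>x. ennreal (norm (stft g ?W x \<omega>)))) = u" by (simp add: fun_eq_iff Lp_enorm_def u_def)
    then show ?thesis using fin by (simp only: modulation_norm_def)
  qed
  \<comment> \<open>The frequency decay furnished by the multiplier bounds. It is integrable and
    strictly positive, as a kernel for Young's inequality has to be here.\<close>
  define \<kappa> where "\<kappa> \<eta> = 1 / (1 + norm \<eta>) ^ (2 * DIM((real ^ 'd) \<times> (real ^ 'd)))" for \<eta> :: "(real ^ 'd) \<times> (real ^ 'd)"
  have \<kappa>i: "integrable lborel \<kappa>" unfolding \<kappa>_def[abs_def] by (rule integrable_decay) simp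
  have \<kappa>pos: "0 < \<kappa> \<eta>" for \<eta> unfolding \<kappa>_def by (intro divide_pos_pos zero_less_power add_pos_nonneg) auto
  have \<kappa>0: "0 \<le> \<kappa> \<eta>" for \<eta> using \<kappa>pos[of \<eta>] by simp
  have \<kappa>I: "0 < (\<integral>\<eta>. \<kappa> \<eta> \<partial>lborel)"
  proof (rule ccontr)
    assume "\<not> 0 < (\<integral>\<eta>. \<kappa> \<eta> \<partial>lborel)"
    then have "(\<integral>\<eta>. \<kappa> \<eta> \<partial>lborel) = 0" using integral_nonneg_AE[of \<kappa> lborel] \<kappa>0 by (simp add: antisym not_less)
    then have "AE \<eta> in lborel. \<kappa> \<eta> = 0" using integral_nonneg_eq_0_iff_AE[OF \<kappa>i] \<kappa>0 by simp
    then have "AE \<eta> in (lborel :: ((real ^ 'd) \<times> (real ^ 'd)) measure). False" by (rule eventually_mono) (use \<kappa>pos in \<open>simp add: less_imp_neq[symmetric]\<close>)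
    then show False using AE_iff_measurable[of "UNIV :: ((real ^ 'd) \<times> (real ^ 'd)) set" lborel "\<lambda>_. False"] by simp
  qed
  define X where "X \<omega> = (\<integral>\<^sup>+\<eta>. ennreal (\<kappa> \<eta>) * u (\<omega> - \<eta>) \<partial>lborel)" for \<omega>
  have Xfin: "Lp_enorm q lborel X < \<infinity>"
    unfolding X_def[abs_def] by (rule Lp_enorm_convolution_finite[OF assms(2) \<kappa>i \<kappa>pos \<kappa>I um ufin])
  have \<kappa>m [measurable]: "\<kappa> \<in> borel_measurable borel" using \<kappa>i by simp
  have Xm: "X \<in> borel_measurable lborel" unfolding X_def[abs_def] by measurable
  define a where "a \<omega> \<eta> = complex_of_real (nsinc (qf (\<eta> - \<omega>)) ^ n) * \<theta> \<eta>" for \<omega> \<eta>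
  note mult = multiplier_nsinc_power[OF b \<theta>, of n]
  have as: "schwartz (a \<omega>)" for \<omega>
    unfolding a_def[abs_def] by (rule schwartz_mult'[OF multiplier_moderate[OF b \<theta> mult] \<theta>])
  have am: "a \<omega> \<in> borel_measurable borel" for \<omega> by (rule schwartz_measurable[OF as])
  define Q where "Q \<omega> = localized_fourier \<phi> (born_jordan n f) \<omega>" for \<omega>
  have Q: "Q \<omega> = ?W (\<lambda>x. ift (a \<omega>) x * cis (- 2 * pi * (x \<bullet> \<omega>)))" for \<omega>
    unfolding Q_def localized_fourier_born_jordan[OF \<phi>s] a_def[abs_def] \<theta>_def ..
  have est: "ennreal (norm c * norm (Q \<omega>)) \<le> (\<integral>\<^sup>+\<eta>'. amp_norm b (a \<omega>) \<eta>' * u (\<omega> - \<eta>') \<partial>lborel)" for \<omega>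
    unfolding c_def Q by (rule stft_estimate[OF W g(1) as b um ule])
  obtain C where C: "0 \<le> C" "\<And>\<omega> \<eta>'. amp_norm b (a \<omega>) \<eta>' \<le> ennreal (C * \<kappa> \<eta>')"
  proof -
    obtain C where "0 \<le> C" "\<And>\<omega> \<eta>'. amp_norm b (\<lambda>\<eta>. complex_of_real (nsinc (qf (\<eta> - \<omega>)) ^ n) * \<theta> \<eta>) \<eta>' \<le>
        ennreal (C * (1 + norm \<omega>) ^ 0 * (1 / (1 + norm \<eta>') ^ (2 * DIM((real ^ 'd) \<times> (real ^ 'd)))))"
      using multiplier_bound[OF b \<theta> mult] by blast
    then show ?thesis by (intro that[of C]) (simp_all only: a_def[abs_def] \<kappa>_def power_0 mult_1_right)
  qed
  \<comment> \<open>The gain: \<open>qf \<omega> ^ (2 * n)\<close> is of order \<open>4 * n\<close>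
    in the cone, but only \<open>2 * n\<close> powers of \<open>1 + norm \<omega>\<close> appear on
    the right.\<close>
  obtain D where D: "0 \<le> D" "\<And>\<omega> \<eta>'. ennreal (qf \<omega> ^ (2 * n)) * amp_norm b (a \<omega>) \<eta>' \<le> ennreal (D * (1 + norm \<omega>) ^ (2 * n) * \<kappa> \<eta>')"
  proof -
    obtain D where D: "0 \<le> D" "\<And>\<omega> \<eta>'. amp_norm b (\<lambda>\<eta>. complex_of_real (qf \<omega> ^ (2 * n) * nsinc (qf (\<eta> - \<omega>)) ^ n) * \<theta> \<eta>) \<eta>' \<le>
        ennreal (D * (1 + norm \<omega>) ^ (2 * n) * (1 / (1 + norm \<eta>') ^ (2 * DIM((real ^ 'd) \<times> (real ^ 'd)))))"
      using multiplier_bound[OF b \<theta> multiplier_qf_nsinc_power[OF b \<theta>, of n]] by blast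
    have "ennreal (qf \<omega> ^ (2 * n)) * amp_norm b (a \<omega>) \<eta>' \<le> ennreal (D * (1 + norm \<omega>) ^ (2 * n) * \<kappa> \<eta>')" for \<omega> \<eta>'
    proof -
      have "norm (complex_of_real (qf \<omega> ^ (2 * n))) = qf \<omega> ^ (2 * n)"
        by (simp only: norm_of_real) (simp add: power_mult)
      then have "ennreal (qf \<omega> ^ (2 * n)) * amp_norm b (a \<omega>) \<eta>' = amp_norm b (\<lambda>\<eta>. complex_of_real (qf \<omega> ^ (2 * n)) * a \<omega> \<eta>) \<eta>'"
        using amp_norm_scale[OF am schwartz_measurable[OF b], of "complex_of_real (qf \<omega> ^ (2 * n))"] by (simp only:)
      also have "(\<lambda>\<eta>. complex_of_real (qf \<omega> ^ (2 * n)) * a \<omega> \<eta>) =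
          (\<lambda>\<eta>. complex_of_real (qf \<omega> ^ (2 * n) * nsinc (qf (\<eta> - \<omega>)) ^ n) * \<theta> \<eta>)"
        by (simp only: a_def of_real_mult mult.assoc)
      finally show ?thesis using D(2)[of \<omega> \<eta>'] by (simp only: \<kappa>_def)
    qed
    then show ?thesis by (rule that[OF D(1)])
  qed
  have E1: "ennreal (norm c * norm (Q \<omega>)) \<le> ennreal C * X \<omega>" for \<omega>
  proof -
    have "(\<integral>\<^sup>+\<eta>'. amp_norm b (a \<omega>) \<eta>' * u (\<omega> - \<eta>') \<partial>lborel) \<le> (\<integral>\<^sup>+\<eta>'. ennreal C * (ennreal (\<kappa> \<eta>') * u (\<omega> - \<eta>')) \<partial>lborel)"
      using mult_right_mono[OF C(2)] C(1) \<kappa>0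
      by (intro nn_integral_mono) (simp add: ennreal_mult mult.assoc[symmetric])
    also have "\<dots> = ennreal C * X \<omega>" unfolding X_def by (rule nn_integral_cmult) measurable
    finally show ?thesis using est order_trans by blast
  qed
  have E2: "ennreal (qf \<omega> ^ (2 * n)) * ennreal (norm c * norm (Q \<omega>)) \<le> ennreal (D * (1 + norm \<omega>) ^ (2 * n)) * X \<omega>" for \<omega>
  proof -
    have D0: "0 \<le> D * (1 + norm \<omega>) ^ (2 * n)" using D(1) by simp
    have m: "(\<lambda>\<eta>'. amp_norm b (a \<omega>) \<eta>' * u (\<omega> - \<eta>')) \<in> borel_measurable lborel"
    proof (rule borel_measurable_times_ennreal)
      show "amp_norm b (a \<omega>) \<in> borel_measurable lborel"
        using amp_norm_measurable[OF am schwartz_measurable[OF b]] by simp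
      have "(\<lambda>\<eta>'. \<omega> - \<eta>') \<in> borel_measurable borel" by measurable
      from measurable_compose[OF this, of u borel] um
      show "(\<lambda>\<eta>'. u (\<omega> - \<eta>')) \<in> borel_measurable lborel" by simp
    qed
    have "ennreal (qf \<omega> ^ (2 * n)) * ennreal (norm c * norm (Q \<omega>)) \<le>
        ennreal (qf \<omega> ^ (2 * n)) * (\<integral>\<^sup>+\<eta>'. amp_norm b (a \<omega>) \<eta>' * u (\<omega> - \<eta>') \<partial>lborel)"
      by (rule mult_left_mono[OF est]) simp
    also have "\<dots> = (\<integral>\<^sup>+\<eta>'. ennreal (qf \<omega> ^ (2 * n)) * (amp_norm b (a \<omega>) \<eta>' * u (\<omega> - \<eta>')) \<partial>lborel)"
      by (rule nn_integral_cmult[OF m, symmetric])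
    also have "\<dots> \<le> (\<integral>\<^sup>+\<eta>'. ennreal (D * (1 + norm \<omega>) ^ (2 * n)) * (ennreal (\<kappa> \<eta>') * u (\<omega> - \<eta>')) \<partial>lborel)"
    proof (rule nn_integral_mono)
      fix \<eta>'
      show "ennreal (qf \<omega> ^ (2 * n)) * (amp_norm b (a \<omega>) \<eta>' * u (\<omega> - \<eta>')) \<le>
          ennreal (D * (1 + norm \<omega>) ^ (2 * n)) * (ennreal (\<kappa> \<eta>') * u (\<omega> - \<eta>'))"
        unfolding mult.assoc[symmetric, where 'a = ennreal] ennreal_mult[OF D0 \<kappa>0, symmetric]
        by (rule mult_right_mono[OF D(2) zero_le])
    qed
    also have "\<dots> = ennreal (D * (1 + norm \<omega>) ^ (2 * n)) * X \<omega>" unfolding X_def by (rule nn_integral_cmult) measurable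
    finally show ?thesis .
  qed
  have "qf (\<zeta>\<^sub>1, \<zeta>\<^sub>2) \<noteq> 0" using assms(5) by (simp add: qf_def)
  then obtain \<delta> where \<delta>: "0 < \<delta>" and cone: "open_conic_nbhd (\<zeta>\<^sub>1, \<zeta>\<^sub>2) {\<omega>. \<omega> \<noteq> 0 \<and> \<delta> * (norm \<omega>)\<^sup>2 < \<bar>qf \<omega>\<bar>}" (is "open_conic_nbhd _ ?\<Gamma>")
    by (rule open_conic_nbhd_qf)
  \<comment> \<open>The constant of \<open>cone_weight_bound\<close>, divided by the pairing of
    window and dual window, since the estimates bound
    \<open>norm c * norm (Q \<omega>)\<close>.\<close>
  define B where "B = (2 ^ n * C + 2 ^ n * (4 ^ n * D / \<delta> ^ (2 * n))) / norm c"
  have B0: "0 \<le> B" using C(1) D(1) \<delta> by (simp add: B_def)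
  let ?v = "\<lambda>\<omega>. ennreal (norm (Q \<omega>) * jbracket \<omega> powr (2 * real n))"
  \<comment> \<open>The constant is \<open>B + 1\<close> to be strictly positive: where
    \<open>X \<omega>\<close> is infinite the right-hand side must be infinite, but 0 times infinity
    is 0 in \<open>ennreal\<close>.\<close>
  have le: "?v \<omega> \<le> ennreal (B + 1) * X \<omega>" if \<omega>: "\<omega> \<in> ?\<Gamma>" for \<omega>
  proof (cases "X \<omega>")
    case (real x)
    have A: "norm c * norm (Q \<omega>) * (1 + (norm \<omega>)\<^sup>2) ^ n \<le> (2 ^ n * C + 2 ^ n * (4 ^ n * D / \<delta> ^ (2 * n))) * x"
    proof (rule cone_weight_bound)
      show "norm c * norm (Q \<omega>) \<le> C * x"
        using E1[of \<omega>] real C(1) by (simp add: ennreal_mult[symmetric])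
      show "qf \<omega> ^ (2 * n) * (norm c * norm (Q \<omega>)) \<le> D * (1 + norm \<omega>) ^ (2 * n) * x"
        using E2[of \<omega>] real D(1) by (simp add: ennreal_mult[symmetric] power_mult)
    qed (use \<omega> C D \<delta> real in auto)
    then have "norm (Q \<omega>) * (1 + (norm \<omega>)\<^sup>2) ^ n \<le> B * x"
      using c0 by (simp add: B_def field_simps)
    also have "\<dots> \<le> (B + 1) * x" using real by (simp add: algebra_simps)
    finally have "?v \<omega> \<le> ennreal ((B + 1) * x)" unfolding jbracket_powr by (rule ennreal_leI)
    also have "\<dots> = ennreal (B + 1) * ennreal x" using real B0 by (intro ennreal_mult) auto
    finally show ?thesis by (simp only: real(2))
  next
    case top
    then show ?thesis using B0 by (simp add: ennreal_mult_top)
  qed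
  \<comment> \<open>Measurability is read off the reconstruction formula, divided by the nonzero
    constant \<open>c\<close>.\<close>
  have Qm: "Q \<in> borel_measurable borel"
  proof -
    have "continuous_on UNIV (\<lambda>z :: ((real ^ 'd) \<times> (real ^ 'd)) \<times> ((real ^ 'd) \<times> (real ^ 'd)). nsinc (qf (snd z - fst z)))"
      by (rule continuous_on_compose2[OF continuous_nsinc[of UNIV] continuous_on_compose2[OF continuous_qf[of UNIV]]])
        (auto intro!: continuous_intros)
    then have "continuous_on UNIV (\<lambda>z. a (fst z) (snd z))"
      unfolding a_def
      by (intro continuous_intros continuous_on_compose2[OF schwartz_continuous[OF \<theta>, of UNIV]]) auto
    from amplitude_parameter_measurable[OF this schwartz_continuous[OF b] continuous_stft[OF W g(1)] continuous_on_id]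
    have m: "(\<lambda>\<omega>. \<integral>p. amplitude b (a \<omega>) p * stft g ?W (fst p) (\<omega> - snd p) \<partial>lborel) \<in> borel_measurable borel" .
    have Qeq: "Q = (\<lambda>\<omega>. (1 / c) * (\<integral>p. amplitude b (a \<omega>) p * stft g ?W (fst p) (\<omega> - snd p) \<partial>lborel))"
      unfolding fun_eq_iff Q stft_reconstruction(1)[OF W g(1) as b, symmetric] c_def[symmetric] using c0 by simp
    show ?thesis unfolding Qeq by (rule borel_measurable_times[OF borel_measurable_const m])
  qed
  have vm: "?v \<in> borel_measurable lborel"
    unfolding jbracket_powr using Qm by measurable
  have \<Gamma>: "?\<Gamma> \<in> sets lborel" using cone by (auto simp: open_conic_nbhd_def)
  have "Lp_enorm q (restrict_space lborel ?\<Gamma>) ?v < \<infinity>"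
    by (rule Lp_enorm_restrict_mono[OF \<Gamma> vm le Lp_enorm_scale_finite[OF assms(2) Xm Xfin]]) (use B0 in auto)
  then show ?thesis
    unfolding WF_FL_def Q_def using \<phi> cone by blast
qed

end
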